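(* Let $f:\mathbb{R}^{n_1\times\cdots\times n_d}\to\mathbb{R}$ be continuously differentiable with locally Lipschitz continuous gradient, bounded below by $f^*\in\mathbb{R}$ on $\mathcal{M}_{\leq\mathbf{r}}$, and such that the sublevel set $\{\mathcal{X}\in\mathcal{M}_{\leq\mathbf{r}}:f(\mathcal{X})\leq f(\mathcal{X}^{(0)})\}$ is compact. Let $\{\mathcal{X}^{(t)}\}$ be a sequence generated by the GRAP-R method from the initial guess $\mathcal{X}^{(0)}\in\mathcal{M}_{\leq\mathbf{r}}$. If $\{\mathcal{X}^{(t)}\}$ is finite, the method terminates at a stationary point of $f$ on $\mathcal{M}_{\leq\mathbf{r}}$. Otherwise, $\{\mathcal{X}^{(t)}\}$ has an accumulation point, and any accumulation point of $\{\mathcal{X}^{(t)}\}$ is stationary.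
   Context: Notation. $d,n_1,\dots,n_d$ are positive integers, $[d]=\{1,\dots,d\}$, $n_{-k}=\prod_{i\ne k}n_i$, and $\mathbf{r}=(r_1,\dots,r_d)$ are positive integers with $r_k\le\min\{n_k,n_{-k}\}$. The mode-$k$ unfolding $\mathbf{X}_{(k)}\in\mathbb{R}^{n_k\times n_{-k}}$ of $\mathcal{X}$ has the mode-$k$ fibers as columns; $\mathrm{ten}_{(k)}$ is the inverse of mode-$k$ unfolding; $(\mathcal{X}\times_k\mathbf{A})_{(k)}=\mathbf{A}\mathbf{X}_{(k)}$ defines the $k$-mode product. $\langle\cdot,\cdot\rangle$, $\|\cdot\|_{\mathrm{F}}$ are the entrywise inner product and Frobenius norm. $\mathrm{St}(r,n)=\{\mathbf{X}\in\mathbb{R}^{n\times r}:\mathbf{X}^\top\mathbf{X}=\mathbf{I}_r\}$; for $\mathbf{S}$ with orthonormal columns, $\mathrm{P}_{\mathbf{S}}=\mathbf{S}\mathbf{S}^\top$, $\mathrm{P}_{\mathbf{S}}^\perp=\mathbf{I}-\mathbf{S}\mathbf{S}^\top$. Tucker rank: $\mathrm{rank}_{\mathrm{tc}}(\mathcal{X})=(\mathrm{rank}(\mathbf{X}_{(k)}))_{k=1}^d$; $\mathcal{M}_{\leq\mathbf{r}}=\{\mathcal{X}:\mathrm{rank}_{\mathrm{tc}}(\mathcal{X})\leq\mathbf{r}\}$. A tensor of Tucker rank $\underline{\mathbf{r}}$ has a Tucker decomposition $\mathcal{X}=\mathcal{G}\times_{k=1}^d\mathbf{U}_k$, $\mathcal{G}\in\mathbb{R}^{\underline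 r_1\times\cdots\times\underline r_d}$, $\mathbf{U}_k\in\mathrm{St}(\underline r_k,n_k)$ (empty if $\underline r_k=0$), and $\mathbf{G}_{(k)}^\dagger=\mathbf{G}_{(k)}^\top(\mathbf{G}_{(k)}\mathbf{G}_{(k)}^\top)^{-1}$. Stationarity. $\mathcal{X}\in\mathcal{M}_{\leq\mathbf{r}}$ is stationary if $\|\mathrm{P}_{\mathrm{T}_{\mathcal{X}}\mathcal{M}_{\leq\mathbf{r}}}(-\nabla f(\mathcal{X}))\|_{\mathrm{F}}=0$, where $\mathrm{T}_{\mathcal{X}}\mathcal{M}_{\leq\mathbf{r}}$ is the Bouligand tangent cone and $\mathrm{P}$ the metric projection onto it. HOSVD. For $\mathbf{s}=(s_1,\dots,s_d)$, $\mathrm{P}_{\leq\mathbf{s}}^{\mathrm{HO}}(\mathcal{A})=\mathrm{P}_{\leq s_d}^d(\cdots(\mathrm{P}_{\leq s_1}^1(\mathcal{A})))$, where $\mathrm{P}_{\leq s}^k(\mathcal{A})=\mathrm{ten}_{(k)}(\mathrm{P}_{\leq s}(\mathbf{A}_{(k)}))$ and $\mathrm{P}_{\leq s}(\mathbf{A})$ is a best Frobenius-norm approximation of $\mathbf{A}$ of rank at most $s$ (truncated SVD). Approximate projection. For $\mathcal{X}=\mathcal{G}\times_{k=1}^d\mathbf{U}_k$ of Tucker rank $\underline{\mathbf{r}}\leq\mathbf{r}$, $I=\{k:\underline r_k<r_k\}$, and a tensor $\mathcal{A}$, choose $\tilde{\mathbf{U}}_{k,1}\in\mathrm{St}(r_k-\underline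 r_k,n_k)$, $k\in I$, with $\mathbf{U}_k^\top\tilde{\mathbf{U}}_{k,1}=0$ and $\|\mathcal{A}\times_{k\in I}\mathrm{P}_{[\mathbf{U}_k\ \tilde{\mathbf{U}}_{k,1}]}\times_{k\notin I}\mathrm{P}_{\mathbf{U}_k}\|_{\mathrm{F}}\geq\|\mathcal{A}\times_{k\notin I}\mathrm{P}_{\mathbf{U}_k}\|_{\mathrm{F}}\prod_{k\in I}\sqrt{(r_k-\underline r_k)/\min\{n_k,n_{-k}\}}$ (possible via SVD). With $\tilde{\mathbf{S}}_k=[\mathbf{U}_k\ \tilde{\mathbf{U}}_{k,1}]$ for $k\in I$ and $\tilde{\mathbf{S}}_k=\mathbf{U}_k$ otherwise, $$\tilde{\mathrm{P}}_{\mathrm{T}_{\mathcal{X}}\mathcal{M}_{\leq\mathbf{r}}}(\mathcal{A})=\mathcal{A}\times_{k=1}^d\mathrm{P}_{\tilde{\mathbf{S}}_k}+\sum_{k=1}^d\mathcal{G}\times_k\big(\mathrm{P}^\perp_{\tilde{\mathbf{S}}_k}(\mathcal{A}\times_{j\neq k}\mathbf{U}_j^\top)_{(k)}\mathbf{G}_{(k)}^\dagger\big)\times_{j\neq k}\mathbf{U}_j.$$ Armijo backtracking. Fix $\bar s>0$ and $\rho,a\in(0,1)$. For $\mathcal{X}\in\mathcal{M}_{\leq\mathbf{r}}$ and $\mathcal{V}\in\mathrm{T}_{\mathcal{X}}\mathcal{M}_{\leq\mathbf{r}}$, the stepsize is $s=\rho^l\bar s$ with the smallest integer $l\geq0$ such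 that $f(\mathcal{X})-f(\mathrm{P}_{\leq\mathbf{r}}^{\mathrm{HO}}(\mathcal{X}+s\mathcal{V}))\geq s\,a\,\langle-\nabla f(\mathcal{X}),\mathcal{V}\rangle$. GRAP-R method. Input $\mathcal{X}^{(0)}\in\mathcal{M}_{\leq\mathbf{r}}$, $\Delta>0$, $\bar s,\rho,a$. For a matrix with singular values $\sigma_1\geq\sigma_2\geq\cdots$ (with $\sigma_i=0$ beyond the smaller dimension), $\mathrm{rank}_\Delta=\min\{i\geq0:\sigma_{i+1}\leq\Delta\}$. At iteration $t$: stop if $\|\tilde{\mathrm{P}}_{\mathrm{T}_{\mathcal{X}^{(t)}}\mathcal{M}_{\leq\mathbf{r}}}(-\nabla f(\mathcal{X}^{(t)}))\|_{\mathrm{F}}=0$. Otherwise let $I_k=\{\mathrm{rank}_\Delta(\mathbf{X}_{(k)}^{(t)}),\dots,\mathrm{rank}(\mathbf{X}_{(k)}^{(t)})\}$ for $k\in[d]$; for every $\underline{\mathbf{r}}\in I_1\times\cdots\times I_d$ form $\mathcal{X}_{\underline{\mathbf{r}}}^{(t)}=\mathrm{P}_{\leq\underline{\mathbf{r}}}^{\mathrm{HO}}(\mathcal{X}^{(t)})$ and $\mathcal{Y}_{\underline{\mathbf{r}}}^{(t)}=\mathrm{P}_{\leq\mathbf{r}}^{\mathrm{HO}}\big(\mathcal{X}_{\underline{\mathbf{r}}}^{(t)}+s_{\underline{\mathbf{r}}}^{(t)}\tilde{\mathcal{V}}\big)$, where $\tilde{\mathcal{V}}=\tilde{\mathrm{P}}_{\mathrm{T}_{\mathcal{X}_{\underline{\mathbf{r}}}^{(t)}}\mathcal{M}_{\leq\mathbf{r}}}(-\nabla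 f(\mathcal{X}_{\underline{\mathbf{r}}}^{(t)}))$ and $s_{\underline{\mathbf{r}}}^{(t)}$ is the Armijo stepsize at $\mathcal{X}_{\underline{\mathbf{r}}}^{(t)}$ along $\tilde{\mathcal{V}}$. Let $\mathcal{X}^{(t+1)}$ be a point with lowest $f$-value among all $\mathcal{Y}_{\underline{\mathbf{r}}}^{(t)}$. *)

theory Defs
  imports
    "HOL-Analysis.Analysis"
    "Jordan_Normal_Form.DL_Rank"
    "Jordan_Normal_Form.Gauss_Jordan_Elimination"
begin

section \<open>Matrices\<close>

abbreviation mat_rank :: "real mat \<Rightarrow> nat" where
  "mat_rank A \<equiv> vec_space.rank (dim_row A) A"

definition frob_norm :: "real mat \<Rightarrow> real" where
  "frob_norm A = sqrt (\<Sum>i<dim_row A. \<Sum>j<dim_col A. (A $$ (i, j))\<^sup>2)"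

definition stiefel :: "nat \<Rightarrow> nat \<Rightarrow> real mat set" where
  "stiefel r n = {S \<in> carrier_mat n r. S\<^sup>T * S = 1\<^sub>m r}"

definition proj_mat :: "real mat \<Rightarrow> real mat" where
  "proj_mat S = S * S\<^sup>T"

definition perp_mat :: "real mat \<Rightarrow> real mat" where
  "perp_mat S = 1\<^sub>m (dim_row S) - S * S\<^sup>T"

text \<open>The block matrix \<open>[A B]\<close>.\<close>
definition append_cols :: "real mat \<Rightarrow> real mat \<Rightarrow> real mat" where
  "append_cols A B = (A\<^sup>T @\<^sub>r B\<^sup>T)\<^sup>T"

text \<open>The formula \<open>A\<^sup>T (A A\<^sup>T)\<^sup>-\<^sup>1\<close>; it is only used for matrices of full row rank, for
  which \<open>A A\<^sup>T\<close> is invertible.\<close>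
definition right_pinv :: "real mat \<Rightarrow> real mat" where
  "right_pinv A = A\<^sup>T * the (mat_inverse (A * A\<^sup>T))"

text \<open>\<open>\<sigma> i\<close> is the singular value with 0-based index \<open>i\<close>, i.e. the (i+1)-st largest one; it is
  zero beyond the smaller dimension. A sequence with this property exists and is unique.\<close>
definition is_singular_values :: "real mat \<Rightarrow> (nat \<Rightarrow> real) \<Rightarrow> bool" where
  "is_singular_values A \<sigma> \<longleftrightarrow>
     (\<forall>i j. i \<le> j \<longrightarrow> \<sigma> j \<le> \<sigma> i) \<and> (\<forall>i. 0 \<le> \<sigma> i) \<and>
     (\<forall>i \<ge> min (dim_row A) (dim_col A). \<sigma> i = 0) \<and>
     (\<exists>U \<in> stiefel (dim_row A) (dim_row A). \<exists>V \<in> stiefel (dim_col A) (dim_col A).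
        A = U * Matrix.mat (dim_row A) (dim_col A) (\<lambda>(i, j). if i = j then \<sigma> i else 0) * V\<^sup>T)"

definition singular_value :: "real mat \<Rightarrow> nat \<Rightarrow> real" where
  "singular_value A = (SOME \<sigma>. is_singular_values A \<sigma>)"

text \<open>With the 0-based indexing above, \<open>singular_value A i\<close> is \<open>\<sigma>\<^bsub>i+1\<^esub>\<close>.\<close>
definition rank_Delta :: "real \<Rightarrow> real mat \<Rightarrow> nat" where
  "rank_Delta \<Delta> A = (LEAST i. singular_value A i \<le> \<Delta>)"

text \<open>\<open>B\<close> is a best Frobenius-norm approximation of \<open>A\<close> of rank at most \<open>s\<close>; such a \<open>B\<close>
  need not be unique.\<close>
definition is_best_approx :: "nat \<Rightarrow> real mat \<Rightarrow> real mat \<Rightarrow> bool" where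
  "is_best_approx s A B \<longleftrightarrow>
     B \<in> carrier_mat (dim_row A) (dim_col A) \<and> mat_rank B \<le> s \<and>
     (\<forall>C \<in> carrier_mat (dim_row A) (dim_col A).
        mat_rank C \<le> s \<longrightarrow> frob_norm (A - B) \<le> frob_norm (A - C))"


section \<open>Tensors of arbitrary shape\<close>

text \<open>
  A tensor of order \<open>d\<close> and shape \<open>p 1 \<times> \<dots> \<times> p d\<close> is a real function on multi-indices; modes
  are numbered from 1 to \<open>d\<close>, and the index in mode \<open>k\<close> ranges over \<open>0, \<dots>, p k - 1\<close>. Only the
  values on \<open>multi_indices d p\<close> matter. Zero dimensions are allowed (core tensors of rank zero).
\<close>

type_synonym tensor = "(nat \<Rightarrow> nat) \<Rightarrow> real"

definition multi_indices :: "nat \<Rightarrow> (nat \<Rightarrow> nat) \<Rightarrow> (nat \<Rightarrow> nat) set" where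
  "multi_indices d p = PiE {1..d} (\<lambda>k. {..<p k})"

definition codim :: "nat \<Rightarrow> (nat \<Rightarrow> nat) \<Rightarrow> nat \<Rightarrow> nat" where
  "codim d p k = (\<Prod>i\<in>{1..d} - {k}. p i)"

text \<open>A fixed enumeration of the mode-\<open>k\<close> fibers, i.e. of the multi-indices over the modes other
  than \<open>k\<close>. It depends only on \<open>d\<close>, \<open>k\<close> and the dimensions of those other modes.\<close>
definition fiber_enum :: "nat \<Rightarrow> (nat \<Rightarrow> nat) \<Rightarrow> nat \<Rightarrow> nat \<Rightarrow> (nat \<Rightarrow> nat)" where
  "fiber_enum d p k =
     (SOME e. bij_betw e {..<codim d p k} (PiE ({1..d} - {k}) (\<lambda>i. {..<p i})))"

definition unfold_mode :: "nat \<Rightarrow> (nat \<Rightarrow> nat) \<Rightarrow> nat \<Rightarrow> tensor \<Rightarrow> real mat" where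
  "unfold_mode d p k X =
     Matrix.mat (p k) (codim d p k) (\<lambda>(a, j). X ((fiber_enum d p k j)(k := a)))"

definition ten_mode :: "nat \<Rightarrow> (nat \<Rightarrow> nat) \<Rightarrow> nat \<Rightarrow> real mat \<Rightarrow> tensor" where
  "ten_mode d p k M =
     (\<lambda>i. M $$ (i k, inv_into {..<codim d p k} (fiber_enum d p k) (restrict i ({1..d} - {k}))))"

text \<open>The \<open>k\<close>-mode product \<open>X \<times>\<^sub>k A\<close> of a tensor of shape \<open>p\<close>.\<close>
definition mode_prod :: "nat \<Rightarrow> (nat \<Rightarrow> nat) \<Rightarrow> nat \<Rightarrow> tensor \<Rightarrow> real mat \<Rightarrow> tensor" where
  "mode_prod d p k X A = ten_mode d (p(k := dim_row A)) k (A * unfold_mode d p k X)"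

text \<open>Successive mode products with the matrices \<open>A k\<close>, for \<open>k\<close> in the given list of modes.\<close>
primrec mode_prods ::
  "nat \<Rightarrow> (nat \<Rightarrow> nat) \<Rightarrow> nat list \<Rightarrow> tensor \<Rightarrow> (nat \<Rightarrow> real mat) \<Rightarrow> tensor" where
  "mode_prods d p [] X A = X"
| "mode_prods d p (k # ks) X A =
     mode_prods d (p(k := dim_row (A k))) ks (mode_prod d p k X (A k)) A"

text \<open>\<open>X \<times>\<^bsub>k\<in>K\<^esub> A k\<close>\<close>
definition multi_prod ::
  "nat \<Rightarrow> (nat \<Rightarrow> nat) \<Rightarrow> nat set \<Rightarrow> tensor \<Rightarrow> (nat \<Rightarrow> real mat) \<Rightarrow> tensor" where
  "multi_prod d p K X A = mode_prods d p (sorted_list_of_set K) X A"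


section \<open>Cones, projections, accumulation points\<close>

text \<open>Bouligand tangent cone\<close>
definition tangent_cone :: "'a::real_normed_vector set \<Rightarrow> 'a \<Rightarrow> 'a set" where
  "tangent_cone S x =
     {v. \<exists>y t. (\<forall>j. y j \<in> S) \<and> (\<forall>j. 0 < t j) \<and> (t \<longlonglongrightarrow> (0::real)) \<and>
         y \<longlonglongrightarrow> x \<and> (\<lambda>j. inverse (t j) *\<^sub>R (y j - x)) \<longlonglongrightarrow> v}"

text \<open>The metric projection is set-valued, since \<open>S\<close> need not be convex.\<close>
definition metric_proj :: "'a::metric_space set \<Rightarrow> 'a \<Rightarrow> 'a set" where
  "metric_proj S a = {v \<in> S. \<forall>w \<in> S. dist a v \<le> dist a w}"

definition accumulation_point :: "(nat \<Rightarrow> 'a::topological_space) \<Rightarrow> 'a \<Rightarrow> bool" where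
  "accumulation_point X L \<longleftrightarrow> (\<exists>\<phi>. strict_mono \<phi> \<and> (X \<circ> \<phi>) \<longlonglongrightarrow> L)"

definition locally_Lipschitz :: "('a::metric_space \<Rightarrow> 'b::metric_space) \<Rightarrow> bool" where
  "locally_Lipschitz g \<longleftrightarrow> (\<forall>x. \<exists>e>0. \<exists>L. L-lipschitz_on (ball x e) g)"


section \<open>The tensor space \<open>\<real>\<^bsup>n 1 \<times> \<dots> \<times> n d\<^esup>\<close> and the Tucker variety\<close>

text \<open>
  The ambient space is \<open>real ^ 'm\<close>, whose coordinates are put in bijection with the multi-indices
  by \<open>idx\<close> (see \<open>tensor_index\<close>). Then \<open>\<bullet>\<close>, \<open>norm\<close> and the topology of \<open>real ^ 'm\<close> are
  the entrywise inner product, the Frobenius norm and the usual topology of the tensor space.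
\<close>

definition tensor_index :: "nat \<Rightarrow> (nat \<Rightarrow> nat) \<Rightarrow> ('m \<Rightarrow> (nat \<Rightarrow> nat)) \<Rightarrow> bool" where
  "tensor_index d n idx \<longleftrightarrow> bij_betw idx UNIV (multi_indices d n)"

context
  fixes d :: nat and n :: "nat \<Rightarrow> nat" and idx :: "'m::finite \<Rightarrow> (nat \<Rightarrow> nat)"
begin

definition entries :: "real ^ 'm \<Rightarrow> tensor" where
  "entries X = (\<lambda>i. vec_nth X (inv_into UNIV idx i))"

definition of_entries :: "tensor \<Rightarrow> real ^ 'm" where
  "of_entries T = (\<chi> m. T (idx m))"

definition unfolding_of :: "nat \<Rightarrow> real ^ 'm \<Rightarrow> real mat" where
  "unfolding_of k X = unfold_mode d n k (entries X)"

definition tucker_rank :: "real ^ 'm \<Rightarrow> nat \<Rightarrow> nat" where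
  "tucker_rank X k = mat_rank (unfolding_of k X)"

definition tucker_variety :: "(nat \<Rightarrow> nat) \<Rightarrow> (real ^ 'm) set" where
  "tucker_variety r = {X. \<forall>k\<in>{1..d}. tucker_rank X k \<le> r k}"

definition stationary :: "(nat \<Rightarrow> nat) \<Rightarrow> (real ^ 'm \<Rightarrow> real ^ 'm) \<Rightarrow> real ^ 'm \<Rightarrow> bool" where
  "stationary r g X \<longleftrightarrow> X \<in> tucker_variety r \<and>
     norm ` metric_proj (tangent_cone (tucker_variety r) X) (- g X) = {0}"

text \<open>The set of possible values of the truncations in modes \<open>1, \<dots>, k\<close>: it consists of all
  results obtained by arbitrary choices of the best low-rank approximations.\<close>
primrec hosvd_upto :: "(nat \<Rightarrow> nat) \<Rightarrow> real ^ 'm \<Rightarrow> nat \<Rightarrow> (real ^ 'm) set" where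
  "hosvd_upto s A 0 = {A}"
| "hosvd_upto s A (Suc k) =
     {of_entries (ten_mode d n (Suc k) B) | B C.
        C \<in> hosvd_upto s A k \<and> is_best_approx (s (Suc k)) (unfolding_of (Suc k) C) B}"

definition hosvd :: "(nat \<Rightarrow> nat) \<Rightarrow> real ^ 'm \<Rightarrow> (real ^ 'm) set" where
  "hosvd s A = hosvd_upto s A d"

text \<open>
  The approximate projection of \<open>A\<close> at \<open>X\<close>, evaluated with the Tucker decomposition \<open>G\<close>, \<open>U\<close> of
  \<open>X\<close> (of Tucker rank \<open>q\<close>) and the augmented bases \<open>S\<close>. In the \<open>k\<close>-th summand,
  the tensor that is unfolded has shape \<open>q\<close> except for the dimension \<open>n k\<close> in mode \<open>k\<close>.
\<close>
definition approx_proj_formula ::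
  "(nat \<Rightarrow> nat) \<Rightarrow> tensor \<Rightarrow> (nat \<Rightarrow> real mat) \<Rightarrow> (nat \<Rightarrow> real mat) \<Rightarrow> real ^ 'm \<Rightarrow> real ^ 'm"
  where
  "approx_proj_formula q G U S A =
     of_entries (multi_prod d n {1..d} (entries A) (\<lambda>k. proj_mat (S k))) +
     (\<Sum>k\<in>{1..d}.
        let M = unfold_mode d (q(k := n k)) k
                  (multi_prod d n ({1..d} - {k}) (entries A) (\<lambda>j. (U j)\<^sup>T));
            W = perp_mat (S k) * M * right_pinv (unfold_mode d q k G)
        in of_entries
             (multi_prod d (q(k := n k)) ({1..d} - {k}) (mode_prod d q k G W) U))"

text \<open>All values the approximate projection can take, over the admissible choices of the Tucker
  decomposition and of the complementary bases \<open>U' k\<close>.\<close>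
definition approx_proj :: "(nat \<Rightarrow> nat) \<Rightarrow> real ^ 'm \<Rightarrow> real ^ 'm \<Rightarrow> (real ^ 'm) set" where
  "approx_proj r X A =
     {V. \<exists>G U U'.
        let q = tucker_rank X;
            I = {k \<in> {1..d}. q k < r k};
            S = (\<lambda>k. if k \<in> I then append_cols (U k) (U' k) else U k)
        in (\<forall>k\<in>{1..d}. U k \<in> stiefel (q k) (n k)) \<and>
           X = of_entries (multi_prod d q {1..d} G U) \<and>
           (\<forall>k\<in>I. U' k \<in> stiefel (r k - q k) (n k) \<and>
                   (U k)\<^sup>T * U' k = 0\<^sub>m (q k) (r k - q k)) \<and>
           norm (of_entries (multi_prod d n {1..d} (entries A) (\<lambda>k. proj_mat (S k))))
             \<ge> norm (of_entries (multi_prod d n ({1..d} - I) (entries A) (\<lambda>k. proj_mat (U k))))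
                * (\<Prod>k\<in>I. sqrt (real (r k - q k) / real (min (n k) (codim d n k)))) \<and>
           V = approx_proj_formula q G U S A}"


section \<open>The GRAP-R method\<close>

context
  fixes r :: "nat \<Rightarrow> nat"
    and f :: "real ^ 'm \<Rightarrow> real" and g :: "real ^ 'm \<Rightarrow> real ^ 'm"
    and \<Delta> sbar \<rho> a :: real
begin

text \<open>
  \<open>Y\<close> is the point accepted by Armijo backtracking from \<open>X\<close> along \<open>V\<close>: \<open>trial j\<close> is the (chosen)
  value of the HOSVD truncation for the stepsize \<open>\<rho>^j * sbar\<close>, and \<open>l\<close> is the first index
  at which the sufficient decrease condition holds.
\<close>
definition armijo_point :: "real ^ 'm \<Rightarrow> real ^ 'm \<Rightarrow> real ^ 'm \<Rightarrow> bool" where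
  "armijo_point X V Y \<longleftrightarrow>
     (\<exists>trial l.
        let decrease = (\<lambda>j. f X - f (trial j) \<ge> \<rho> ^ j * sbar * a * inner (- g X) V)
        in (\<forall>j\<le>l. trial j \<in> hosvd r (X + (\<rho> ^ j * sbar) *\<^sub>R V)) \<and>
           decrease l \<and> (\<forall>j<l. \<not> decrease j) \<and> Y = trial l)"

definition grap_r_stop :: "real ^ 'm \<Rightarrow> bool" where
  "grap_r_stop X \<longleftrightarrow> (\<exists>V \<in> approx_proj r X (- g X). norm V = 0)"

definition candidate_ranks :: "real ^ 'm \<Rightarrow> (nat \<Rightarrow> nat) set" where
  "candidate_ranks X =
     PiE {1..d} (\<lambda>k. {rank_Delta \<Delta> (unfolding_of k X) .. tucker_rank X k})"

definition grap_r_step :: "real ^ 'm \<Rightarrow> real ^ 'm \<Rightarrow> bool" where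
  "grap_r_step X X' \<longleftrightarrow>
     (\<exists>V \<in> approx_proj r X (- g X). norm V \<noteq> 0) \<and>
     (\<exists>Z V Y.
        (\<forall>q \<in> candidate_ranks X.
           Z q \<in> hosvd q X \<and> V q \<in> approx_proj r (Z q) (- g (Z q)) \<and>
           armijo_point (Z q) (V q) (Y q)) \<and>
        (\<exists>q \<in> candidate_ranks X. X' = Y q) \<and>
        (\<forall>q \<in> candidate_ranks X. f X' \<le> f (Y q)))"

text \<open>\<open>T\<close> is the index of the last iterate, with \<open>T = \<infinity>\<close> if the stopping test never succeeds;
  the values \<open>X t\<close> for \<open>t > T\<close> are irrelevant.\<close>
definition grap_r_sequence :: "(nat \<Rightarrow> real ^ 'm) \<Rightarrow> enat \<Rightarrow> bool" where
  "grap_r_sequence X T \<longleftrightarrow>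
     (\<forall>t. enat t < T \<longrightarrow> grap_r_step (X t) (X (Suc t))) \<and>
     (\<forall>N. T = enat N \<longrightarrow> grap_r_stop (X N))"

end

end

end

theory Submission
  imports Defs
begin

text \<open>
  The candidate ranks at an iterate include its own Tucker rank, so the function values decrease
  (\<open>grap_r_step_descent\<close>) and the iterates stay in a compact sublevel
  set. What needs proof is stationarity: the antigradient \<open>A = - g X\<close> has to have inner
  product at most \<open>0\<close> with all tangent vectors (\<open>stationaryI\<close>).

  An approximate projection of \<open>A\<close> at \<open>Z\<close> is a sum \<open>V = C + (\<Sum>k. E k)\<close>, where \<open>C\<close> projects \<open>A\<close> to
  the product of the enlarged fiber spaces and \<open>E k\<close> is the left multiple of \<open>Z\<close> that is nearest
  to the rest of \<open>A\<close> in mode \<open>k\<close> (\<open>approx_proj_summand\<close>). Hence \<open>A \<bullet> V\<close> is the sum of the squared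
  norms of these parts (\<open>tangent_split_inner\<close>). If all parts vanish, then \<open>A\<close> is even orthogonal to
  the tangent cone: in a mode whose rank bound is attained, a tangent vector has no component that
  is perpendicular to \<open>Z\<close> on both sides of the unfolding (\<open>tangent_cone_saturated_mode\<close>), so it
  splits into a part in the fiber spaces of these modes and left multiples of \<open>Z\<close>; the bound
  required of the complementary bases keeps \<open>A\<close> from seeing the first part, and \<open>C\<close> and \<open>E k\<close>
  control the others.

  At an accumulation point \<open>L\<close> the Tucker rank may drop, and the approximate projections at the
  iterates need not have anything to do with the tangent cone at \<open>L\<close>. This is what the rank
  reduction is for. The singular values of the unfoldings of \<open>X t\<close> beyond the rank of \<open>L\<close> are at
  most \<open>norm (X t - L)\<close> (\<open>singular_value_le_dist_low_rank\<close>), hence finally below \<open>\<Delta>\<close>, so the Tucker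
  rank of \<open>L\<close> is a candidate. The truncations \<open>Z t\<close> of \<open>X t\<close> to it converge to \<open>L\<close> and have the
  Tucker rank of \<open>L\<close>. Along such points the geometry is continuous. This is made precise without
  converging Tucker decompositions: if \<open>P L N = 1\<close> for the unfolding of \<open>L\<close>, then the skeleton
  identity \<open>Z N (P Z N)\<^sup>-\<^sup>1 P Z = Z\<close> holds for the unfoldings of all tensors of the same rank nearby,
  and it turns left multiples of \<open>Z\<close> into explicit continuous functions (\<open>left_factor\<close>). In
  particular, vanishing of the parts \<open>C\<close>, \<open>E k\<close> along \<open>Z t\<close> implies stationarity of \<open>L\<close>
  (\<open>vanishing_split_imp_orthogonal_to_tangent_cone\<close>).

  The Armijo points that start from \<open>Z t\<close> have values at least \<open>f L\<close>, while \<open>f (Z t)\<close> tends to \<open>f L\<close>,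
  so the product of the step size and \<open>A \<bullet> V\<close> tends to \<open>0\<close>. If the step sizes tend to \<open>0\<close>, then so do
  the last rejected ones, for which the decrease is less than the fraction \<open>a\<close> of its first-order
  prediction. But the truncated HOSVD is a retraction up to \<open>o(s)\<close>, uniformly along \<open>Z t\<close>
  (\<open>hosvd_retraction_limit\<close>), so the decrease agrees with the prediction to first order. In either
  case the parts of the approximate projections tend to \<open>0\<close> on a subsequence
  (\<open>grap_r_limit_stationary\<close>).
\<close>

section \<open>Rank and factorizations of matrices\<close>

lemma mat_mult_entry:
  fixes A B :: "real mat"
  assumes "A \<in> carrier_mat n k" "B \<in> carrier_mat k m" "i < n" "j < m"
  shows "(A * B) $$ (i, j) = (\<Sum>l<k. A $$ (i, l) * B $$ (l, j))"
  using assms by (auto simp: scalar_prod_def lessThan_atLeast0 intro!: sum.cong)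

lemma inverse_mat_exists:
  fixes A :: "real mat"
  assumes A: "A \<in> carrier_mat n n" and "Determinant.det A \<noteq> 0"
  shows "\<exists>B \<in> carrier_mat n n. A * B = 1\<^sub>m n \<and> B * A = 1\<^sub>m n"
proof -
  have "A \<in> Units (ring_mat TYPE(real) n ())"
    using det_non_zero_imp_unit[OF assms] .
  then show ?thesis
    by (auto simp: Units_def ring_mat_def)
qed

text \<open>Filling up with zero rows gives a square matrix whose determinant vanishes because of such a
  row.\<close>
lemma kernel_vector_exists:
  fixes M :: "real mat"
  assumes M: "M \<in> carrier_mat q s" and "q < s"
  shows "\<exists>v \<in> carrier_vec s. v \<noteq> 0\<^sub>v s \<and> M *\<^sub>v v = 0\<^sub>v q"
proof -
  define M' where "M' = Matrix.mat s s (\<lambda>(i, j). if i < q then M $$ (i, j) else 0)"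
  have M': "M' \<in> carrier_mat s s" by (simp add: M'_def)
  have "M'\<^sup>T *\<^sub>v unit_vec s q = 0\<^sub>v s"
    using \<open>q < s\<close>
    by (intro eq_vecI) (auto simp: M'_def scalar_prod_def unit_vec_def intro!: sum.neutral)
  moreover have "unit_vec s q \<noteq> (0\<^sub>v s :: real Matrix.vec)"
    using \<open>q < s\<close> by simp
  ultimately have "Determinant.det (M'\<^sup>T) = 0"
    using M' det_0_iff_vec_prod_zero[of "M'\<^sup>T" s, THEN iffD2, OF _ exI[of _ "unit_vec s q"]]
    by simp
  then have "Determinant.det M' = 0" using det_transpose[OF M'] by simp
  then obtain v where v: "v \<in> carrier_vec s" "v \<noteq> 0\<^sub>v s" "M' *\<^sub>v v = 0\<^sub>v s"
    using det_0_iff_vec_prod_zero[OF M'] by auto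
  have "M *\<^sub>v v = 0\<^sub>v q"
  proof (rule eq_vecI)
    fix i assume "i < dim_vec (0\<^sub>v q :: real Matrix.vec)"
    then have i: "i < q" by simp
    have "(M *\<^sub>v v) $ i = (M' *\<^sub>v v) $ i"
      using i \<open>q < s\<close> M v(1) by (auto simp: M'_def scalar_prod_def intro!: sum.cong)
    then show "(M *\<^sub>v v) $ i = 0\<^sub>v q $ i" using v(3) i \<open>q < s\<close> by simp
  qed (use M in simp)
  then show ?thesis using v by blast
qed

lemma scalar_prod_self_zero:
  fixes v :: "real Matrix.vec"
  assumes "v \<in> carrier_vec n" "scalar_prod v v = 0"
  shows "v = 0\<^sub>v n"
proof (rule eq_vecI)
  fix i assume "i < dim_vec (0\<^sub>v n :: real Matrix.vec)"
  then have i: "i < n" by simp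
  have "(\<Sum>i\<in>{0..<n}. v $ i * v $ i) = 0"
    using assms by (simp add: scalar_prod_def)
  then have "v $ i * v $ i = 0"
    using i by (subst (asm) sum_nonneg_eq_0_iff) auto
  then show "v $ i = 0\<^sub>v n $ i" using i by simp
qed (use assms in simp)

text \<open>Over the reals \<open>F\<^sup>T F\<close> has the same kernel as \<open>F\<close>, because \<open>x \<bullet> F\<^sup>T F x = |F x|\<^sup>2\<close>.\<close>
lemma gram_inverse_exists:
  fixes F :: "real mat"
  assumes F: "F \<in> carrier_mat n q"
    and inj: "\<And>x. x \<in> carrier_vec q \<Longrightarrow> F *\<^sub>v x = 0\<^sub>v n \<Longrightarrow> x = 0\<^sub>v q"
  shows "\<exists>B \<in> carrier_mat q q. F\<^sup>T * F * B = 1\<^sub>m q \<and> B * (F\<^sup>T * F) = 1\<^sub>m q"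
proof (rule inverse_mat_exists)
  show "F\<^sup>T * F \<in> carrier_mat q q" using F by simp
  show "Determinant.det (F\<^sup>T * F) \<noteq> 0"
  proof
    assume "Determinant.det (F\<^sup>T * F) = 0"
    then obtain x where x: "x \<in> carrier_vec q" "x \<noteq> 0\<^sub>v q" "F\<^sup>T * F *\<^sub>v x = 0\<^sub>v q"
      using det_0_iff_vec_prod_zero[of "F\<^sup>T * F" q] F by auto
    have Fx: "F *\<^sub>v x \<in> carrier_vec n" using F x by simp
    have "F\<^sup>T *\<^sub>v (F *\<^sub>v x) = 0\<^sub>v q"
      using assoc_mult_mat_vec[of "F\<^sup>T" q n F q x] x F by simp
    then have "scalar_prod (F\<^sup>T *\<^sub>v (F *\<^sub>v x)) x = 0" using x by simp
    then have "scalar_prod (F *\<^sub>v x) (F *\<^sub>v x) = 0"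
      using transpose_vec_mult_scalar[OF F x(1) Fx] by simp
    then have "F *\<^sub>v x = 0\<^sub>v n" using scalar_prod_self_zero[OF Fx] by simp
    then show False using inj x by blast
  qed
qed

lemma left_inverse_exists:
  fixes F :: "real mat"
  assumes F: "F \<in> carrier_mat n q"
    and inj: "\<And>x. x \<in> carrier_vec q \<Longrightarrow> F *\<^sub>v x = 0\<^sub>v n \<Longrightarrow> x = 0\<^sub>v q"
  shows "\<exists>P \<in> carrier_mat q n. P * F = 1\<^sub>m q"
proof -
  obtain B where B: "B \<in> carrier_mat q q" "B * (F\<^sup>T * F) = 1\<^sub>m q"
    using gram_inverse_exists[OF assms] by blast
  have "B * F\<^sup>T * F = 1\<^sub>m q"
    using assoc_mult_mat[of B q q "F\<^sup>T" n F q] B F by simp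
  then show ?thesis using B F by (intro bexI[of _ "B * F\<^sup>T"]) auto
qed

text \<open>More than \<open>q\<close> columns of \<open>F H\<close> come from more than \<open>q\<close> coordinate vectors in dimension \<open>q\<close>,
  so a linear relation between the latter carries over to them.\<close>
lemma mat_rank_le_factor:
  fixes F H :: "real mat"
  assumes F: "F \<in> carrier_mat n q" and H: "H \<in> carrier_mat q m"
  shows "mat_rank (F * H) \<le> q"
proof -
  interpret vec_space "TYPE(real)" n .
  let ?A = "F * H"
  have A: "?A \<in> carrier_mat n m" using F H by simp
  obtain S where S: "maximal S (\<lambda>T. T \<subseteq> set (cols ?A) \<and> lin_indpt T)"
    using maximal_exists_superset[of "set (cols ?A)" "\<lambda>T. T \<subseteq> set (cols ?A) \<and> lin_indpt T" "{}"]
    by (auto simp: lin_dep_def)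
  have rank: "rank ?A = card S" by (rule rank_card_indpt[OF A S])
  have SA: "S \<subseteq> set (cols ?A)" and ind: "lin_indpt S" using S by (auto simp: maximal_def)
  obtain ss where ss: "set ss = S" "distinct ss"
    using SA finite_distinct_list[of S] finite_subset[OF SA] by auto
  have len: "length ss = card S" using ss distinct_card by metis
  have carr: "set ss \<subseteq> carrier_vec n" using SA ss A cols_dim by blast
  have "\<exists>h. h \<in> carrier_vec q \<and> c = F *\<^sub>v h" if c: "c \<in> S" for c
  proof -
    from c SA obtain j where j: "j < m" "c = col ?A j"
      using H by (auto simp: cols_def)
    then have "c = F *\<^sub>v col H j" using col_mult2[OF F H j(1)] by simp
    then show ?thesis using F H by (intro exI[of _ "col H j"]) auto
  qed
  then obtain h where h: "\<And>c. c \<in> S \<Longrightarrow> h c \<in> carrier_vec q \<and> c = F *\<^sub>v h c" by metis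
  define M where "M = mat_of_cols q (map h ss)"
  have M: "M \<in> carrier_mat q (card S)" using len by (simp add: M_def mat_of_cols_def)
  define A' where "A' = mat_of_cols n ss"
  have A': "A' \<in> carrier_mat n (card S)" using len by (simp add: A'_def mat_of_cols_def)
  have colsA': "cols A' = ss" using carr unfolding A'_def by (rule cols_mat_of_cols)
  have A'eq: "A' = F * M"
  proof (rule mat_col_eqI)
    fix i assume i: "i < dim_col (F * M)"
    then have i': "i < length ss" using M len by simp
    then have mem: "ss ! i \<in> S" using ss nth_mem by blast
    have "col A' i = ss ! i"
      unfolding A'_def using i' carr by (intro col_mat_of_cols) auto
    moreover have "col M i = h (ss ! i)"
      unfolding M_def using i' h[OF mem] by (subst col_mat_of_cols) auto
    ultimately show "col A' i = col (F * M) i"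
      using h[OF mem] col_mult2[OF F M, of i] i' len by simp
  qed (use A' F M in auto)
  show ?thesis
  proof (rule ccontr)
    assume "\<not> mat_rank (F * H) \<le> q"
    then have "q < card S" using rank F by simp
    from kernel_vector_exists[OF M this] obtain v where
      v: "v \<in> carrier_vec (card S)" "v \<noteq> 0\<^sub>v (card S)" "M *\<^sub>v v = 0\<^sub>v q" by blast
    have "A' *\<^sub>v v = 0\<^sub>v n"
      unfolding A'eq using assoc_mult_mat_vec[OF F M v(1)] v(3) F
      by (auto intro!: eq_vecI simp: scalar_prod_def)
    then have "lin_dep (set (cols A'))"
      using lin_depI[OF A' v(1,2)] colsA' ss by simp
    then show False using ind colsA' ss by simp
  qed
qed

text \<open>Any matrix factors through its rank: \<open>F\<close> consists of a maximal independent set of columns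
  of \<open>A\<close>, selected by \<open>N\<close>, and \<open>P\<close> is a left inverse of \<open>F\<close>. As \<open>F H N = A N = F\<close> and \<open>F\<close>
  is injective, \<open>H N\<close> is the identity.\<close>
lemma rank_factorization:
  fixes A :: "real mat"
  assumes A: "A \<in> carrier_mat n m"
  shows "\<exists>F \<in> carrier_mat n (mat_rank A). \<exists>H \<in> carrier_mat (mat_rank A) m.
         \<exists>P \<in> carrier_mat (mat_rank A) n. \<exists>N \<in> carrier_mat m (mat_rank A).
           A = F * H \<and> P * F = 1\<^sub>m (mat_rank A) \<and> H * N = 1\<^sub>m (mat_rank A)"
proof -
  interpret vec_space "TYPE(real)" n .
  obtain S where S: "maximal S (\<lambda>T. T \<subseteq> set (cols A) \<and> lin_indpt T)"
    using maximal_exists_superset[of "set (cols A)" "\<lambda>T. T \<subseteq> set (cols A) \<and> lin_indpt T" "{}"]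
    by (auto simp: lin_dep_def)
  define q where "q = card S"
  have rank: "mat_rank A = q" using rank_card_indpt[OF A S] A by (simp add: q_def)
  have SA: "S \<subseteq> set (cols A)" and ind: "lin_indpt S" using S by (auto simp: maximal_def)
  obtain ss where ss: "set ss = S" "distinct ss"
    using SA finite_distinct_list[of S] finite_subset[OF SA] by auto
  have len: "length ss = q" using ss distinct_card q_def by metis
  have colsA: "set (cols A) \<subseteq> carrier_vec n" using A cols_dim by blast
  have carr: "set ss \<subseteq> carrier_vec n" using SA ss colsA by blast
  define F where "F = mat_of_cols n ss"
  have F: "F \<in> carrier_mat n q" using len by (simp add: F_def mat_of_cols_def)
  have colsF: "cols F = ss" using carr unfolding F_def by (rule cols_mat_of_cols)
  have inj: "x = 0\<^sub>v q" if "x \<in> carrier_vec q" "F *\<^sub>v x = 0\<^sub>v n" for x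
    using lin_depI[OF F that(1) _ that(2)] colsF ss ind by auto
  have "\<exists>h. h \<in> carrier_vec q \<and> col A j = F *\<^sub>v h" if j: "j < m" for j
  proof -
    have c: "col A j \<in> set (cols A)" using A j by (auto simp: cols_def)
    have cn: "col A j \<in> carrier_vec n" using A j by simp
    have "col A j \<in> span S"
    proof (cases "col A j \<in> S")
      case True
      then show ?thesis using carr ss by (meson in_own_span subset_eq)
    next
      case False
      have "\<not> lin_indpt (insert (col A j) S)"
        using S False c SA unfolding maximal_def by auto
      then show ?thesis
        using lin_dep_iff_in_span[of S "col A j"] carr ss ind False cn by auto
    qed
    then obtain w where "col A j = lincomb w S"
      using finite_in_span[of S "col A j"] ss carr by (metis finite_set)
    then have "col A j = F *\<^sub>v Matrix.vec q (\<lambda>i. w (col F i))"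
      using mat_mult_eq_lincomb[OF F, of w] colsF ss by simp
    then show ?thesis by (metis vec_carrier)
  qed
  then obtain h where h: "\<And>j. j < m \<Longrightarrow> h j \<in> carrier_vec q \<and> col A j = F *\<^sub>v h j" by metis
  define H where "H = mat_of_cols q (map h [0..<m])"
  have H: "H \<in> carrier_mat q m" by (simp add: H_def mat_of_cols_def)
  have AFH: "A = F * H"
  proof (rule mat_col_eqI)
    fix j assume "j < dim_col (F * H)"
    then have j: "j < m" using H by simp
    have "col H j = h j" unfolding H_def using j h[OF j] by (subst col_mat_of_cols) auto
    then show "col A j = col (F * H) j" using h[OF j] col_mult2[OF F H j] by simp
  qed (use A F H in auto)
  obtain P where P: "P \<in> carrier_mat q n" "P * F = 1\<^sub>m q"
    using left_inverse_exists[OF F inj] by blast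
  have "\<exists>j<m. ss ! i = col A j" if "i < q" for i
  proof -
    have "ss ! i \<in> set (cols A)" using that len ss SA nth_mem[of i ss] by blast
    then show ?thesis using A by (auto simp: cols_def)
  qed
  then obtain \<iota> where \<iota>: "\<And>i. i < q \<Longrightarrow> \<iota> i < m \<and> ss ! i = col A (\<iota> i)" by metis
  define N :: "real mat" where "N = mat_of_cols m (map (\<lambda>i. unit_vec m (\<iota> i)) [0..<q])"
  have N: "N \<in> carrier_mat m q" by (simp add: N_def mat_of_cols_def)
  have AN: "A * N = F"
  proof (rule mat_col_eqI)
    fix i assume "i < dim_col F"
    then have i: "i < q" using F by simp
    have "col N i = unit_vec m (\<iota> i)" unfolding N_def using i by (subst col_mat_of_cols) auto
    moreover have "col F i = ss ! i"
      unfolding F_def using i len carr by (intro col_mat_of_cols) auto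
    moreover have "A *\<^sub>v unit_vec m (\<iota> i) = col A (\<iota> i)"
      using A \<iota>[OF i] by (intro eq_vecI) auto
    ultimately show "col (A * N) i = col F i"
      using \<iota>[OF i] col_mult2[OF A N i] by metis
  qed (use A F N in auto)
  have "H * N = P * F * (H * N)" using P H N by simp
  also have "\<dots> = P * (F * H * N)"
    using assoc_mult_mat[OF P(1) F, of "H * N" q] assoc_mult_mat[OF F H N] H N by simp
  also have "\<dots> = 1\<^sub>m q" using AN AFH P by simp
  finally show ?thesis using AFH F H P N unfolding rank by blast
qed

text \<open>This form of a lower rank bound is what later makes the rank lower semicontinuous: the product
  \<open>P B N\<close> stays invertible for all matrices \<open>B\<close> near \<open>A\<close>.\<close>
lemma le_mat_rank_iff:
  fixes A :: "real mat"
  assumes A: "A \<in> carrier_mat n m"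
  shows "q \<le> mat_rank A \<longleftrightarrow>
    (\<exists>P \<in> carrier_mat q n. \<exists>N \<in> carrier_mat m q. P * A * N = 1\<^sub>m q)"
proof
  assume le: "q \<le> mat_rank A"
  define p where "p = mat_rank A"
  obtain F H P N where FH: "F \<in> carrier_mat n p" "H \<in> carrier_mat p m" "P \<in> carrier_mat p n"
    "N \<in> carrier_mat m p" "A = F * H" "P * F = 1\<^sub>m p" "H * N = 1\<^sub>m p"
    using rank_factorization[OF A] unfolding p_def by blast
  define P' where "P' = Matrix.mat q n (\<lambda>(i, j). P $$ (i, j))"
  define N' where "N' = Matrix.mat m q (\<lambda>(i, j). N $$ (i, j))"
  have "P * A = H" using assoc_mult_mat[OF FH(3,1,2)] FH by simp
  then have PAN: "P * A * N = 1\<^sub>m p" using FH by simp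
  have "P' * A * N' = 1\<^sub>m q"
  proof (rule eq_matI)
    fix i j assume "i < dim_row (1\<^sub>m q :: real mat)" "j < dim_col (1\<^sub>m q :: real mat)"
    then have ij: "i < q" "j < q" "i < p" "j < p" using le p_def by auto
    have "row (P' * A) i = row (P * A) i"
      using ij FH A by (intro eq_vecI) (auto simp: P'_def scalar_prod_def)
    moreover have "col N' j = col N j"
      using ij FH A by (intro eq_vecI) (auto simp: N'_def)
    ultimately have "(P' * A * N') $$ (i, j) = (P * A * N) $$ (i, j)"
      using ij FH A by (auto simp: P'_def N'_def)
    then show "(P' * A * N') $$ (i, j) = 1\<^sub>m q $$ (i, j)" using ij PAN by simp
  qed (auto simp: P'_def N'_def)
  then show "\<exists>P \<in> carrier_mat q n. \<exists>N \<in> carrier_mat m q. P * A * N = 1\<^sub>m q"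
    by (intro bexI[of _ P'] bexI[of _ N']) (auto simp: P'_def N'_def)
next
  assume "\<exists>P \<in> carrier_mat q n. \<exists>N \<in> carrier_mat m q. P * A * N = 1\<^sub>m q"
  then obtain P N where PN: "P \<in> carrier_mat q n" "N \<in> carrier_mat m q" "P * A * N = 1\<^sub>m q"
    by blast
  define p where "p = mat_rank A"
  obtain F H where FH: "F \<in> carrier_mat n p" "H \<in> carrier_mat p m" "A = F * H"
    using rank_factorization[OF A] unfolding p_def by blast
  have "P * A * N = (P * F) * (H * N)"
    using assoc_mult_mat[OF PN(1) FH(1,2)] assoc_mult_mat[of "P * F" q p H m N q] PN FH by simp
  then have "1\<^sub>m q = (P * F) * (H * N)" using PN by simp
  then have "mat_rank (1\<^sub>m q :: real mat) \<le> p"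
    using mat_rank_le_factor[of "P * F" q p "H * N" q] PN FH by simp
  moreover have "mat_rank (1\<^sub>m q :: real mat) = q"
    using vec_space.det_rank_iff[of "1\<^sub>m q :: real mat" q] by simp
  ultimately show "q \<le> mat_rank A" by (simp add: p_def)
qed

lemma mat_rank_le_iff:
  fixes A :: "real mat"
  assumes A: "A \<in> carrier_mat n m"
  shows "mat_rank A \<le> q \<longleftrightarrow>
    (\<exists>F \<in> carrier_mat n q. \<exists>H \<in> carrier_mat q m. A = F * H)"
proof
  assume le: "mat_rank A \<le> q"
  define p where "p = mat_rank A"
  obtain F H where FH: "F \<in> carrier_mat n p" "H \<in> carrier_mat p m" "A = F * H"
    using rank_factorization[OF A] unfolding p_def by blast
  define F' where "F' = Matrix.mat n q (\<lambda>(i, j). if j < p then F $$ (i, j) else 0)"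
  define H' where "H' = Matrix.mat q m (\<lambda>(i, j). if i < p then H $$ (i, j) else 0)"
  have F': "F' \<in> carrier_mat n q" and H': "H' \<in> carrier_mat q m" by (auto simp: F'_def H'_def)
  have "A = F' * H'"
  proof (rule eq_matI)
    fix i j assume "i < dim_row (F' * H')" "j < dim_col (F' * H')"
    then have ij: "i < n" "j < m" using F' H' by auto
    have "(F' * H') $$ (i, j) = (\<Sum>l<q. F' $$ (i, l) * H' $$ (l, j))"
      using mat_mult_entry[OF F' H' ij] .
    also have "\<dots> = (\<Sum>l<q. if l \<in> {..<p} then F $$ (i, l) * H $$ (l, j) else 0)"
      using ij by (intro sum.cong) (auto simp: F'_def H'_def)
    also have "\<dots> = (\<Sum>l<p. F $$ (i, l) * H $$ (l, j))"
      using le p_def by (subst sum.inter_restrict[symmetric]) (auto intro!: sum.cong)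
    finally show "A $$ (i, j) = (F' * H') $$ (i, j)"
      using mat_mult_entry[OF FH(1,2) ij] FH(3) by simp
  qed (use A F' H' in auto)
  then show "\<exists>F \<in> carrier_mat n q. \<exists>H \<in> carrier_mat q m. A = F * H" using F' H' by blast
qed (use mat_rank_le_factor A in auto)

section \<open>Singular value decomposition\<close>

lemma finite_family_convergent_subsequence:
  fixes x :: "'i \<Rightarrow> nat \<Rightarrow> 'a::heine_borel"
  assumes "finite K" and "\<And>k. k \<in> K \<Longrightarrow> bounded (range (x k))"
  shows "\<exists>\<phi> l. strict_mono (\<phi> :: nat \<Rightarrow> nat) \<and> (\<forall>k\<in>K. (\<lambda>j. x k (\<phi> j)) \<longlonglongrightarrow> l k)"
  using assms
proof (induction K rule: finite_induct)
  case empty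
  then show ?case by (intro exI[of _ id]) (simp add: strict_mono_def)
next
  case (insert k K)
  then obtain \<phi> l where \<phi>: "strict_mono \<phi>" "\<forall>k\<in>K. (\<lambda>j. x k (\<phi> j)) \<longlonglongrightarrow> l k" by auto
  have "bounded (range (\<lambda>j. x k (\<phi> j)))"
    using insert.prems[of k] by (rule bounded_subset) auto
  then obtain \<psi> l' where \<psi>: "strict_mono \<psi>" "(\<lambda>j. x k (\<phi> (\<psi> j))) \<longlonglongrightarrow> l'"
    using bounded_imp_convergent_subsequence[of "\<lambda>j. x k (\<phi> j)"] by (auto simp: o_def)
  have "(\<lambda>j. x i (\<phi> (\<psi> j))) \<longlonglongrightarrow> l i" if "i \<in> K" for i
    using LIMSEQ_subseq_LIMSEQ[OF \<phi>(2)[rule_format, OF that] \<psi>(1)] by (simp add: o_def)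
  then have "\<forall>i\<in>insert k K. (\<lambda>j. x i (\<phi> (\<psi> j))) \<longlonglongrightarrow> (l(k := l')) i"
    using \<psi>(2) insert.hyps by auto
  then show ?case
    using strict_mono_o[OF \<phi>(1) \<psi>(1)] by (intro exI[of _ "\<phi> \<circ> \<psi>"] exI[of _ "l(k := l')"]) (simp add: o_def)
qed

text \<open>A maximizing sequence of pairs of unit vectors has a subsequence that converges in every
  coordinate.\<close>
lemma bilinear_form_attains_max:
  fixes b :: "nat \<Rightarrow> nat \<Rightarrow> real"
  assumes "m > 0" "n > 0"
  shows "\<exists>x y. (\<Sum>i<m. (x i)\<^sup>2) = 1 \<and> (\<Sum>j<n. (y j)\<^sup>2) = 1 \<and>
    (\<forall>x' y'. (\<Sum>i<m. (x' i)\<^sup>2) = 1 \<longrightarrow> (\<Sum>j<n. (y' j)\<^sup>2) = 1 \<longrightarrow>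
       (\<Sum>i<m. \<Sum>j<n. b i j * x' i * y' j) \<le> (\<Sum>i<m. \<Sum>j<n. b i j * x i * y j))"
proof -
  define \<beta> where "\<beta> = (\<lambda>x y. \<Sum>i<m. \<Sum>j<n. b i j * x i * y j)"
  define S where "S = {\<beta> x y | x y. (\<Sum>i<m. (x i)\<^sup>2) = 1 \<and> (\<Sum>j<n. (y j)\<^sup>2) = 1}"
  have unit: "\<bar>z i\<bar> \<le> 1" if "(\<Sum>i<k. (z i)\<^sup>2) = 1" "i < k" for z :: "nat \<Rightarrow> real" and i k
  proof -
    have "(z i)\<^sup>2 \<le> (\<Sum>i<k. (z i)\<^sup>2)"
      using that(2) by (intro member_le_sum) auto
    then show ?thesis using that(1) abs_square_le_1 by auto
  qed
  have "\<beta> x y \<le> (\<Sum>i<m. \<Sum>j<n. \<bar>b i j\<bar>)"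
    if "(\<Sum>i<m. (x i)\<^sup>2) = 1" "(\<Sum>j<n. (y j)\<^sup>2) = 1" for x y
  proof -
    have "b i j * x i * y j \<le> \<bar>b i j\<bar>" if "i < m" "j < n" for i j
    proof -
      have "b i j * x i * y j \<le> \<bar>b i j\<bar> * (\<bar>x i\<bar> * \<bar>y j\<bar>)"
        by (metis abs_ge_self abs_mult mult.assoc)
      also have "\<dots> \<le> \<bar>b i j\<bar> * (1 * 1)"
        using unit[OF \<open>(\<Sum>i<m. (x i)\<^sup>2) = 1\<close> \<open>i < m\<close>] unit[OF \<open>(\<Sum>j<n. (y j)\<^sup>2) = 1\<close> \<open>j < n\<close>]
        by (intro mult_left_mono mult_mono) auto
      finally show ?thesis by simp
    qed
    then show ?thesis unfolding \<beta>_def by (intro sum_mono) auto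
  qed
  then have bdd: "bdd_above S" unfolding S_def by (auto intro!: bdd_aboveI)
  have e0: "(\<Sum>i<k. ((\<lambda>i. if i = 0 then 1 else 0 :: real) i)\<^sup>2) = 1" if "k > 0" for k :: nat
    using that by (simp add: if_distrib[of "\<lambda>z. z\<^sup>2"] cong: if_cong)
  have "\<beta> (\<lambda>i. if i = 0 then 1 else 0) (\<lambda>i. if i = 0 then 1 else 0) \<in> S"
    unfolding S_def using e0[OF assms(1)] e0[OF assms(2)] by (intro CollectI exI conjI refl) auto
  then have "S \<noteq> {}" by auto
  then have "\<exists>s\<in>S. Sup S - 1 / real (Suc k) < s" for k
    using less_cSup_iff[OF _ bdd, of "Sup S - 1 / real (Suc k)"] by simp
  then have "\<forall>k. \<exists>x y. (\<Sum>i<m. (x i)\<^sup>2) = 1 \<and> (\<Sum>j<n. (y j)\<^sup>2) = 1 \<and>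
      Sup S - 1 / real (Suc k) < \<beta> x y"
    unfolding S_def by blast
  then obtain x y where xy: "\<And>k. (\<Sum>i<m. (x k i)\<^sup>2) = 1" "\<And>k. (\<Sum>j<n. (y k j)\<^sup>2) = 1"
      "\<And>k. Sup S - 1 / real (Suc k) < \<beta> (x k) (y k)"
    by metis
  have bx: "bounded (range (\<lambda>k. x k i))" if "i < m" for i
    using unit[OF xy(1) that] by (auto intro!: boundedI[of _ 1])
  have by': "bounded (range (\<lambda>k. y k i))" if "i < n" for i
    using unit[OF xy(2) that] by (auto intro!: boundedI[of _ 1])
  obtain \<phi> lx where \<phi>: "strict_mono \<phi>" "\<forall>i\<in>{..<m}. (\<lambda>k. x (\<phi> k) i) \<longlonglongrightarrow> lx i"
    using finite_family_convergent_subsequence[of "{..<m}" "\<lambda>i k. x k i"] bx by auto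
  have "bounded (range (\<lambda>k. y (\<phi> k) i))" if "i < n" for i
    using by'[OF that] by (rule bounded_subset) auto
  then obtain \<psi> ly where \<psi>: "strict_mono \<psi>" "\<forall>i\<in>{..<n}. (\<lambda>k. y (\<phi> (\<psi> k)) i) \<longlonglongrightarrow> ly i"
    using finite_family_convergent_subsequence[of "{..<n}" "\<lambda>i k. y (\<phi> k) i"] by auto
  have lx: "(\<lambda>k. x (\<phi> (\<psi> k)) i) \<longlonglongrightarrow> lx i" if "i < m" for i
    using LIMSEQ_subseq_LIMSEQ[OF \<phi>(2)[rule_format] \<psi>(1), of i] that by (simp add: o_def)
  have "(\<lambda>k. \<Sum>i<m. (x (\<phi> (\<psi> k)) i)\<^sup>2) \<longlonglongrightarrow> (\<Sum>i<m. (lx i)\<^sup>2)"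
    using lx by (intro tendsto_intros) auto
  then have 1: "(\<Sum>i<m. (lx i)\<^sup>2) = 1" using xy(1) by (simp add: LIMSEQ_const_iff)
  have "(\<lambda>k. \<Sum>i<n. (y (\<phi> (\<psi> k)) i)\<^sup>2) \<longlonglongrightarrow> (\<Sum>i<n. (ly i)\<^sup>2)"
    using \<psi>(2) by (intro tendsto_intros) auto
  then have 2: "(\<Sum>j<n. (ly j)\<^sup>2) = 1" using xy(2) by (simp add: LIMSEQ_const_iff)
  have \<beta>lim: "(\<lambda>k. \<beta> (x (\<phi> (\<psi> k))) (y (\<phi> (\<psi> k)))) \<longlonglongrightarrow> \<beta> lx ly"
    unfolding \<beta>_def using lx \<psi>(2) by (intro tendsto_intros) auto
  have mono: "strict_mono (\<phi> \<circ> \<psi>)" by (rule strict_mono_o[OF \<phi>(1) \<psi>(1)])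
  have "(\<lambda>k. Sup S - 1 / real (Suc k)) \<longlonglongrightarrow> Sup S - 0"
    by (intro tendsto_intros LIMSEQ_Suc[OF lim_1_over_n])
  from LIMSEQ_subseq_LIMSEQ[OF this mono]
  have "(\<lambda>k. Sup S - 1 / real (Suc (\<phi> (\<psi> k)))) \<longlonglongrightarrow> Sup S" by (simp add: o_def)
  then have "Sup S \<le> \<beta> lx ly"
    by (rule LIMSEQ_le[OF _ \<beta>lim]) (use xy(3) less_imp_le in blast)
  moreover have "\<beta> x' y' \<le> Sup S"
    if "(\<Sum>i<m. (x' i)\<^sup>2) = 1" "(\<Sum>j<n. (y' j)\<^sup>2) = 1" for x' y'
    using that by (intro cSup_upper[OF _ bdd]) (auto simp: S_def)
  ultimately show ?thesis
    using 1 2 unfolding \<beta>_def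
    by (intro exI[of _ lx] exI[of _ ly] conjI allI impI) (assumption | rule order_trans)+
qed

lemma scalar_prod_mat_vec:
  fixes A :: "real mat"
  assumes "A \<in> carrier_mat m n" "x \<in> carrier_vec m" "y \<in> carrier_vec n"
  shows "scalar_prod x (A *\<^sub>v y) = (\<Sum>i<m. \<Sum>j<n. A $$ (i, j) * x $ i * y $ j)"
  using assms by (auto simp: scalar_prod_def sum_distrib_left lessThan_atLeast0 algebra_simps
      intro!: sum.cong)

lemma scalar_prod_self_eq:
  fixes x :: "real Matrix.vec"
  assumes "x \<in> carrier_vec m"
  shows "scalar_prod x x = (\<Sum>i<m. (x $ i)\<^sup>2)"
  using assms by (auto simp: scalar_prod_def lessThan_atLeast0 power2_eq_square)

lemma bilinear_max_vec:
  fixes A :: "real mat"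
  assumes A: "A \<in> carrier_mat m n" and "m > 0" "n > 0"
  shows "\<exists>u\<in>carrier_vec m. \<exists>v\<in>carrier_vec n. scalar_prod u u = 1 \<and> scalar_prod v v = 1 \<and>
    (\<forall>x\<in>carrier_vec m. \<forall>y\<in>carrier_vec n. scalar_prod x x = 1 \<longrightarrow> scalar_prod y y = 1 \<longrightarrow>
       scalar_prod x (A *\<^sub>v y) \<le> scalar_prod u (A *\<^sub>v v))"
proof -
  obtain x y where xy: "(\<Sum>i<m. (x i)\<^sup>2) = 1" "(\<Sum>j<n. (y j)\<^sup>2) = 1"
    and max: "\<And>x' y'. (\<Sum>i<m. (x' i)\<^sup>2) = 1 \<Longrightarrow> (\<Sum>j<n. (y' j)\<^sup>2) = 1 \<Longrightarrow>
       (\<Sum>i<m. \<Sum>j<n. A $$ (i, j) * x' i * y' j) \<le> (\<Sum>i<m. \<Sum>j<n. A $$ (i, j) * x i * y j)"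
    using bilinear_form_attains_max[OF assms(2,3), of "\<lambda>i j. A $$ (i, j)"] by blast
  define u where "u = Matrix.vec m x"
  define v where "v = Matrix.vec n y"
  have u: "u \<in> carrier_vec m" and v: "v \<in> carrier_vec n" by (auto simp: u_def v_def)
  have "scalar_prod u (A *\<^sub>v v) = (\<Sum>i<m. \<Sum>j<n. A $$ (i, j) * x i * y j)"
    unfolding scalar_prod_mat_vec[OF A u v] by (auto simp: u_def v_def intro!: sum.cong)
  moreover have "scalar_prod u u = 1" "scalar_prod v v = 1"
    unfolding scalar_prod_self_eq[OF u] scalar_prod_self_eq[OF v]
    using xy by (auto simp: u_def v_def)
  ultimately show ?thesis
    using u v max by (intro bexI[OF _ u] bexI[OF _ v])
      (auto simp: scalar_prod_mat_vec[OF A] scalar_prod_self_eq)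
qed

lemma stiefel_carrier: "S \<in> stiefel r n \<Longrightarrow> S \<in> carrier_mat n r"
  by (simp add: stiefel_def)

lemma stiefel_gram: "S \<in> stiefel r n \<Longrightarrow> S\<^sup>T * S = 1\<^sub>m r"
  by (simp add: stiefel_def)

lemma stiefel_mult:
  assumes "S \<in> stiefel r n" "R \<in> stiefel q r"
  shows "S * R \<in> stiefel q n"
proof -
  have S: "S \<in> carrier_mat n r" and R: "R \<in> carrier_mat r q" using assms stiefel_carrier by auto
  have "(S * R)\<^sup>T * (S * R) = R\<^sup>T * (S\<^sup>T * S) * R"
    using S R by (simp add: transpose_mult[OF S R] assoc_mult_mat[of _ _ n _ r _ q]
        assoc_mult_mat[of _ _ r _ n _ r] assoc_mult_mat[of _ _ r _ r _ q] assoc_mult_mat[of _ _ r _ n _ q])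
  then show ?thesis using assms S R by (simp add: stiefel_def)
qed

lemma stiefel_square_right:
  assumes "S \<in> stiefel n n"
  shows "S * S\<^sup>T = 1\<^sub>m n"
  using mat_mult_left_right_inverse[of "S\<^sup>T" n S] assms by (auto simp: stiefel_def)

lemma scalar_prod_transpose:
  fixes A :: "real mat"
  assumes "A \<in> carrier_mat m n" "x \<in> carrier_vec m" "y \<in> carrier_vec n"
  shows "scalar_prod (A\<^sup>T *\<^sub>v x) y = scalar_prod x (A *\<^sub>v y)"
  using transpose_vec_mult_scalar[OF assms(1) assms(3) assms(2)] by simp

lemma stiefel_scalar_prod:
  assumes S: "S \<in> stiefel r n" and x: "x \<in> carrier_vec r" and y: "y \<in> carrier_vec r"
  shows "scalar_prod (S *\<^sub>v x) (S *\<^sub>v y) = scalar_prod x y"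
proof -
  have Sc: "S \<in> carrier_mat n r" using S stiefel_carrier by auto
  have "scalar_prod (S *\<^sub>v x) (S *\<^sub>v y) = scalar_prod x (S\<^sup>T *\<^sub>v (S *\<^sub>v y))"
    using scalar_prod_transpose[of "S\<^sup>T" r n x "S *\<^sub>v y"] Sc x y by simp
  also have "S\<^sup>T *\<^sub>v (S *\<^sub>v y) = y"
    using assoc_mult_mat_vec[of "S\<^sup>T" r n S r y] Sc y stiefel_gram[OF S] by simp
  finally show ?thesis .
qed

text \<open>The Householder reflection that exchanges \<open>u\<close> and the first unit vector.\<close>
lemma orthogonal_with_first_column:
  fixes u :: "real Matrix.vec"
  assumes u: "u \<in> carrier_vec n" and unit: "scalar_prod u u = 1" and n: "n > 0"
  shows "\<exists>Q \<in> stiefel n n. Q *\<^sub>v unit_vec n 0 = u"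
proof (cases "u $ 0 = 1")
  case True
  have "(\<Sum>i<n. (u $ i)\<^sup>2) = 1" using unit scalar_prod_self_eq[OF u] by simp
  then have "(\<Sum>i\<in>{..<n} - {0}. (u $ i)\<^sup>2) = 0"
    using n True by (simp add: sum.remove[of _ 0])
  then have "u $ i = 0" if "i < n" "i \<noteq> 0" for i
    using that by (subst (asm) sum_nonneg_eq_0_iff) auto
  then have "u = unit_vec n 0" using u True by (intro eq_vecI) auto
  then show ?thesis by (intro bexI[of _ "1\<^sub>m n"]) (auto simp: stiefel_def)
next
  case False
  define w where "w = (\<lambda>i. (if i = 0 then 1 else 0) - u $ i)"
  define c where "c = 1 / (1 - u $ 0)"
  define Q where "Q = Matrix.mat n n (\<lambda>(i, j). (if i = j then 1 else 0) - c * w i * w j)"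
  have usum: "(\<Sum>i<n. (u $ i)\<^sup>2) = 1" using unit scalar_prod_self_eq[OF u] by simp
  have "(\<Sum>i<n. (w i)\<^sup>2) = (\<Sum>i<n. (if i = 0 then 1 - 2 * u $ 0 else 0) + (u $ i)\<^sup>2)"
    by (intro sum.cong) (auto simp: w_def power2_eq_square algebra_simps)
  also have "\<dots> = 2 - 2 * u $ 0" using n usum by (simp add: sum.distrib)
  finally have cw: "c * (\<Sum>i<n. (w i)\<^sup>2) = 2"
    using False by (simp add: c_def field_simps)
  have Q: "Q \<in> carrier_mat n n" by (simp add: Q_def)
  have "Q\<^sup>T * Q = 1\<^sub>m n"
  proof (rule eq_matI)
    fix i j assume "i < dim_row (1\<^sub>m n :: real mat)" "j < dim_col (1\<^sub>m n :: real mat)"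
    then have ij: "i < n" "j < n" by auto
    have "(Q\<^sup>T * Q) $$ (i, j) = (\<Sum>k<n. Q $$ (k, i) * Q $$ (k, j))"
      using mat_mult_entry[of "Q\<^sup>T" n n Q n i j] Q ij by simp
    also have "\<dots> = (\<Sum>k<n. (if k = i then (if i = j then 1 else 0) - c * w i * w j else 0)
        + (if k = j then - c * w j * w i else 0) + c * w i * w j * c * (w k)\<^sup>2)"
      using ij by (intro sum.cong) (auto simp: Q_def algebra_simps power2_eq_square)
    also have "\<dots> = (if i = j then 1 else 0) - 2 * c * w i * w j
        + c * w i * w j * (c * (\<Sum>k<n. (w k)\<^sup>2))"
      using ij by (simp add: sum.distrib sum_distrib_left[symmetric] algebra_simps)
    also have "\<dots> = 1\<^sub>m n $$ (i, j)" unfolding cw using ij by simp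
    finally show "(Q\<^sup>T * Q) $$ (i, j) = 1\<^sub>m n $$ (i, j)" .
  qed (use Q in auto)
  then have "Q \<in> stiefel n n" using Q by (simp add: stiefel_def)
  moreover have "Q *\<^sub>v unit_vec n 0 = u"
  proof (rule eq_vecI)
    fix i assume "i < dim_vec u"
    then have i: "i < n" using u by simp
    have "(Q *\<^sub>v unit_vec n 0) $ i = Q $$ (i, 0)" using Q i n by simp
    also have "\<dots> = (if i = 0 then 1 else 0) - c * w i * w 0" using i n by (simp add: Q_def)
    also have "\<dots> = u $ i" using False by (simp add: c_def w_def)
    finally show "(Q *\<^sub>v unit_vec n 0) $ i = u $ i" .
  qed (use u Q in auto)
  ultimately show ?thesis by blast
qed

definition diag_rect :: "nat \<Rightarrow> nat \<Rightarrow> (nat \<Rightarrow> real) \<Rightarrow> real mat" where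
  "diag_rect m n \<sigma> = Matrix.mat m n (\<lambda>(i, j). if i = j then \<sigma> i else 0)"

lemma diag_rect_carrier: "diag_rect m n \<sigma> \<in> carrier_mat m n"
  by (simp add: diag_rect_def)

lemma diag_rect_transpose: "(diag_rect m n \<sigma>)\<^sup>T = diag_rect n m \<sigma>"
  by (intro eq_matI) (auto simp: diag_rect_def)

lemma diag_rect_mult:
  "diag_rect m n \<sigma> * diag_rect n p \<tau> = diag_rect m p (\<lambda>i. if i < n then \<sigma> i * \<tau> i else 0)"
  (is "?A * ?B = ?C")
proof (rule eq_matI)
  fix i j assume "i < dim_row ?C" "j < dim_col ?C"
  then have ij: "i < m" "j < p" by (auto simp: diag_rect_def)
  have "(?A * ?B) $$ (i, j) = (\<Sum>k<n. ?A $$ (i, k) * ?B $$ (k, j))"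
    by (rule mat_mult_entry[OF diag_rect_carrier diag_rect_carrier ij])
  also have "\<dots> = (\<Sum>k<n. if k = i then (if i = j then \<sigma> i * \<tau> i else 0) else 0)"
    using ij by (intro sum.cong) (auto simp: diag_rect_def)
  finally show "(?A * ?B) $$ (i, j) = ?C $$ (i, j)" using ij by (simp add: diag_rect_def)
qed (auto simp: diag_rect_def)

lemma mat_entry_unit_vec:
  fixes M :: "real mat"
  assumes "M \<in> carrier_mat p q" "i < p" "j < q"
  shows "M $$ (i, j) = scalar_prod (unit_vec p i) (M *\<^sub>v unit_vec q j)"
  using assms by simp

lemma conj_mat_entry:
  fixes A :: "real mat"
  assumes A: "A \<in> carrier_mat m n" and U: "U \<in> carrier_mat m p" and V: "V \<in> carrier_mat n q"
    and "i < p" "j < q"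
  shows "(U\<^sup>T * A * V) $$ (i, j) = scalar_prod (U *\<^sub>v unit_vec p i) (A *\<^sub>v (V *\<^sub>v unit_vec q j))"
proof -
  have UT: "U\<^sup>T \<in> carrier_mat p m" and UTA: "U\<^sup>T * A \<in> carrier_mat p n"
    and UTAV: "U\<^sup>T * A * V \<in> carrier_mat p q" and Ve: "V *\<^sub>v unit_vec q j \<in> carrier_vec n"
    and AVe: "A *\<^sub>v (V *\<^sub>v unit_vec q j) \<in> carrier_vec m"
    using A U V by auto
  show ?thesis
    unfolding mat_entry_unit_vec[OF UTAV assms(4,5)] assoc_mult_mat_vec[OF UTA V unit_vec_carrier]
      assoc_mult_mat_vec[OF UT A Ve] scalar_prod_transpose[OF UT unit_vec_carrier AVe, symmetric]
      transpose_transpose ..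
qed

text \<open>Test the bilinear form with the \<open>i\<close>-th unit vector and the normalized \<open>i\<close>-th row.\<close>
lemma row_norm_le_if_bilinear_le:
  fixes A :: "real mat"
  assumes A: "A \<in> carrier_mat m n" and i: "i < m"
    and le: "\<And>x y. x \<in> carrier_vec m \<Longrightarrow> y \<in> carrier_vec n \<Longrightarrow> scalar_prod x x = 1 \<Longrightarrow>
      scalar_prod y y = 1 \<Longrightarrow> scalar_prod x (A *\<^sub>v y) \<le> s" and "0 \<le> s"
  shows "(\<Sum>j<n. (A $$ (i, j))\<^sup>2) \<le> s\<^sup>2"
proof (cases "(\<Sum>j<n. (A $$ (i, j))\<^sup>2) = 0")
  case False
  define N where "N = (\<Sum>j<n. (A $$ (i, j))\<^sup>2)"
  have N: "N > 0" using False sum_nonneg[of "{..<n}" "\<lambda>j. (A $$ (i, j))\<^sup>2"] by (simp add: N_def less_le)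
  define y where "y = Matrix.vec n (\<lambda>j. A $$ (i, j) / sqrt N)"
  have y: "y \<in> carrier_vec n" by (simp add: y_def)
  have "scalar_prod y y = (\<Sum>j<n. (A $$ (i, j))\<^sup>2) / N"
    unfolding scalar_prod_self_eq[OF y] using N
    by (simp add: y_def power_divide sum_divide_distrib)
  then have "scalar_prod y y = 1" using N by (simp add: N_def)
  then have "scalar_prod (unit_vec m i) (A *\<^sub>v y) \<le> s" using le y i by simp
  moreover have "scalar_prod (unit_vec m i) (A *\<^sub>v y) = (A *\<^sub>v y) $ i"
    using A y i by simp
  moreover have "(A *\<^sub>v y) $ i = (\<Sum>j<n. (A $$ (i, j))\<^sup>2) / sqrt N"
    using A i by (simp add: y_def scalar_prod_def power2_eq_square sum_divide_distrib
        lessThan_atLeast0)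
  moreover have "N / sqrt N = sqrt N" using N by (simp add: real_div_sqrt)
  ultimately have "sqrt N \<le> s" by (simp add: N_def)
  then show ?thesis using N unfolding N_def[symmetric] by (simp add: real_le_lsqrt sqrt_le_D)
qed simp

text \<open>A pair of unit vectors maximising the bilinear form of \<open>A\<close> is a pair of leading singular
  vectors: in orthonormal bases beginning with them, the first row and the first column of \<open>A\<close>
  have norm at most the maximum, which is already their first entry, so the rest of them
  vanishes.\<close>
lemma svd_exists:
  fixes A :: "real mat"
  assumes "A \<in> carrier_mat m n"
  shows "\<exists>U \<in> stiefel m m. \<exists>V \<in> stiefel n n. \<exists>\<sigma>. (\<forall>i j. i \<le> j \<longrightarrow> \<sigma> j \<le> \<sigma> i) \<and> (\<forall>i. 0 \<le> \<sigma> i) \<and>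
    (\<forall>i \<ge> min m n. \<sigma> i = 0) \<and> U\<^sup>T * A * V = diag_rect m n \<sigma>"
  using assms
proof (induction m arbitrary: A n)
  case 0
  then show ?case
    by (intro bexI[of _ "1\<^sub>m 0"] bexI[of _ "1\<^sub>m n"] exI[of _ "\<lambda>_. 0"])
      (auto simp: stiefel_def diag_rect_def intro!: eq_matI)
next
  case (Suc m A n')
  note A = Suc.prems
  show ?case
  proof (cases n')
    case 0
    then show ?thesis using A
      by (intro bexI[of _ "1\<^sub>m (Suc m)"] bexI[of _ "1\<^sub>m n'"] exI[of _ "\<lambda>_. 0"])
        (auto simp: stiefel_def diag_rect_def intro!: eq_matI)
  next
    case (Suc n)
    note n' = this
    obtain u v where u: "u \<in> carrier_vec (Suc m)" "scalar_prod u u = 1"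
      and v: "v \<in> carrier_vec n'" "scalar_prod v v = 1"
      and max: "\<And>x y. x \<in> carrier_vec (Suc m) \<Longrightarrow> y \<in> carrier_vec n' \<Longrightarrow> scalar_prod x x = 1 \<Longrightarrow>
        scalar_prod y y = 1 \<Longrightarrow> scalar_prod x (A *\<^sub>v y) \<le> scalar_prod u (A *\<^sub>v v)"
      using bilinear_max_vec[OF A] n' by auto
    define s where "s = scalar_prod u (A *\<^sub>v v)"
    have "scalar_prod (- u) (A *\<^sub>v v) \<le> s"
      unfolding s_def using u v by (intro max) auto
    moreover have "scalar_prod (- u) (A *\<^sub>v v) = - s"
      unfolding s_def using u v A by (intro uminus_scalar_prod[symmetric]) auto
    ultimately have s0: "0 \<le> s" by simp
    obtain U1 where U1: "U1 \<in> stiefel (Suc m) (Suc m)" "U1 *\<^sub>v unit_vec (Suc m) 0 = u"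
      using orthogonal_with_first_column[OF u] by auto
    obtain V1 where V1: "V1 \<in> stiefel n' n'" "V1 *\<^sub>v unit_vec n' 0 = v"
      using orthogonal_with_first_column[OF v] n' by auto
    note Uc = stiefel_carrier[OF U1(1)] and Vc = stiefel_carrier[OF V1(1)]
    have bil: "scalar_prod (U *\<^sub>v x) (A *\<^sub>v (V *\<^sub>v y)) \<le> s"
      if "U \<in> stiefel p (Suc m)" "V \<in> stiefel q n'" "x \<in> carrier_vec p" "y \<in> carrier_vec q"
        "scalar_prod x x = 1" "scalar_prod y y = 1" for U V p q x y
      unfolding s_def using that stiefel_carrier[OF that(1)] stiefel_carrier[OF that(2)]
      by (intro max) (auto simp: stiefel_scalar_prod)
    define A' where "A' = U1\<^sup>T * A * V1"
    have A': "A' \<in> carrier_mat (Suc m) n'" using Uc Vc A by (simp add: A'_def)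
    have A'bil: "scalar_prod x (A' *\<^sub>v y) \<le> s"
      if xy: "x \<in> carrier_vec (Suc m)" "y \<in> carrier_vec n'" "scalar_prod x x = 1" "scalar_prod y y = 1" for x y
    proof -
      have "A' *\<^sub>v y = U1\<^sup>T *\<^sub>v (A *\<^sub>v (V1 *\<^sub>v y))"
        using Uc Vc A xy assoc_mult_mat_vec[of "U1\<^sup>T * A" "Suc m" n' V1 n' y]
          assoc_mult_mat_vec[of "U1\<^sup>T" "Suc m" "Suc m" A n' "V1 *\<^sub>v y"] by (simp add: A'_def)
      then have "scalar_prod x (A' *\<^sub>v y) = scalar_prod (U1 *\<^sub>v x) (A *\<^sub>v (V1 *\<^sub>v y))"
        using Uc Vc A xy scalar_prod_transpose[of "U1\<^sup>T" "Suc m" "Suc m" x "A *\<^sub>v (V1 *\<^sub>v y)"] by simp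
      then show ?thesis using bil[OF U1(1) V1(1) xy] by simp
    qed
    have A'00: "A' $$ (0, 0) = s"
      unfolding A'_def s_def using conj_mat_entry[OF A Uc Vc, of 0 0] U1(2) V1(2) n' by simp
    have rest0: "z j = 0" if "(\<Sum>j<k. (z j)\<^sup>2) \<le> s\<^sup>2" "z 0 = s" "0 < j" "j < k" for z :: "nat \<Rightarrow> real" and k j
    proof -
      have "(\<Sum>j<k. (z j)\<^sup>2) = (z 0)\<^sup>2 + (\<Sum>j\<in>{..<k} - {0}. (z j)\<^sup>2)"
        using that(3,4) by (intro sum.remove) auto
      then have "(\<Sum>j\<in>{..<k} - {0}. (z j)\<^sup>2) \<le> 0" using that(1,2) by simp
      moreover have "(z j)\<^sup>2 \<le> (\<Sum>j\<in>{..<k} - {0}. (z j)\<^sup>2)"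
        using that(3,4) by (intro member_le_sum) auto
      ultimately show ?thesis by (meson order_trans power2_less_eq_zero_iff)
    qed
    have row0: "A' $$ (0, j) = 0" if "0 < j" "j < n'" for j
    proof (rule rest0[where z = "\<lambda>j. A' $$ (0, j)" and k = n'])
      show "(\<Sum>j<n'. (A' $$ (0, j))\<^sup>2) \<le> s\<^sup>2"
        by (rule row_norm_le_if_bilinear_le[OF A' _ _ s0]) (simp, rule A'bil)
    qed (use A'00 that in auto)
    have A'T: "A'\<^sup>T \<in> carrier_mat n' (Suc m)" using A' by simp
    have A'Tbil: "scalar_prod y (A'\<^sup>T *\<^sub>v x) \<le> s"
      if xy: "y \<in> carrier_vec n'" "x \<in> carrier_vec (Suc m)" "scalar_prod y y = 1" "scalar_prod x x = 1" for x y
    proof -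
      have "scalar_prod y (A'\<^sup>T *\<^sub>v x) = scalar_prod x (A' *\<^sub>v y)"
        using scalar_prod_transpose[OF A' xy(2,1)] comm_scalar_prod[of y n' "A'\<^sup>T *\<^sub>v x"] A' xy by simp
      then show ?thesis using A'bil xy by simp
    qed
    have col0: "A' $$ (i, 0) = 0" if "0 < i" "i < Suc m" for i
    proof (rule rest0[where z = "\<lambda>i. A' $$ (i, 0)" and k = "Suc m"])
      have "(\<Sum>i<Suc m. (A'\<^sup>T $$ (0, i))\<^sup>2) \<le> s\<^sup>2"
        by (rule row_norm_le_if_bilinear_le[OF A'T _ _ s0]) (simp add: n', rule A'Tbil)
      moreover have "(\<Sum>i<Suc m. (A'\<^sup>T $$ (0, i))\<^sup>2) = (\<Sum>i<Suc m. (A' $$ (i, 0))\<^sup>2)"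
        using A' n' by (intro sum.cong) auto
      ultimately show "(\<Sum>i<Suc m. (A' $$ (i, 0))\<^sup>2) \<le> s\<^sup>2" by simp
    qed (use A'00 that in auto)
    define B where "B = Matrix.mat m n (\<lambda>(i, j). A' $$ (Suc i, Suc j))"
    have B: "B \<in> carrier_mat m n" by (simp add: B_def)
    obtain U' V' \<sigma>' where U': "U' \<in> stiefel m m" and V': "V' \<in> stiefel n n"
      and dec: "\<forall>i j. i \<le> j \<longrightarrow> \<sigma>' j \<le> \<sigma>' i" and nn: "\<forall>i. 0 \<le> \<sigma>' i"
      and z: "\<forall>i \<ge> min m n. \<sigma>' i = 0" and UBV: "U'\<^sup>T * B * V' = diag_rect m n \<sigma>'"
      using Suc.IH[OF B] by blast
    have A'blk: "A' = four_block_mat (s \<cdot>\<^sub>m 1\<^sub>m 1) (0\<^sub>m 1 n) (0\<^sub>m m 1) B"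
      using A' n' A'00 row0 col0 by (intro eq_matI) (auto simp: B_def)
    define U2 where "U2 = four_block_mat (1\<^sub>m 1) (0\<^sub>m 1 m) (0\<^sub>m m 1) U'"
    define V2 where "V2 = four_block_mat (1\<^sub>m 1) (0\<^sub>m 1 n) (0\<^sub>m n 1) V'"
    note U'c = stiefel_carrier[OF U'] and V'c = stiefel_carrier[OF V']
    have U2c: "U2 \<in> carrier_mat (Suc m) (Suc m)" using U'c by (intro carrier_matI) (auto simp: U2_def)
    have V2c: "V2 \<in> carrier_mat n' n'" using V'c n' by (intro carrier_matI) (auto simp: V2_def)
    have U2T: "U2\<^sup>T = four_block_mat (1\<^sub>m 1) (0\<^sub>m 1 m) (0\<^sub>m m 1) (U'\<^sup>T)"
      unfolding U2_def using U'c by (subst transpose_four_block_mat) auto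
    have V2T: "V2\<^sup>T = four_block_mat (1\<^sub>m 1) (0\<^sub>m 1 n) (0\<^sub>m n 1) (V'\<^sup>T)"
      unfolding V2_def using V'c by (subst transpose_four_block_mat) auto
    have "U2\<^sup>T * U2 = four_block_mat (1\<^sub>m 1) (0\<^sub>m 1 m) (0\<^sub>m m 1) (1\<^sub>m m)"
      unfolding U2T unfolding U2_def using U'c stiefel_gram[OF U']
      by (subst mult_four_block_mat[where ?n1.0 = 1 and ?n2.0 = m]) auto
    then have U2: "U2 \<in> stiefel (Suc m) (Suc m)" using U2c by (simp add: stiefel_def)
    have "V2\<^sup>T * V2 = four_block_mat (1\<^sub>m 1) (0\<^sub>m 1 n) (0\<^sub>m n 1) (1\<^sub>m n)"
      unfolding V2T unfolding V2_def using V'c stiefel_gram[OF V']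
      by (subst mult_four_block_mat[where ?n1.0 = 1 and ?n2.0 = n]) auto
    then have V2: "V2 \<in> stiefel n' n'" using V2c n' by (simp add: stiefel_def)
    define \<sigma> where "\<sigma> = (\<lambda>i. case i of 0 \<Rightarrow> s | Suc i \<Rightarrow> \<sigma>' i)"
    have "U2\<^sup>T * A' = four_block_mat (s \<cdot>\<^sub>m 1\<^sub>m 1) (0\<^sub>m 1 n) (0\<^sub>m m 1) (U'\<^sup>T * B)"
      unfolding U2T A'blk using U'c B
      by (subst mult_four_block_mat[where ?n1.0 = 1 and ?n2.0 = m]) auto
    then have "U2\<^sup>T * A' * V2 = four_block_mat (s \<cdot>\<^sub>m 1\<^sub>m 1) (0\<^sub>m 1 n) (0\<^sub>m m 1) (U'\<^sup>T * B)
        * four_block_mat (1\<^sub>m 1) (0\<^sub>m 1 n) (0\<^sub>m n 1) V'"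
      by (simp only: V2_def)
    also have "\<dots> = four_block_mat (s \<cdot>\<^sub>m 1\<^sub>m 1) (0\<^sub>m 1 n) (0\<^sub>m m 1) (U'\<^sup>T * B * V')"
      using U'c V'c B by (subst mult_four_block_mat[where ?n1.0 = 1 and ?n2.0 = n]) auto
    also have "\<dots> = diag_rect (Suc m) n' \<sigma>"
      unfolding UBV by (intro eq_matI) (auto simp: diag_rect_def \<sigma>_def n' split: nat.splits)
    finally have diag2: "U2\<^sup>T * A' * V2 = diag_rect (Suc m) n' \<sigma>" .
    define U where "U = U1 * U2"
    define V where "V = V1 * V2"
    have U: "U \<in> stiefel (Suc m) (Suc m)" unfolding U_def by (rule stiefel_mult[OF U1(1) U2])
    have V: "V \<in> stiefel n' n'" unfolding V_def by (rule stiefel_mult[OF V1(1) V2])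
    have diag: "U\<^sup>T * A * V = diag_rect (Suc m) n' \<sigma>"
    proof -
      have "U\<^sup>T * A * V = U2\<^sup>T * (U1\<^sup>T * A) * (V1 * V2)"
        unfolding U_def V_def transpose_mult[OF Uc U2c] using Uc U2c A
          assoc_mult_mat[of "U2\<^sup>T" "Suc m" "Suc m" "U1\<^sup>T" "Suc m" A n'] by simp
      also have "\<dots> = U2\<^sup>T * (U1\<^sup>T * A) * V1 * V2"
        using Uc U2c Vc V2c A assoc_mult_mat[of "U2\<^sup>T * (U1\<^sup>T * A)" "Suc m" n' V1 n' V2 n'] by simp
      also have "U2\<^sup>T * (U1\<^sup>T * A) * V1 = U2\<^sup>T * A'"
        unfolding A'_def
        using Uc U2c Vc A assoc_mult_mat[of "U2\<^sup>T" "Suc m" "Suc m" "U1\<^sup>T * A" n' V1 n'] by simp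
      finally show ?thesis using diag2 by simp
    qed
    have \<sigma>s: "\<sigma>' 0 \<le> s"
    proof (cases "min m n = 0")
      case True
      then show ?thesis using z s0 by auto
    next
      case False
      then have "diag_rect (Suc m) n' \<sigma> $$ (1, 1) = \<sigma>' 0" using n' by (simp add: diag_rect_def \<sigma>_def)
      moreover have "(U\<^sup>T * A * V) $$ (1, 1) \<le> s"
        using False n' bil[OF U V, of "unit_vec (Suc m) 1" "unit_vec n' 1"]
        by (subst conj_mat_entry[OF A stiefel_carrier[OF U] stiefel_carrier[OF V]]) auto
      ultimately show ?thesis using diag by simp
    qed
    have "\<sigma>' i \<le> s" for i using \<sigma>s dec by (meson le0 order_trans)
    then have "\<forall>i j. i \<le> j \<longrightarrow> \<sigma> j \<le> \<sigma> i" using dec by (auto simp: \<sigma>_def split: nat.splits)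
    moreover have "\<forall>i. 0 \<le> \<sigma> i" using nn s0 by (auto simp: \<sigma>_def split: nat.splits)
    moreover have "\<forall>i \<ge> min (Suc m) n'. \<sigma> i = 0" using z n' by (auto simp: \<sigma>_def split: nat.splits)
    ultimately show ?thesis using U V diag by blast
  qed
qed

lemma is_singular_values_singular_value: "is_singular_values A (singular_value A)"
proof -
  let ?m = "dim_row A" and ?n = "dim_col A"
  have A: "A \<in> carrier_mat ?m ?n" by simp
  obtain U V \<sigma> where U: "U \<in> stiefel ?m ?m" and V: "V \<in> stiefel ?n ?n"
    and \<sigma>: "\<forall>i j. i \<le> j \<longrightarrow> \<sigma> j \<le> \<sigma> i" "\<forall>i. 0 \<le> \<sigma> i" "\<forall>i \<ge> min ?m ?n. \<sigma> i = 0"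
    and diag: "U\<^sup>T * A * V = diag_rect ?m ?n \<sigma>"
    using svd_exists[OF A] by blast
  note Uc = stiefel_carrier[OF U] and Vc = stiefel_carrier[OF V]
  have UT: "U\<^sup>T \<in> carrier_mat ?m ?m" and VT: "V\<^sup>T \<in> carrier_mat ?n ?n"
    and UTA: "U\<^sup>T * A \<in> carrier_mat ?m ?n" using Uc Vc by auto
  have "U * (U\<^sup>T * A) = A"
    unfolding assoc_mult_mat[OF Uc UT A, symmetric] stiefel_square_right[OF U] by simp
  then have "U * (U\<^sup>T * A * V) = A * V"
    unfolding assoc_mult_mat[OF Uc UTA Vc, symmetric] by simp
  moreover have "A * V * V\<^sup>T = A"
    unfolding assoc_mult_mat[OF A Vc VT] stiefel_square_right[OF V] by simp
  ultimately have "A = U * diag_rect ?m ?n \<sigma> * V\<^sup>T" unfolding diag by simp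
  then have "is_singular_values A \<sigma>"
    using U V \<sigma> unfolding is_singular_values_def diag_rect_def by blast
  then show ?thesis unfolding singular_value_def by (rule someI[of "is_singular_values A"])
qed

lemma bilinear_le_frob_norm:
  fixes B :: "real mat"
  assumes B: "B \<in> carrier_mat m n" and x: "x \<in> carrier_vec m" and y: "y \<in> carrier_vec n"
  shows "(scalar_prod x (B *\<^sub>v y))\<^sup>2 \<le> (frob_norm B)\<^sup>2 * (scalar_prod x x * scalar_prod y y)"
proof -
  let ?I = "{..<m} \<times> {..<n}"
  have "scalar_prod x (B *\<^sub>v y) = (\<Sum>p\<in>?I. B $$ p * (x $ fst p * y $ snd p))"
    unfolding scalar_prod_mat_vec[OF assms] sum.cartesian_product
    by (intro sum.cong) (auto simp: algebra_simps)
  also have "(\<dots>)\<^sup>2 \<le> (\<Sum>p\<in>?I. (B $$ p)\<^sup>2) * (\<Sum>p\<in>?I. (x $ fst p * y $ snd p)\<^sup>2)"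
    by (rule Cauchy_Schwarz_ineq_sum)
  also have "(\<Sum>p\<in>?I. (x $ fst p * y $ snd p)\<^sup>2) = (\<Sum>i<m. (x $ i)\<^sup>2) * (\<Sum>j<n. (y $ j)\<^sup>2)"
    unfolding sum_product sum.cartesian_product by (intro sum.cong) (auto simp: power_mult_distrib)
  also have "(\<Sum>p\<in>?I. (B $$ p)\<^sup>2) = (frob_norm B)\<^sup>2"
    using B by (simp add: frob_norm_def sum_nonneg sum.cartesian_product case_prod_beta)
  finally show ?thesis using scalar_prod_self_eq x y by metis
qed

text \<open>The kernel of \<open>L\<close> meets the span of the first \<open>rank L + 1\<close> right singular vectors of \<open>A\<close>,
  and \<open>A\<close> stretches every vector of this span by at least the last of the corresponding singular
  values.\<close>
lemma singular_value_le_dist_low_rank: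
  fixes A L :: "real mat"
  assumes A: "A \<in> carrier_mat m n" and L: "L \<in> carrier_mat m n"
  shows "singular_value A (mat_rank L) \<le> frob_norm (A - L)"
proof -
  define q where "q = mat_rank L"
  define \<sigma> where "\<sigma> = singular_value A"
  have sv: "is_singular_values A \<sigma>" unfolding \<sigma>_def by (rule is_singular_values_singular_value)
  have frob0: "0 \<le> frob_norm (A - L)" by (simp add: frob_norm_def sum_nonneg)
  show ?thesis
  proof (cases "min m n \<le> q")
    case True
    then have "\<sigma> q = 0" using sv A by (simp add: is_singular_values_def)
    then show ?thesis using frob0 by (simp add: \<sigma>_def q_def)
  next
    case False
    then have q: "q < m" "q < n" by auto
    obtain U V where U: "U \<in> stiefel m m" and V: "V \<in> stiefel n n"
      and AUV: "A = U * diag_rect m n \<sigma> * V\<^sup>T"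
      using sv A unfolding is_singular_values_def diag_rect_def by auto
    have dec: "\<sigma> q \<le> \<sigma> i" if "i \<le> q" for i
      using sv that by (auto simp: is_singular_values_def)
    have nn: "0 \<le> \<sigma> i" for i using sv by (auto simp: is_singular_values_def)
    define I where "I = (\<lambda>m. diag_rect m (Suc q) (\<lambda>_. 1))"
    have Ic: "I m \<in> carrier_mat m (Suc q)" for m by (simp add: I_def diag_rect_def)
    have I: "I m \<in> stiefel (Suc q) m" if "q < m" for m
    proof -
      have "(I m)\<^sup>T * I m = 1\<^sub>m (Suc q)"
        unfolding I_def diag_rect_transpose diag_rect_mult using that
        by (intro eq_matI) (auto simp: diag_rect_def)
      then show ?thesis using Ic by (simp add: stiefel_def)
    qed
    define P where "P = U * I m"
    define Q where "Q = V * I n"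
    have P: "P \<in> stiefel (Suc q) m" unfolding P_def by (rule stiefel_mult[OF U I[OF q(1)]])
    have Q: "Q \<in> stiefel (Suc q) n" unfolding Q_def by (rule stiefel_mult[OF V I[OF q(2)]])
    note Uc = stiefel_carrier[OF U] and Vc = stiefel_carrier[OF V]
      and Pc = stiefel_carrier[OF P] and Qc = stiefel_carrier[OF Q]
    have Dc: "diag_rect m n \<sigma> \<in> carrier_mat m n" by (simp add: diag_rect_def)
    have Q1: "V\<^sup>T * Q = I n"
      unfolding Q_def using assoc_mult_mat[of "V\<^sup>T" n n V n "I n" "Suc q"] Vc Ic[of n] stiefel_gram[OF V]
      by (simp del: assoc_mult_mat)
    have P1: "P\<^sup>T * U = (I m)\<^sup>T"
      unfolding P_def transpose_mult[OF Uc Ic] 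
      using assoc_mult_mat[of "(I m)\<^sup>T" "Suc q" m "U\<^sup>T" m U m] Uc Ic[of m] stiefel_gram[OF U]
      by (simp del: assoc_mult_mat)
    have VT: "V\<^sup>T \<in> carrier_mat n n" and PT: "P\<^sup>T \<in> carrier_mat (Suc q) m"
      and UD: "U * diag_rect m n \<sigma> \<in> carrier_mat m n" and ITc: "(I m)\<^sup>T \<in> carrier_mat (Suc q) m"
      using Uc Vc Pc Dc Ic[of m] by auto
    have "P\<^sup>T * (U * diag_rect m n \<sigma>) = (I m)\<^sup>T * diag_rect m n \<sigma>"
      unfolding assoc_mult_mat[OF PT Uc Dc, symmetric] P1 ..
    then have "P\<^sup>T * A = (I m)\<^sup>T * diag_rect m n \<sigma> * V\<^sup>T"
      unfolding AUV assoc_mult_mat[OF PT UD VT, symmetric] by simp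
    then have "P\<^sup>T * A * Q = (I m)\<^sup>T * diag_rect m n \<sigma> * (V\<^sup>T * Q)"
      using assoc_mult_mat[of "(I m)\<^sup>T * diag_rect m n \<sigma>" "Suc q" n "V\<^sup>T" n Q "Suc q"] ITc Dc VT Qc
      by (simp del: assoc_mult_mat)
    also have "\<dots> = (I m)\<^sup>T * (diag_rect m n \<sigma> * I n)"
      unfolding Q1 by (rule assoc_mult_mat[OF ITc Dc Ic])
    also have "\<dots> = diag_rect (Suc q) (Suc q) \<sigma>"
      unfolding I_def diag_rect_transpose diag_rect_mult using q
      by (intro eq_matI) (auto simp: diag_rect_def)
    finally have PAQ: "P\<^sup>T * A * Q = diag_rect (Suc q) (Suc q) \<sigma>" .
    define M where "M = P\<^sup>T * L * Q"
    have M: "M \<in> carrier_mat (Suc q) (Suc q)" using Pc Qc L by (simp add: M_def)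
    have "Determinant.det M = 0"
    proof (rule ccontr)
      assume "Determinant.det M \<noteq> 0"
      then obtain Mi where Mi: "Mi \<in> carrier_mat (Suc q) (Suc q)" "M * Mi = 1\<^sub>m (Suc q)"
        using inverse_mat_exists[OF M] by blast
      have "P\<^sup>T * L * (Q * Mi) = 1\<^sub>m (Suc q)"
        using assoc_mult_mat[of "P\<^sup>T * L" "Suc q" n Q "Suc q" Mi "Suc q"] Pc Qc L Mi
        by (simp add: M_def del: assoc_mult_mat)
      then have "Suc q \<le> mat_rank L"
        using Pc Qc Mi by (subst le_mat_rank_iff[OF L]) (intro bexI[of _ "P\<^sup>T"] bexI[of _ "Q * Mi"], auto)
      then show False by (simp add: q_def)
    qed
    then obtain z where z: "z \<in> carrier_vec (Suc q)" "z \<noteq> 0\<^sub>v (Suc q)" "M *\<^sub>v z = 0\<^sub>v (Suc q)"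
      using det_0_iff_vec_prod_zero[OF M] by blast
    have zpos: "scalar_prod z z > 0"
      using scalar_prod_self_zero[OF z(1)] z(2) scalar_prod_self_eq[OF z(1)]
        sum_nonneg[of "{..<Suc q}" "\<lambda>i. (z $ i)\<^sup>2"] by (metis less_eq_real_def zero_le_power2)
    define D where "D = diag_rect (Suc q) (Suc q) \<sigma>"
    have D: "D \<in> carrier_mat (Suc q) (Suc q)" by (simp add: D_def diag_rect_def)
    define w where "w = D *\<^sub>v z"
    have w: "w \<in> carrier_vec (Suc q)" using D z by (simp add: w_def)
    have wi: "w $ i = \<sigma> i * z $ i" if "i < Suc q" for i
    proof -
      have "w $ i = (\<Sum>k<Suc q. D $$ (i, k) * z $ k)"
        using that z D by (simp add: w_def scalar_prod_def lessThan_atLeast0)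
      also have "\<dots> = (\<Sum>k<Suc q. if k = i then \<sigma> i * z $ i else 0)"
        using that by (intro sum.cong) (auto simp: D_def diag_rect_def)
      finally show ?thesis using that by simp
    qed
    have PBQ: "P\<^sup>T * (A - L) * Q = D - M"
      unfolding mult_minus_distrib_mat[OF PT A L] M_def D_def PAQ[symmetric]
      using PT A L by (intro minus_mult_distrib_mat[OF _ _ Qc]) auto
    have "scalar_prod w w = scalar_prod w ((D - M) *\<^sub>v z)"
      using D M z by (simp add: w_def minus_mult_distrib_mat_vec)
    also have "(D - M) *\<^sub>v z = P\<^sup>T *\<^sub>v ((A - L) *\<^sub>v (Q *\<^sub>v z))"
      unfolding PBQ[symmetric] using Pc Qc A L z minus_carrier_mat[OF L, of A]
        assoc_mult_mat_vec[of "P\<^sup>T * (A - L)" "Suc q" n Q "Suc q" z]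
        assoc_mult_mat_vec[of "P\<^sup>T" "Suc q" m "A - L" n "Q *\<^sub>v z"]
      by (simp del: assoc_mult_mat assoc_mult_mat_vec)
    also have "scalar_prod w (P\<^sup>T *\<^sub>v ((A - L) *\<^sub>v (Q *\<^sub>v z))) = scalar_prod (P *\<^sub>v w) ((A - L) *\<^sub>v (Q *\<^sub>v z))"
      using scalar_prod_transpose[of "P\<^sup>T" "Suc q" m w "(A - L) *\<^sub>v (Q *\<^sub>v z)"] Pc Qc A L z w
        minus_carrier_mat[OF L, of A] by simp
    finally have ww: "scalar_prod w w = scalar_prod (P *\<^sub>v w) ((A - L) *\<^sub>v (Q *\<^sub>v z))" .
    have "(scalar_prod w w)\<^sup>2 \<le> (frob_norm (A - L))\<^sup>2 * (scalar_prod w w * scalar_prod z z)"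
      using bilinear_le_frob_norm[of "A - L" m n "P *\<^sub>v w" "Q *\<^sub>v z"] ww A L Pc Qc w z
        minus_carrier_mat[OF L, of A]
        stiefel_scalar_prod[OF P w w] stiefel_scalar_prod[OF Q z(1) z(1)] by simp
    then have "scalar_prod w w * scalar_prod w w \<le> scalar_prod w w * ((frob_norm (A - L))\<^sup>2 * scalar_prod z z)"
      by (simp add: power2_eq_square algebra_simps)
    moreover have "0 \<le> scalar_prod w w" unfolding scalar_prod_self_eq[OF w] by (simp add: sum_nonneg)
    ultimately have "scalar_prod w w \<le> (frob_norm (A - L))\<^sup>2 * scalar_prod z z"
      by (metis (no_types, lifting) mult_le_cancel_left_pos less_eq_real_def mult_nonneg_nonneg
          zero_le_power2 zpos)
    moreover have "(\<sigma> q)\<^sup>2 * scalar_prod z z \<le> scalar_prod w w"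
      unfolding scalar_prod_self_eq[OF w] scalar_prod_self_eq[OF z(1)] sum_distrib_left
      using dec nn by (intro sum_mono) (auto simp: wi power_mult_distrib intro!: mult_right_mono power_mono)
    ultimately have "(\<sigma> q)\<^sup>2 * scalar_prod z z \<le> (frob_norm (A - L))\<^sup>2 * scalar_prod z z" by linarith
    then have "(\<sigma> q)\<^sup>2 \<le> (frob_norm (A - L))\<^sup>2" using zpos by simp
    then have "\<sigma> q \<le> frob_norm (A - L)" by (rule power2_le_imp_le[OF _ frob0])
    then show ?thesis by (simp add: \<sigma>_def q_def)
  qed
qed

lemma rank_Delta_le_rank:
  fixes A L :: "real mat"
  assumes "A \<in> carrier_mat m n" "L \<in> carrier_mat m n" "frob_norm (A - L) \<le> \<Delta>"
  shows "rank_Delta \<Delta> A \<le> mat_rank L"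
  unfolding rank_Delta_def
  by (rule Least_le) (rule order_trans[OF singular_value_le_dist_low_rank[OF assms(1,2)] assms(3)])

section \<open>Mode products of tensors\<close>

(* Products are reassociated explicitly from here on; the default rewrite to the right would undo
   the regrouping at the small inner dimensions. *)
declare assoc_mult_mat [simp del]

text \<open>The mode-\<open>k\<close> product as a total operation on functions. It needs no shape, and products in
  different modes commute without any side condition; the shapes only matter for the set of
  indices on which the result is meaningful.\<close>
definition tprod :: "nat \<Rightarrow> real mat \<Rightarrow> tensor \<Rightarrow> tensor" where
  "tprod k A X = (\<lambda>i. \<Sum>b<dim_col A. A $$ (i k, b) * X (i(k := b)))"

definition tprods :: "nat set \<Rightarrow> (nat \<Rightarrow> real mat) \<Rightarrow> tensor \<Rightarrow> tensor" where
  "tprods K A X = Finite_Set.fold (\<lambda>k. tprod k (A k)) X K"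

lemma multi_indices_cong: "(\<And>k. k \<in> {1..d} \<Longrightarrow> p k = p' k) \<Longrightarrow> multi_indices d p = multi_indices d p'"
  unfolding multi_indices_def by (intro PiE_cong) auto

lemma finite_multi_indices [simp]: "finite (multi_indices d p)"
  unfolding multi_indices_def by (intro finite_PiE) auto

lemma multi_indices_less: "i \<in> multi_indices d p \<Longrightarrow> k \<in> {1..d} \<Longrightarrow> i k < p k"
  unfolding multi_indices_def by auto

lemma multi_indices_update:
  assumes "i \<in> multi_indices d p" "k \<in> {1..d}" "b < m"
  shows "i(k := b) \<in> multi_indices d (p(k := m))"
  using assms unfolding multi_indices_def by (auto simp: PiE_iff extensional_def)

lemma multi_indices_update_back:
  assumes "i \<in> multi_indices d (p(k := m))" "k \<in> {1..d}" "b < p k"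
  shows "i(k := b) \<in> multi_indices d p"
  using multi_indices_update[OF assms] by simp

lemma tprod_commute:
  assumes "j \<noteq> k"
  shows "tprod j A (tprod k B X) = tprod k B (tprod j A X)"
proof
  fix i
  have "tprod j A (tprod k B X) i
      = (\<Sum>a<dim_col A. \<Sum>b<dim_col B. A $$ (i j, a) * (B $$ (i k, b) * X (i(j := a, k := b))))"
    using assms by (simp add: tprod_def sum_distrib_left)
  also have "\<dots> = (\<Sum>b<dim_col B. \<Sum>a<dim_col A. A $$ (i j, a) * (B $$ (i k, b) * X (i(j := a, k := b))))"
    by (rule sum.swap)
  also have "\<dots> = tprod k B (tprod j A X) i"
    using assms by (simp add: tprod_def sum_distrib_left fun_upd_twist[of j k] algebra_simps)
  finally show "tprod j A (tprod k B X) i = tprod k B (tprod j A X) i" .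
qed

lemma comp_fun_commute_tprod: "comp_fun_commute (\<lambda>k. tprod k (A k))"
proof
  fix j k
  show "tprod j (A j) \<circ> tprod k (A k) = tprod k (A k) \<circ> tprod j (A j)"
    by (cases "j = k") (auto simp: tprod_commute)
qed

lemma tprods_empty [simp]: "tprods {} A X = X"
  by (simp add: tprods_def)

lemma tprods_insert:
  assumes "finite K" "k \<notin> K"
  shows "tprods (insert k K) A X = tprod k (A k) (tprods K A X)"
  unfolding tprods_def
  by (rule Finite_Set.comp_fun_commute_on.fold_insert[OF comp_fun_commute_tprod[unfolded comp_fun_commute_def']])
    (use assms in auto)

lemma tprods_tprod:
  assumes "finite K" "k \<notin> K"
  shows "tprods K A (tprod k B X) = tprod k B (tprods K A X)"
  using assms by (induction K rule: finite_induct) (auto simp: tprods_insert tprod_commute)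

lemma tprods_matrix_cong:
  assumes "finite K" "\<And>k. k \<in> K \<Longrightarrow> A k = B k"
  shows "tprods K A X = tprods K B X"
  using assms by (induction K rule: finite_induct) (auto simp: tprods_insert)

lemma tprod_cong:
  assumes "i \<in> multi_indices d (p(k := m))" "k \<in> {1..d}" "dim_col A = p k"
    and "\<And>i. i \<in> multi_indices d p \<Longrightarrow> X i = Y i"
  shows "tprod k A X i = tprod k A Y i"
  unfolding tprod_def using assms multi_indices_update_back[OF assms(1,2)]
  by (intro sum.cong) auto

text \<open>Here \<open>p\<close> is the shape before and \<open>p'\<close> the shape after the products. The induction peels off
  the outermost product, so it passes through the intermediate shape \<open>p'(k := p k)\<close>.\<close>
lemma tprods_cong:
  assumes "finite K" "K \<subseteq> {1..d}" "\<And>k. k \<in> K \<Longrightarrow> dim_col (A k) = p k"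
    and "\<And>k. k \<in> {1..d} - K \<Longrightarrow> p' k = p k"
    and "\<And>i. i \<in> multi_indices d p \<Longrightarrow> X i = Y i"
    and "i \<in> multi_indices d p'"
  shows "tprods K A X i = tprods K A Y i"
  using assms
proof (induction K arbitrary: p' i rule: finite_induct)
  case empty
  then have "multi_indices d p' = multi_indices d p" by (intro multi_indices_cong) auto
  then show ?case using empty by simp
next
  case (insert k K)
  have k: "k \<in> {1..d}" using insert.prems by simp
  have "tprod k (A k) (tprods K A X) i = tprod k (A k) (tprods K A Y) i"
  proof (rule tprod_cong[where p = "p'(k := p k)" and m = "p' k" and d = d])
    fix j assume j: "j \<in> multi_indices d (p'(k := p k))"
    show "tprods K A X j = tprods K A Y j"
    proof (rule insert.IH[OF _ _ _ _ j])
      show "(p'(k := p k)) i = p i" if "i \<in> {1..d} - K" for i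
        using that insert.prems(3)[of i] by auto
    qed (use insert.prems in auto)
  qed (use insert.prems k in auto)
  then show ?case using insert.hyps by (simp add: tprods_insert)
qed

lemma tprod_tprod:
  assumes "i k < dim_row A" "dim_col A = dim_row B"
  shows "tprod k A (tprod k B X) i = tprod k (A * B) X i"
proof -
  have "tprod k A (tprod k B X) i
      = (\<Sum>a<dim_col A. \<Sum>b<dim_col B. A $$ (i k, a) * B $$ (a, b) * X (i(k := b)))"
    by (simp add: tprod_def sum_distrib_left mult.assoc)
  also have "\<dots> = (\<Sum>b<dim_col B. (\<Sum>a<dim_col A. A $$ (i k, a) * B $$ (a, b)) * X (i(k := b)))"
    by (subst sum.swap) (simp add: sum_distrib_right)
  also have "\<dots> = (\<Sum>b<dim_col B. (A * B) $$ (i k, b) * X (i(k := b)))"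
    using assms by (intro sum.cong refl arg_cong2[of _ _ _ _ times])
      (auto simp: scalar_prod_def lessThan_atLeast0 intro!: sum.cong)
  finally show ?thesis by (simp add: tprod_def)
qed

lemma tprod_one:
  assumes "i k < m"
  shows "tprod k (1\<^sub>m m) X i = X i"
proof -
  have "tprod k (1\<^sub>m m) X i = (\<Sum>b<m. if b = i k then X i else 0)"
    unfolding tprod_def using assms by (intro sum.cong) auto
  then show ?thesis using assms by simp
qed

lemma tprods_left_inverse:
  assumes "finite K" "K \<subseteq> {1..d}"
    and "\<And>k. k \<in> K \<Longrightarrow> A k \<in> carrier_mat (p' k) (p k) \<and> B k \<in> carrier_mat (p k) (p' k) \<and>
      B k * A k = 1\<^sub>m (p k)"
    and "i \<in> multi_indices d p"
  shows "tprods K B (tprods K A X) i = X i"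
  using assms
proof (induction K arbitrary: i rule: finite_induct)
  case (insert k K)
  have k: "k \<in> {1..d}" "i k < p k" using insert.prems multi_indices_less by auto
  have AB: "A k \<in> carrier_mat (p' k) (p k)" "B k \<in> carrier_mat (p k) (p' k)" "B k * A k = 1\<^sub>m (p k)"
    using insert.prems(2)[of k] by auto
  have "tprods (insert k K) B (tprods (insert k K) A X) i
      = tprod k (B k) (tprod k (A k) (tprods K B (tprods K A X))) i"
    using insert.hyps by (simp add: tprods_insert tprods_tprod)
  also have "\<dots> = tprod k (1\<^sub>m (p k)) (tprods K B (tprods K A X)) i"
    using AB k by (subst tprod_tprod) auto
  also have "\<dots> = tprods K B (tprods K A X) i" using k by (simp add: tprod_one)
  also have "\<dots> = X i" using insert.prems by (intro insert.IH) auto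
  finally show ?case .
qed simp

lemma sum_multi_indices_split:
  assumes k: "k \<in> {1..d}"
  shows "(\<Sum>i\<in>multi_indices d p. h i)
    = (\<Sum>j\<in>PiE ({1..d} - {k}) (\<lambda>i. {..<p i}). \<Sum>b<p k. h (j(k := b)))"
proof -
  let ?J = "PiE ({1..d} - {k}) (\<lambda>i. {..<p i})"
  have "multi_indices d p = (\<lambda>(b, j). j(k := b)) ` ({..<p k} \<times> ?J)"
    unfolding multi_indices_def using PiE_insert_eq[of k "{1..d} - {k}" "\<lambda>k. {..<p k}"] k
    by (simp add: insert_absorb)
  moreover have "inj_on (\<lambda>(b, j). j(k := b)) ({..<p k} \<times> ?J)"
    using FuncSet.inj_combinator[of k "{1..d} - {k}" "\<lambda>i. {..<p i}"] by simp
  ultimately have "(\<Sum>i\<in>multi_indices d p. h i) = (\<Sum>(b, j)\<in>{..<p k} \<times> ?J. h (j(k := b)))"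
    unfolding case_prod_beta by (simp add: sum.reindex)
  also have "\<dots> = (\<Sum>b<p k. \<Sum>j\<in>?J. h (j(k := b)))"
    by (rule sum.cartesian_product[symmetric])
  also have "\<dots> = (\<Sum>j\<in>?J. \<Sum>b<p k. h (j(k := b)))" by (rule sum.swap)
  finally show ?thesis .
qed

definition tinner :: "nat \<Rightarrow> (nat \<Rightarrow> nat) \<Rightarrow> tensor \<Rightarrow> tensor \<Rightarrow> real" where
  "tinner d p X Y = (\<Sum>i\<in>multi_indices d p. X i * Y i)"

lemma tinner_cong:
  assumes "\<And>i. i \<in> multi_indices d p \<Longrightarrow> X i = X' i" "\<And>i. i \<in> multi_indices d p \<Longrightarrow> Y i = Y' i"
  shows "tinner d p X Y = tinner d p X' Y'"
  unfolding tinner_def using assms by (intro sum.cong) auto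

lemma tinner_shape_cong:
  "(\<And>k. k \<in> {1..d} \<Longrightarrow> p k = p' k) \<Longrightarrow> tinner d p X Y = tinner d p' X Y"
  unfolding tinner_def using multi_indices_cong[of d p p'] by metis

lemma tprod_adjoint:
  assumes k: "k \<in> {1..d}" and A: "A \<in> carrier_mat (p' k) (p k)"
    and p': "\<And>j. j \<in> {1..d} - {k} \<Longrightarrow> p' j = p j"
  shows "tinner d p' (tprod k A X) Y = tinner d p X (tprod k A\<^sup>T Y)"
proof -
  let ?J = "PiE ({1..d} - {k}) (\<lambda>i. {..<p i})"
  have J: "PiE ({1..d} - {k}) (\<lambda>i. {..<p' i}) = ?J" using p' by (intro PiE_cong) auto
  have "tinner d p' (tprod k A X) Y
      = (\<Sum>j\<in>?J. \<Sum>a<p' k. \<Sum>b<p k. A $$ (a, b) * X (j(k := b)) * Y (j(k := a)))"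
    unfolding tinner_def sum_multi_indices_split[OF k] J using A
    by (simp add: tprod_def sum_distrib_right)
  also have "\<dots> = (\<Sum>j\<in>?J. \<Sum>b<p k. \<Sum>a<p' k. A $$ (a, b) * X (j(k := b)) * Y (j(k := a)))"
    by (intro sum.cong refl sum.swap)
  also have "\<dots> = tinner d p X (tprod k A\<^sup>T Y)"
    unfolding tinner_def sum_multi_indices_split[OF k] using A
    by (auto simp: tprod_def sum_distrib_left algebra_simps intro!: sum.cong)
  finally show ?thesis .
qed

lemma tprods_adjoint:
  assumes "finite K" "K \<subseteq> {1..d}" "\<And>k. k \<in> K \<Longrightarrow> A k \<in> carrier_mat (p' k) (p k)"
    and "\<And>k. k \<in> {1..d} - K \<Longrightarrow> p' k = p k"
  shows "tinner d p' (tprods K A X) Y = tinner d p X (tprods K (\<lambda>k. (A k)\<^sup>T) Y)"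
  using assms
proof (induction K arbitrary: p' Y rule: finite_induct)
  case empty
  then show ?case using tinner_shape_cong[of d p' p] by simp
next
  case (insert k K)
  have "tinner d p' (tprods (insert k K) A X) Y = tinner d p' (tprod k (A k) (tprods K A X)) Y"
    using insert.hyps by (simp add: tprods_insert)
  also have "\<dots> = tinner d (p'(k := p k)) (tprods K A X) (tprod k (A k)\<^sup>T Y)"
    using insert.prems by (intro tprod_adjoint) auto
  also have "\<dots> = tinner d p X (tprods K (\<lambda>k. (A k)\<^sup>T) (tprod k (A k)\<^sup>T Y))"
    using insert.prems insert.hyps by (intro insert.IH) auto
  also have "\<dots> = tinner d p X (tprods (insert k K) (\<lambda>k. (A k)\<^sup>T) Y)"
    using insert.hyps by (simp add: tprods_insert tprods_tprod)
  finally show ?case .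
qed

section \<open>Unfoldings\<close>

lemma fiber_enum_bij:
  "bij_betw (fiber_enum d p k) {..<codim d p k} (PiE ({1..d} - {k}) (\<lambda>i. {..<p i}))"
proof -
  let ?J = "PiE ({1..d} - {k}) (\<lambda>i. {..<p i})"
  have "finite ?J" by (intro finite_PiE) auto
  then obtain h where "bij_betw h {0..<card ?J} ?J" using ex_bij_betw_nat_finite by blast
  moreover have "card ?J = codim d p k" by (simp add: card_PiE codim_def)
  ultimately have "bij_betw h {..<codim d p k} ?J" by (simp add: lessThan_atLeast0)
  then show ?thesis unfolding fiber_enum_def
    by (rule someI[of "\<lambda>e. bij_betw e {..<codim d p k} ?J"])
qed

lemma codim_update [simp]: "codim d (p(k := m)) k = codim d p k"
  unfolding codim_def by (intro prod.cong) auto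

lemma fiber_enum_update [simp]: "fiber_enum d (p(k := m)) k = fiber_enum d p k"
proof -
  have "PiE ({1..d} - {k}) (\<lambda>i. {..<(p(k := m)) i}) = PiE ({1..d} - {k}) (\<lambda>i. {..<p i})"
    by (intro PiE_cong) auto
  then show ?thesis unfolding fiber_enum_def codim_update by presburger
qed

definition fiber_index :: "nat \<Rightarrow> (nat \<Rightarrow> nat) \<Rightarrow> nat \<Rightarrow> (nat \<Rightarrow> nat) \<Rightarrow> nat" where
  "fiber_index d p k i =
    inv_into {..<codim d p k} (fiber_enum d p k) (restrict i ({1..d} - {k}))"

lemma fiber_index:
  assumes "i \<in> multi_indices d p" "k \<in> {1..d}"
  shows "fiber_index d p k i < codim d p k"
    and "(fiber_enum d p k (fiber_index d p k i))(k := a) = i(k := a)"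
proof -
  let ?r = "restrict i ({1..d} - {k})"
  have r: "?r \<in> PiE ({1..d} - {k}) (\<lambda>i. {..<p i})"
    using assms by (auto simp: multi_indices_def)
  then have im: "?r \<in> fiber_enum d p k ` {..<codim d p k}"
    using fiber_enum_bij[of d p k] by (auto simp: bij_betw_def)
  show "fiber_index d p k i < codim d p k"
    using inv_into_into[OF im] by (simp add: fiber_index_def)
  have "fiber_enum d p k (fiber_index d p k i) = ?r"
    unfolding fiber_index_def by (rule f_inv_into_f[OF im])
  then show "(fiber_enum d p k (fiber_index d p k i))(k := a) = i(k := a)"
    using assms by (auto simp: multi_indices_def PiE_iff extensional_def fun_eq_iff)
qed

lemma fiber_enum_multi_index:
  assumes "j < codim d p k" "k \<in> {1..d}" "a < m"
  shows "(fiber_enum d p k j)(k := a) \<in> multi_indices d (p(k := m))"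
    and "fiber_index d p k ((fiber_enum d p k j)(k := a)) = j"
proof -
  have e: "fiber_enum d p k j \<in> PiE ({1..d} - {k}) (\<lambda>i. {..<p i})"
    using fiber_enum_bij[of d p k] assms(1) by (auto simp: bij_betw_def)
  then show "(fiber_enum d p k j)(k := a) \<in> multi_indices d (p(k := m))"
    using assms by (auto simp: multi_indices_def PiE_iff extensional_def)
  have "restrict ((fiber_enum d p k j)(k := a)) ({1..d} - {k}) = fiber_enum d p k j"
    using e by (auto simp: PiE_iff extensional_def fun_eq_iff)
  then show "fiber_index d p k ((fiber_enum d p k j)(k := a)) = j"
    unfolding fiber_index_def using fiber_enum_bij[of d p k] assms(1)
    by (simp add: inv_into_f_f bij_betw_def)
qed

lemma fiber_index_update [simp]: "fiber_index d (p(k := m)) k i = fiber_index d p k i"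
  by (simp add: fiber_index_def)

lemma unfold_mode_carrier [simp]: "unfold_mode d p k X \<in> carrier_mat (p k) (codim d p k)"
  by (simp add: unfold_mode_def)

lemma unfold_mode_dims [simp]:
  "dim_row (unfold_mode d p k X) = p k" "dim_col (unfold_mode d p k X) = codim d p k"
  by (simp_all add: unfold_mode_def)

lemma ten_mode_eq: "ten_mode d p k M i = M $$ (i k, fiber_index d p k i)"
  by (simp add: ten_mode_def fiber_index_def)

lemma ten_mode_unfold_mode:
  assumes "i \<in> multi_indices d p" "k \<in> {1..d}"
  shows "ten_mode d p k (unfold_mode d p k X) i = X i"
  using fiber_index[OF assms] multi_indices_less[OF assms]
  by (simp add: ten_mode_eq unfold_mode_def)

lemma unfold_mode_ten_mode:
  assumes "M \<in> carrier_mat (p k) (codim d p k)" "k \<in> {1..d}"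
  shows "unfold_mode d p k (ten_mode d p k M) = M"
  using assms fiber_enum_multi_index(2)[of _ d p k]
  by (intro eq_matI) (auto simp: unfold_mode_def ten_mode_eq)

lemma unfold_mode_cong:
  assumes "k \<in> {1..d}" "\<And>i. i \<in> multi_indices d p \<Longrightarrow> X i = Y i"
  shows "unfold_mode d p k X = unfold_mode d p k Y"
  using assms fiber_enum_multi_index(1)[of _ d p k _ "p k"]
  by (intro eq_matI) (auto simp: unfold_mode_def)

lemma unfold_mode_tprod:
  assumes "A \<in> carrier_mat m (p k)" "k \<in> {1..d}"
  shows "unfold_mode d (p(k := m)) k (tprod k A X) = A * unfold_mode d p k X"
proof (rule eq_matI)
  fix a j assume "a < dim_row (A * unfold_mode d p k X)" "j < dim_col (A * unfold_mode d p k X)"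
  then have aj: "a < m" "j < codim d p k" using assms by auto
  then show "unfold_mode d (p(k := m)) k (tprod k A X) $$ (a, j) = (A * unfold_mode d p k X) $$ (a, j)"
    using assms mat_mult_entry[OF assms(1) unfold_mode_carrier[of d p k X], of a j]
    by (simp add: unfold_mode_def tprod_def del: index_mult_mat)
qed (use assms in auto)

lemma unfold_mode_inner:
  assumes k: "k \<in> {1..d}"
  shows "tinner d p X Y = (\<Sum>j<codim d p k. \<Sum>b<p k. unfold_mode d p k X $$ (b, j) * unfold_mode d p k Y $$ (b, j))"
  unfolding tinner_def sum_multi_indices_split[OF k]
  by (subst sum.reindex_bij_betw[OF fiber_enum_bij, symmetric])
    (auto simp: unfold_mode_def intro!: sum.cong)

lemma mode_prod_eq_tprod:
  assumes "i \<in> multi_indices d (p(k := dim_row A))" "k \<in> {1..d}" "dim_col A = p k"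
  shows "mode_prod d p k X A i = tprod k A X i"
proof -
  have "A * unfold_mode d p k X = unfold_mode d (p(k := dim_row A)) k (tprod k A X)"
    using assms by (intro unfold_mode_tprod[symmetric]) auto
  then show ?thesis
    unfolding mode_prod_def using ten_mode_unfold_mode[OF assms(1,2)] by simp
qed

lemma mode_prods_eq_tprods:
  assumes "distinct ks" "set ks \<subseteq> {1..d}" "\<And>k. k \<in> set ks \<Longrightarrow> dim_col (A k) = p k"
    and "\<And>i. i \<in> multi_indices d p \<Longrightarrow> X i = Y i"
    and "\<And>k. k \<in> {1..d} \<Longrightarrow> p' k = (if k \<in> set ks then dim_row (A k) else p k)"
    and "i \<in> multi_indices d p'"
  shows "mode_prods d p ks X A i = tprods (set ks) A Y i"
  using assms
proof (induction ks arbitrary: p X Y)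
  case Nil
  have "multi_indices d p' = multi_indices d p" using Nil.prems by (intro multi_indices_cong) auto
  then show ?case using Nil.prems by simp
next
  case (Cons k ks)
  have k: "k \<in> {1..d}" "dim_col (A k) = p k" using Cons.prems by auto
  have "mode_prods d (p(k := dim_row (A k))) ks (mode_prod d p k X (A k)) A i
      = tprods (set ks) A (tprod k (A k) Y) i"
  proof (rule Cons.IH)
    fix j assume j: "j \<in> multi_indices d (p(k := dim_row (A k)))"
    have "mode_prod d p k X (A k) j = tprod k (A k) X j"
      using j k by (intro mode_prod_eq_tprod) auto
    also have "\<dots> = tprod k (A k) Y j"
      using j k Cons.prems by (intro tprod_cong[where p = p and d = d]) auto
    finally show "mode_prod d p k X (A k) j = tprod k (A k) Y j" .
  qed (use Cons.prems in auto)
  then show ?case using Cons.prems by (simp add: tprods_insert tprods_tprod)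
qed

lemma multi_prod_eq_tprods:
  assumes "K \<subseteq> {1..d}" "\<And>k. k \<in> K \<Longrightarrow> dim_col (A k) = p k"
    and "\<And>i. i \<in> multi_indices d p \<Longrightarrow> X i = Y i"
    and "\<And>k. k \<in> {1..d} \<Longrightarrow> p' k = (if k \<in> K then dim_row (A k) else p k)"
    and "i \<in> multi_indices d p'"
  shows "multi_prod d p K X A i = tprods K A Y i"
proof -
  have "finite K" using assms(1) finite_subset by blast
  then show ?thesis unfolding multi_prod_def
    using mode_prods_eq_tprods[of "sorted_list_of_set K" d A p X Y p' i] assms by simp
qed

section \<open>Best low-rank approximations are left multiples\<close>

definition frob_inner :: "real mat \<Rightarrow> real mat \<Rightarrow> real" where
  "frob_inner A B = (\<Sum>i<dim_row A. \<Sum>j<dim_col A. A $$ (i, j) * B $$ (i, j))"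

lemma frob_norm_sq: "(frob_norm A)\<^sup>2 = frob_inner A A"
  by (simp add: frob_norm_def frob_inner_def sum_nonneg power2_eq_square[symmetric])

lemma frob_norm_nonneg: "0 \<le> frob_norm A"
  by (simp add: frob_norm_def sum_nonneg)

lemma frob_inner_eq:
  "A \<in> carrier_mat n m \<Longrightarrow> frob_inner A B = (\<Sum>i<n. \<Sum>j<m. A $$ (i, j) * B $$ (i, j))"
  by (simp add: frob_inner_def)

lemma frob_inner_mult_left:
  assumes A: "A \<in> carrier_mat n k" and B: "B \<in> carrier_mat k m" and C: "C \<in> carrier_mat n m"
  shows "frob_inner (A * B) C = frob_inner B (A\<^sup>T * C)"
proof -
  have "frob_inner (A * B) C = (\<Sum>i<n. \<Sum>j<m. \<Sum>l<k. A $$ (i, l) * B $$ (l, j) * C $$ (i, j))"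
    using mat_mult_entry[OF A B] frob_inner_eq[of "A * B" n m C] A B
    by (simp add: sum_distrib_right)
  also have "\<dots> = (\<Sum>i<n. \<Sum>l<k. \<Sum>j<m. A $$ (i, l) * B $$ (l, j) * C $$ (i, j))"
    by (intro sum.cong refl sum.swap)
  also have "\<dots> = (\<Sum>l<k. \<Sum>i<n. \<Sum>j<m. A $$ (i, l) * B $$ (l, j) * C $$ (i, j))"
    by (rule sum.swap)
  also have "\<dots> = (\<Sum>l<k. \<Sum>j<m. \<Sum>i<n. A $$ (i, l) * B $$ (l, j) * C $$ (i, j))"
    by (intro sum.cong refl sum.swap)
  also have "\<dots> = (\<Sum>l<k. \<Sum>j<m. B $$ (l, j) * (A\<^sup>T * C) $$ (l, j))"
  proof (intro sum.cong refl)
    fix l j assume "l \<in> {..<k}" "j \<in> {..<m}"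
    then show "(\<Sum>i<n. A $$ (i, l) * B $$ (l, j) * C $$ (i, j)) = B $$ (l, j) * (A\<^sup>T * C) $$ (l, j)"
      using mat_mult_entry[of "A\<^sup>T" k n C m l j] A C
      by (auto simp: sum_distrib_left algebra_simps intro!: sum.cong)
  qed
  also have "\<dots> = frob_inner B (A\<^sup>T * C)" using frob_inner_eq[OF B] by simp
  finally show ?thesis .
qed

lemma frob_inner_transpose:
  assumes "A \<in> carrier_mat n m" "B \<in> carrier_mat n m"
  shows "frob_inner A\<^sup>T B\<^sup>T = frob_inner A B"
proof -
  have "frob_inner A\<^sup>T B\<^sup>T = (\<Sum>j<m. \<Sum>i<n. A $$ (i, j) * B $$ (i, j))"
    using assms by (auto simp: frob_inner_def intro!: sum.cong)
  also have "\<dots> = frob_inner A B" using assms by (subst sum.swap) (simp add: frob_inner_def)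
  finally show ?thesis .
qed

lemma frob_inner_mult_right:
  assumes A: "A \<in> carrier_mat n k" and B: "B \<in> carrier_mat k m" and C: "C \<in> carrier_mat n m"
  shows "frob_inner (A * B) C = frob_inner A (C * B\<^sup>T)"
proof -
  have AB: "A * B \<in> carrier_mat n m" and CB: "C * B\<^sup>T \<in> carrier_mat n k"
    and AT: "A\<^sup>T \<in> carrier_mat k n" and BT: "B\<^sup>T \<in> carrier_mat m k"
    and CT: "C\<^sup>T \<in> carrier_mat m n" using A B C by auto
  have "frob_inner (A * B) C = frob_inner (B\<^sup>T * A\<^sup>T) C\<^sup>T"
    unfolding transpose_mult[OF A B, symmetric] by (rule frob_inner_transpose[OF AB C, symmetric])
  also have "\<dots> = frob_inner A\<^sup>T (C * B\<^sup>T)\<^sup>T"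
    unfolding frob_inner_mult_left[OF BT AT CT] transpose_mult[OF C BT] ..
  also have "\<dots> = frob_inner A (C * B\<^sup>T)" by (rule frob_inner_transpose[OF A CB])
  finally show ?thesis .
qed

text \<open>Let \<open>F\<close> be a basis of the column space of a best approximation \<open>B\<close> of \<open>C\<close>. The orthogonal
  projection \<open>M C\<close> of \<open>C\<close> onto this space competes with \<open>B\<close>. By Pythagoras its squared distance
  to \<open>C\<close> is smaller than that of \<open>B\<close> by the squared distance from \<open>M C\<close> to \<open>B\<close>, which is
  therefore zero. As a left multiple in one mode does not increase the ranks in the other modes, the HOSVD inherits this property.\<close>
lemma best_approx_eq_left_mult:
  fixes B C :: "real mat"
  assumes C: "C \<in> carrier_mat n m" and best: "is_best_approx s C B"
  shows "\<exists>M \<in> carrier_mat n n. B = M * C"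
proof -
  have B: "B \<in> carrier_mat n m" and Bs: "mat_rank B \<le> s"
    and opt: "\<And>D. D \<in> carrier_mat n m \<Longrightarrow> mat_rank D \<le> s \<Longrightarrow> frob_norm (C - B) \<le> frob_norm (C - D)"
    using best C by (auto simp: is_best_approx_def)
  define q where "q = mat_rank B"
  obtain F H P where F: "F \<in> carrier_mat n q" and H: "H \<in> carrier_mat q m"
    and P: "P \<in> carrier_mat q n" and BFH: "B = F * H" and PF: "P * F = 1\<^sub>m q"
    using rank_factorization[OF B] unfolding q_def by blast
  have "x = 0\<^sub>v q" if x: "x \<in> carrier_vec q" "F *\<^sub>v x = 0\<^sub>v n" for x
  proof -
    have "x = P *\<^sub>v (F *\<^sub>v x)" using assoc_mult_mat_vec[OF P F x(1)] PF x by simp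
    then show ?thesis using x P by (auto simp: scalar_prod_def intro!: eq_vecI)
  qed
  then obtain Gi where Gi: "Gi \<in> carrier_mat q q" "F\<^sup>T * F * Gi = 1\<^sub>m q" "Gi * (F\<^sup>T * F) = 1\<^sub>m q"
    using gram_inverse_exists[OF F] by blast
  define Q where "Q = Gi * F\<^sup>T"
  have FT: "F\<^sup>T \<in> carrier_mat q n" and Q: "Q \<in> carrier_mat q n" using F Gi by (auto simp: Q_def)
  have QF: "Q * F = 1\<^sub>m q" unfolding Q_def using assoc_mult_mat[OF Gi(1) FT F] Gi by simp
  have FTFQ: "F\<^sup>T * (F * Q) = F\<^sup>T"
  proof -
    have "F\<^sup>T * (F * Q) = F\<^sup>T * F * (Gi * F\<^sup>T)"
      unfolding Q_def[symmetric] by (rule assoc_mult_mat[OF FT F Q, symmetric])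
    also have "\<dots> = F\<^sup>T * F * Gi * F\<^sup>T"
      using assoc_mult_mat[of "F\<^sup>T * F" q q Gi q "F\<^sup>T" n] FT F Gi by simp
    also have "\<dots> = F\<^sup>T" using Gi FT by simp
    finally show ?thesis .
  qed
  define M where "M = F * Q"
  have M: "M \<in> carrier_mat n n" using F Q by (simp add: M_def)
  have MC: "M * C \<in> carrier_mat n m" using M C by simp
  have QB: "Q * B = H" unfolding BFH using assoc_mult_mat[OF Q F H] QF H by simp
  have CB: "C - B \<in> carrier_mat n m" and CMC: "C - M * C \<in> carrier_mat n m"
    and MCB: "M * C - B \<in> carrier_mat n m"
    by (intro minus_carrier_mat B MC)+
  have diff: "M * C - B = F * (Q * (C - B))"
  proof -
    have "M * C = F * (Q * C)" unfolding M_def by (rule assoc_mult_mat[OF F Q C])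
    then have "M * C - B = F * (Q * C - H)"
      unfolding BFH using mult_minus_distrib_mat[OF F, of "Q * C" m H] Q C H by simp
    also have "Q * C - H = Q * (C - B)"
      unfolding mult_minus_distrib_mat[OF Q C B] QB ..
    finally show ?thesis .
  qed
  have "F\<^sup>T * (M * C) = F\<^sup>T * C"
    using assoc_mult_mat[OF FT M C] FTFQ by (simp add: M_def)
  then have "F\<^sup>T * (C - M * C) = 0\<^sub>m q m"
    unfolding mult_minus_distrib_mat[OF FT C MC] using FT C by (auto intro!: eq_matI)
  then have orth: "frob_inner (M * C - B) (C - M * C) = 0"
    unfolding diff frob_inner_mult_left[OF F mult_carrier_mat[OF Q CB] CMC]
    by (simp add: frob_inner_eq[OF mult_carrier_mat[OF Q CB]])
  have "frob_inner (C - B) (C - B)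
      = (\<Sum>i<n. \<Sum>j<m. (C - M * C) $$ (i, j) * (C - M * C) $$ (i, j)
          + (M * C - B) $$ (i, j) * (M * C - B) $$ (i, j)
          + 2 * ((M * C - B) $$ (i, j) * (C - M * C) $$ (i, j)))"
    unfolding frob_inner_eq[OF CB] using B C MC M
    by (intro sum.cong refl) (simp add: algebra_simps del: index_mult_mat(1))
  also have "\<dots> = frob_inner (C - M * C) (C - M * C) + frob_inner (M * C - B) (M * C - B)
      + 2 * frob_inner (M * C - B) (C - M * C)"
    unfolding frob_inner_eq[OF CMC] frob_inner_eq[OF MCB] by (simp add: sum.distrib sum_distrib_left)
  finally have pyth: "(frob_norm (C - B))\<^sup>2 = (frob_norm (C - M * C))\<^sup>2 + (frob_norm (M * C - B))\<^sup>2"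
    using orth by (simp add: frob_norm_sq)
  have "mat_rank (M * C) \<le> q"
    using mat_rank_le_factor[of F n q "Q * C" m] F Q C assoc_mult_mat[OF F Q C] by (simp add: M_def)
  then have "frob_norm (C - B) \<le> frob_norm (C - M * C)"
    using Bs MC by (intro opt) (auto simp: q_def)
  then have "(frob_norm (C - B))\<^sup>2 \<le> (frob_norm (C - M * C))\<^sup>2"
    by (intro power_mono frob_norm_nonneg)
  then have zero: "(frob_norm (M * C - B))\<^sup>2 = 0" using pyth by simp
  have "(M * C - B) $$ (i, j) = 0" if "i < n" "j < m" for i j
  proof -
    have "(\<Sum>i<n. \<Sum>j<m. ((M * C - B) $$ (i, j))\<^sup>2) = 0"
      using zero unfolding frob_norm_sq frob_inner_eq[OF MCB] by (simp add: power2_eq_square)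
    then have "(\<Sum>j<m. ((M * C - B) $$ (i, j))\<^sup>2) = 0"
      using that by (subst (asm) sum_nonneg_eq_0_iff) (auto intro: sum_nonneg)
    then show ?thesis using that by (subst (asm) sum_nonneg_eq_0_iff) auto
  qed
  then have "B = M * C" using B C M by (intro eq_matI) auto
  then show ?thesis using M by blast
qed

section \<open>The tensor space\<close>

locale tensor_space =
  fixes d :: nat and n :: "nat \<Rightarrow> nat" and idx :: "'m::finite \<Rightarrow> (nat \<Rightarrow> nat)"
  assumes idx: "tensor_index d n idx"
begin

abbreviation "modes \<equiv> {1..d}"
abbreviation "unf \<equiv> unfolding_of d n idx"
abbreviation "trank \<equiv> tucker_rank d n idx"

lemma idx_in: "idx m \<in> multi_indices d n"
  using idx by (auto simp: tensor_index_def bij_betw_def)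

lemma inv_idx: "inv_into UNIV idx (idx m) = m"
  using idx by (auto simp: tensor_index_def bij_betw_def)

lemma idx_inv: "i \<in> multi_indices d n \<Longrightarrow> idx (inv_into UNIV idx i) = i"
  using idx by (auto simp: tensor_index_def bij_betw_def intro!: f_inv_into_f)

lemma entries_of_entries: "i \<in> multi_indices d n \<Longrightarrow> entries idx (of_entries idx T) i = T i"
  by (simp add: entries_def of_entries_def idx_inv)

lemma of_entries_entries: "of_entries idx (entries idx X) = X"
  by (simp add: entries_def of_entries_def inv_idx)

lemma of_entries_cong:
  "(\<And>i. i \<in> multi_indices d n \<Longrightarrow> T i = T' i) \<Longrightarrow> of_entries idx T = of_entries idx T'"
  using idx_in by (auto simp: of_entries_def intro!: Cart_lambda_cong)

lemma entries_eqI: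
  "(\<And>i. i \<in> multi_indices d n \<Longrightarrow> entries idx X i = entries idx Y i) \<Longrightarrow> X = Y"
  using of_entries_cong[of "entries idx X" "entries idx Y"] by (simp add: of_entries_entries)

lemma entries_add: "entries idx (X + Y) i = entries idx X i + entries idx Y i"
  and entries_diff: "entries idx (X - Y) i = entries idx X i - entries idx Y i"
  and entries_scaleR: "entries idx (c *\<^sub>R X) i = c * entries idx X i"
  by (simp_all add: entries_def)

lemma inner_eq_tinner: "inner X Y = tinner d n (entries idx X) (entries idx Y)"
proof -
  have "inner X Y = (\<Sum>m\<in>UNIV. entries idx X (idx m) * entries idx Y (idx m))"
    by (simp add: inner_vec_def entries_def inv_idx)
  also have "\<dots> = tinner d n (entries idx X) (entries idx Y)"
    unfolding tinner_def using idx unfolding tensor_index_def by (rule sum.reindex_bij_betw)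
  finally show ?thesis .
qed

text \<open>Left multiplication of the mode-\<open>k\<close> unfolding by a square matrix, as an operator on the
  tensor space. These operators take the place of all mode products between different shapes.\<close>
definition lm :: "nat \<Rightarrow> real mat \<Rightarrow> real ^ 'm \<Rightarrow> real ^ 'm" where
  "lm k M x = of_entries idx (tprod k M (entries idx x))"

definition lms :: "nat set \<Rightarrow> (nat \<Rightarrow> real mat) \<Rightarrow> real ^ 'm \<Rightarrow> real ^ 'm" where
  "lms K M x = of_entries idx (tprods K M (entries idx x))"

lemma entries_lm: "i \<in> multi_indices d n \<Longrightarrow> entries idx (lm k M x) i = tprod k M (entries idx x) i"
  by (simp add: lm_def entries_of_entries)

lemma linear_lm: "linear (lm k M)"
proof (rule linearI)
  show "lm k M (x + y) = lm k M x + lm k M y" for x y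
    unfolding lm_def of_entries_def tprod_def
    by (simp add: Finite_Cartesian_Product.vec_eq_iff entries_add sum.distrib algebra_simps)
  show "lm k M (c *\<^sub>R x) = c *\<^sub>R lm k M x" for c x
    unfolding lm_def of_entries_def tprod_def
    by (simp add: Finite_Cartesian_Product.vec_eq_iff entries_scaleR sum_distrib_left algebra_simps)
qed

lemmas lm_add = linear_add[OF linear_lm]
  and lm_diff = linear_diff[OF linear_lm]
  and lm_scaleR = linear_cmul[OF linear_lm]

lemma tendsto_lm: "(f \<longlongrightarrow> l) F \<Longrightarrow> ((\<lambda>t. lm k M (f t)) \<longlongrightarrow> lm k M l) F"
  by (rule bounded_linear.tendsto[OF linear_conv_bounded_linear[THEN iffD1, OF linear_lm]])

lemma lm_eqI:
  assumes "k \<in> modes" "M \<in> carrier_mat (n k) (n k)"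
    and "\<And>i. i \<in> multi_indices d n \<Longrightarrow> entries idx x i = T i"
  shows "lm k M x = of_entries idx (tprod k M T)"
  unfolding lm_def
  by (intro of_entries_cong tprod_cong[where p = n and m = "n k" and d = d]) (use assms in auto)

lemma lm_lm:
  assumes k: "k \<in> modes" and A: "A \<in> carrier_mat (n k) (n k)" and B: "B \<in> carrier_mat (n k) (n k)"
  shows "lm k A (lm k B x) = lm k (A * B) x"
proof -
  have "lm k A (lm k B x) = of_entries idx (tprod k A (tprod k B (entries idx x)))"
    by (rule lm_eqI[OF k A]) (rule entries_lm)
  also have "\<dots> = of_entries idx (tprod k (A * B) (entries idx x))"
    using A B multi_indices_less[OF _ k] by (intro of_entries_cong tprod_tprod) auto
  finally show ?thesis by (simp add: lm_def)
qed

lemma lm_commute: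
  assumes j: "j \<in> modes" and k: "k \<in> modes" and jk: "j \<noteq> k"
    and A: "A \<in> carrier_mat (n j) (n j)" and B: "B \<in> carrier_mat (n k) (n k)"
  shows "lm j A (lm k B x) = lm k B (lm j A x)"
proof -
  have "lm j A (lm k B x) = of_entries idx (tprod j A (tprod k B (entries idx x)))"
    by (rule lm_eqI[OF j A]) (rule entries_lm)
  also have "\<dots> = lm k B (lm j A x)"
    unfolding tprod_commute[OF jk] by (rule lm_eqI[OF k B, symmetric]) (rule entries_lm)
  finally show ?thesis .
qed

lemma lm_one: "k \<in> modes \<Longrightarrow> lm k (1\<^sub>m (n k)) x = x"
  unfolding lm_def using multi_indices_less[of _ d n k]
  by (subst (2) of_entries_entries[symmetric]) (intro of_entries_cong tprod_one, auto)

lemma lm_minus_mat: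
  assumes "k \<in> modes" "A \<in> carrier_mat (n k) (n k)" "B \<in> carrier_mat (n k) (n k)"
  shows "lm k (A - B) x = lm k A x - lm k B x"
proof (rule entries_eqI)
  fix i assume i: "i \<in> multi_indices d n"
  then show "entries idx (lm k (A - B) x) i = entries idx (lm k A x - lm k B x) i"
    using assms multi_indices_less[OF i assms(1)]
    by (simp add: entries_lm entries_diff tprod_def sum_subtractf algebra_simps)
qed

lemma lm_adjoint:
  assumes "k \<in> modes" "A \<in> carrier_mat (n k) (n k)"
  shows "inner (lm k A x) y = inner x (lm k A\<^sup>T y)"
proof -
  have "inner (lm k A x) y = tinner d n (tprod k A (entries idx x)) (entries idx y)"
    unfolding inner_eq_tinner by (intro tinner_cong entries_lm refl)
  also have "\<dots> = tinner d n (entries idx x) (tprod k A\<^sup>T (entries idx y))"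
    using assms by (intro tprod_adjoint) auto
  also have "\<dots> = inner x (lm k A\<^sup>T y)"
    unfolding inner_eq_tinner by (intro tinner_cong entries_lm[symmetric] refl)
  finally show ?thesis .
qed

lemma lms_empty [simp]: "lms {} M x = x"
  by (simp add: lms_def of_entries_entries)

lemma lms_insert:
  assumes "finite K" "k \<notin> K" "k \<in> modes" "M k \<in> carrier_mat (n k) (n k)"
  shows "lms (insert k K) M x = lm k (M k) (lms K M x)"
  unfolding lms_def tprods_insert[OF assms(1,2)]
  by (rule lm_eqI[OF assms(3,4), symmetric]) (rule entries_of_entries)

lemma multi_prod_eq_lms:
  assumes "K \<subseteq> modes" "\<And>k. k \<in> K \<Longrightarrow> M k \<in> carrier_mat (n k) (n k)"
  shows "of_entries idx (multi_prod d n K (entries idx x) M) = lms K M x"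
proof -
  have "dim_row (M k) = n k \<and> dim_col (M k) = n k" if "k \<in> K" for k
    using assms(2)[OF that] by auto
  then show ?thesis unfolding lms_def using assms(1)
    by (intro of_entries_cong multi_prod_eq_tprods[where p' = n]) auto
qed

lemma linear_lms: "linear (lms K M)"
proof -
  have "tprods K M (\<lambda>i. X i + Y i) = (\<lambda>i. tprods K M X i + tprods K M Y i)" for X Y
  proof (cases "finite K")
    case True
    then show ?thesis
      by (induction K rule: finite_induct)
        (auto simp: tprods_insert tprod_def sum.distrib algebra_simps)
  qed (simp add: tprods_def)
  moreover have "tprods K M (\<lambda>i. c * X i) = (\<lambda>i. c * tprods K M X i)" for c X
  proof (cases "finite K")
    case True
    then show ?thesis
      by (induction K rule: finite_induct)
        (auto simp: tprods_insert tprod_def sum_distrib_left algebra_simps)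
  qed (simp add: tprods_def)
  ultimately show ?thesis
    unfolding lms_def of_entries_def
    by (intro linearI) (simp_all add: Finite_Cartesian_Product.vec_eq_iff entries_add[abs_def] entries_scaleR[abs_def])
qed

lemma lms_lm:
  assumes "finite K" "K \<subseteq> modes" "\<And>j. j \<in> K \<Longrightarrow> M j \<in> carrier_mat (n j) (n j)"
    and "k \<in> modes - K" "B \<in> carrier_mat (n k) (n k)"
  shows "lms K M (lm k B x) = lm k B (lms K M x)"
  using assms
proof (induction K rule: finite_induct)
  case (insert j K)
  then have "lms K M (lm k B x) = lm k B (lms K M x)" by auto
  then show ?case using insert.prems insert.hyps
    by (simp add: lms_insert lm_commute[of j k "M j" B])
qed simp

lemma lms_adjoint:
  assumes "finite K" "K \<subseteq> modes" "\<And>j. j \<in> K \<Longrightarrow> M j \<in> carrier_mat (n j) (n j)"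
  shows "inner (lms K M x) y = inner x (lms K (\<lambda>k. (M k)\<^sup>T) y)"
  using assms
proof (induction K arbitrary: y rule: finite_induct)
  case (insert k K)
  have "inner (lms (insert k K) M x) y = inner (lms K M x) (lm k (M k)\<^sup>T y)"
    using insert.prems insert.hyps by (simp add: lms_insert lm_adjoint)
  also have "\<dots> = inner x (lms K (\<lambda>k. (M k)\<^sup>T) (lm k (M k)\<^sup>T y))"
    using insert.prems by (intro insert.IH) auto
  also have "\<dots> = inner x (lms (insert k K) (\<lambda>k. (M k)\<^sup>T) y)"
    using insert.prems insert.hyps by (simp add: lms_insert lms_lm)
  finally show ?case .
qed simp

lemma lms_fixed:
  assumes "finite K" "K \<subseteq> modes" "\<And>j. j \<in> K \<Longrightarrow> M j \<in> carrier_mat (n j) (n j)"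
    and "\<And>j. j \<in> K \<Longrightarrow> lm j (M j) x = x"
  shows "lms K M x = x"
  using assms by (induction K rule: finite_induct) (auto simp: lms_insert)

subsection \<open>Unfoldings and Tucker ranks\<close>

lemma unf_carrier [simp]: "unf k x \<in> carrier_mat (n k) (codim d n k)"
  by (simp add: unfolding_of_def)

lemma unf_dims [simp]: "dim_row (unf k x) = n k" "dim_col (unf k x) = codim d n k"
  by (simp_all add: unfolding_of_def)

lemma unf_diff: "unf k (x - y) = unf k x - unf k y"
  by (rule eq_matI) (auto simp: unfolding_of_def unfold_mode_def entries_diff)

lemma unf_lm:
  assumes "k \<in> modes" "M \<in> carrier_mat (n k) (n k)"
  shows "unf k (lm k M x) = M * unf k x"
proof -
  have "unf k (lm k M x) = unfold_mode d (n(k := n k)) k (tprod k M (entries idx x))"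
    unfolding unfolding_of_def fun_upd_triv by (intro unfold_mode_cong[OF assms(1)] entries_lm)
  then show ?thesis using unfold_mode_tprod[of M "n k" n k d "entries idx x"] assms
    by (simp add: unfolding_of_def)
qed

lemma unf_of_entries_ten_mode:
  assumes "k \<in> modes" "B \<in> carrier_mat (n k) (codim d n k)"
  shows "unf k (of_entries idx (ten_mode d n k B)) = B"
proof -
  have "unf k (of_entries idx (ten_mode d n k B)) = unfold_mode d n k (ten_mode d n k B)"
    unfolding unfolding_of_def by (intro unfold_mode_cong[OF assms(1)] entries_of_entries)
  then show ?thesis using unfold_mode_ten_mode[OF assms(2,1)] by simp
qed

lemma of_entries_ten_mode_unf:
  assumes "k \<in> modes"
  shows "of_entries idx (ten_mode d n k (unf k x)) = x"
proof -
  have "of_entries idx (ten_mode d n k (unf k x)) = of_entries idx (entries idx x)"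
    unfolding unfolding_of_def using assms by (intro of_entries_cong ten_mode_unfold_mode) auto
  then show ?thesis by (simp add: of_entries_entries)
qed

lemma unf_inject: "k \<in> modes \<Longrightarrow> unf k x = unf k y \<Longrightarrow> x = y"
  using of_entries_ten_mode_unf by metis

lemma inner_eq_frob_inner:
  assumes "k \<in> modes"
  shows "inner x y = frob_inner (unf k x) (unf k y)"
  unfolding inner_eq_tinner unfold_mode_inner[OF assms] frob_inner_def unf_dims
  by (subst sum.swap) (simp add: unfolding_of_def)

lemma frob_norm_unf: "k \<in> modes \<Longrightarrow> frob_norm (unf k x) = norm x"
  using inner_eq_frob_inner[of k x x] frob_norm_sq[of "unf k x"] frob_norm_nonneg
  by (metis abs_norm_cancel norm_eq_sqrt_inner real_sqrt_abs abs_of_nonneg)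

lemma trank_eq_mat_rank: "trank x k = mat_rank (unf k x)"
  by (simp add: tucker_rank_def)

text \<open>A rank factorization of the unfolding, folded back into a tensor. In this form the rank bound
  is visibly preserved by products in the other modes, which commute with \<open>tprod k F\<close>.\<close>
lemma trank_le_iff:
  assumes k: "k \<in> modes"
  shows "trank x k \<le> q \<longleftrightarrow>
    (\<exists>F \<in> carrier_mat (n k) q. \<exists>T. \<forall>i\<in>multi_indices d n. entries idx x i = tprod k F T i)"
proof
  assume "trank x k \<le> q"
  then obtain F H where F: "F \<in> carrier_mat (n k) q" and H: "H \<in> carrier_mat q (codim d n k)"
    and FH: "unf k x = F * H"
    using mat_rank_le_iff[OF unf_carrier, of k x q] by (auto simp: trank_eq_mat_rank)
  define T where "T = ten_mode d (n(k := q)) k H"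
  have "unfold_mode d (n(k := q)) k T = H"
    unfolding T_def using H k by (intro unfold_mode_ten_mode) auto
  then have u: "unfold_mode d n k (tprod k F T) = unf k x"
    using unfold_mode_tprod[of F "n k" "n(k := q)" k d T] F k FH by simp
  have "entries idx x i = tprod k F T i" if i: "i \<in> multi_indices d n" for i
    using ten_mode_unfold_mode[OF i k, of "tprod k F T"] ten_mode_unfold_mode[OF i k, of "entries idx x"] u
    by (simp add: unfolding_of_def)
  then show "\<exists>F \<in> carrier_mat (n k) q. \<exists>T. \<forall>i\<in>multi_indices d n. entries idx x i = tprod k F T i"
    using F by blast
next
  assume "\<exists>F \<in> carrier_mat (n k) q. \<exists>T. \<forall>i\<in>multi_indices d n. entries idx x i = tprod k F T i"
  then obtain F T where F: "F \<in> carrier_mat (n k) q"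
    and T: "\<And>i. i \<in> multi_indices d n \<Longrightarrow> entries idx x i = tprod k F T i" by blast
  have "unf k x = unfold_mode d n k (tprod k F T)"
    unfolding unfolding_of_def using T by (intro unfold_mode_cong[OF k])
  also have "\<dots> = F * unfold_mode d (n(k := q)) k T"
    using unfold_mode_tprod[of F "n k" "n(k := q)" k d T] F k by simp
  finally show "trank x k \<le> q"
    using mat_rank_le_factor[OF F, of "unfold_mode d (n(k := q)) k T" "codim d n k"]
      unfold_mode_carrier[of d "n(k := q)" k T] F
    by (simp add: trank_eq_mat_rank)
qed

lemma trank_lm_le:
  assumes j: "j \<in> modes" and k: "k \<in> modes" and M: "M \<in> carrier_mat (n j) (n j)"
  shows "trank (lm j M x) k \<le> trank x k"
proof -
  obtain F T where F: "F \<in> carrier_mat (n k) (trank x k)"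
    and T: "\<And>i. i \<in> multi_indices d n \<Longrightarrow> entries idx x i = tprod k F T i"
    using trank_le_iff[OF k, of x "trank x k"] by blast
  have eq: "entries idx (lm j M x) i = tprod j M (tprod k F T) i" if "i \<in> multi_indices d n" for i
    using lm_eqI[OF j M, of x "tprod k F T"] T that by (simp add: entries_of_entries)
  show ?thesis
  proof (cases "j = k")
    case True
    have "entries idx (lm j M x) i = tprod k (M * F) T i" if "i \<in> multi_indices d n" for i
      unfolding eq[OF that] using True M F multi_indices_less[OF that k] by (simp add: tprod_tprod)
    then show ?thesis unfolding trank_le_iff[OF k] using M F True
      by (intro bexI[of _ "M * F"] exI[of _ T]) auto
  next
    case False
    then show ?thesis unfolding trank_le_iff[OF k] using eq F tprod_commute[OF False]
      by (intro bexI[of _ F] exI[of _ "tprod j M T"]) auto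
  qed
qed

lemma trank_le_if_fixed:
  assumes k: "k \<in> modes" and S: "S \<in> carrier_mat (n k) q" and B: "B \<in> carrier_mat q (n k)"
    and fixed: "lm k (S * B) x = x"
  shows "trank x k \<le> q"
proof -
  have "unf k x = S * B * unf k x" using unf_lm[OF k, of "S * B" x] fixed S B by simp
  also have "\<dots> = S * (B * unf k x)" by (rule assoc_mult_mat[OF S B unf_carrier])
  finally show ?thesis
    using mat_rank_le_factor[OF S, of "B * unf k x" "codim d n k"] B S
    by (metis trank_eq_mat_rank carrier_matD(1) mult_carrier_mat unf_carrier unf_dims(1))
qed

lemma rank_Delta_le_trank:
  assumes "k \<in> modes" "norm (X - L) \<le> \<Delta>"
  shows "rank_Delta \<Delta> (unf k X) \<le> trank L k"
  unfolding trank_eq_mat_rank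
  using assms by (intro rank_Delta_le_rank[OF unf_carrier unf_carrier])
    (simp add: unf_diff[symmetric] frob_norm_unf)

subsection \<open>Truncated HOSVD\<close>

lemma hosvd_uptoE:
  assumes "Z \<in> hosvd_upto d n idx s A (Suc k)" "Suc k \<in> modes"
  obtains C M where "C \<in> hosvd_upto d n idx s A k" "M \<in> carrier_mat (n (Suc k)) (n (Suc k))"
    "Z = lm (Suc k) M C" "trank Z (Suc k) \<le> s (Suc k)"
    "\<And>T. trank T (Suc k) \<le> s (Suc k) \<Longrightarrow> norm (C - Z) \<le> norm (C - T)"
proof -
  note k = assms(2)
  obtain B C where C: "C \<in> hosvd_upto d n idx s A k"
    and best: "is_best_approx (s (Suc k)) (unf (Suc k) C) B"
    and Z: "Z = of_entries idx (ten_mode d n (Suc k) B)"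
    using assms(1) by auto
  obtain M where M: "M \<in> carrier_mat (n (Suc k)) (n (Suc k))" "B = M * unf (Suc k) C"
    using best_approx_eq_left_mult[OF unf_carrier best] by blast
  have B: "B \<in> carrier_mat (n (Suc k)) (codim d n (Suc k))"
    using best by (simp add: is_best_approx_def)
  have uZ: "unf (Suc k) Z = B" unfolding Z by (rule unf_of_entries_ten_mode[OF k B])
  show thesis
  proof (rule that[OF C M(1)])
    show "Z = lm (Suc k) M C"
      using unf_inject[OF k, of Z "lm (Suc k) M C"] uZ M unf_lm[OF k M(1)] by simp
    show "trank Z (Suc k) \<le> s (Suc k)"
      using best uZ by (simp add: is_best_approx_def trank_eq_mat_rank)
    fix T assume "trank T (Suc k) \<le> s (Suc k)"
    then have "frob_norm (unf (Suc k) C - B) \<le> frob_norm (unf (Suc k) C - unf (Suc k) T)"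
      using best by (simp add: is_best_approx_def trank_eq_mat_rank)
    then show "norm (C - Z) \<le> norm (C - T)"
      unfolding uZ[symmetric] unf_diff[symmetric] frob_norm_unf[OF k] .
  qed
qed

lemma hosvd_upto_trank:
  assumes "Z \<in> hosvd_upto d n idx s A k" "k \<le> d"
  shows "(\<forall>j\<in>modes. trank Z j \<le> trank A j) \<and> (\<forall>j\<in>{1..k}. trank Z j \<le> s j)"
  using assms
proof (induction k arbitrary: Z)
  case (Suc k)
  then have k: "Suc k \<in> modes" by auto
  obtain C M where C: "C \<in> hosvd_upto d n idx s A k" and M: "M \<in> carrier_mat (n (Suc k)) (n (Suc k))"
    and Z: "Z = lm (Suc k) M C" "trank Z (Suc k) \<le> s (Suc k)"
    using hosvd_uptoE[OF Suc.prems(1) k] by metis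
  have IH: "(\<forall>j\<in>modes. trank C j \<le> trank A j) \<and> (\<forall>j\<in>{1..k}. trank C j \<le> s j)"
    using Suc.IH[OF C] Suc.prems by simp
  have "trank Z j \<le> trank C j" if "j \<in> modes" for j
    unfolding Z(1) by (rule trank_lm_le[OF k that M])
  then have "\<forall>j\<in>modes. trank Z j \<le> trank A j" "\<forall>j\<in>{1..k}. trank Z j \<le> s j"
    using IH Suc.prems by (fastforce intro: order_trans)+
  then show ?case using Z(2) by (auto simp: le_Suc_eq)
qed simp

text \<open>Crude quasi-optimality of the HOSVD: each truncation at most doubles the distance to a
  tensor \<open>T\<close> of the admissible rank, since that tensor competes in the best approximation.\<close>
lemma hosvd_upto_dist:
  assumes "Z \<in> hosvd_upto d n idx s A k" "k \<le> d" "\<And>j. j \<in> modes \<Longrightarrow> trank T j \<le> s j"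
  shows "norm (Z - T) \<le> 2 ^ k * norm (A - T)"
  using assms(1,2)
proof (induction k arbitrary: Z)
  case (Suc k)
  then have k: "Suc k \<in> modes" by auto
  obtain C where C: "C \<in> hosvd_upto d n idx s A k"
    and opt: "\<And>T. trank T (Suc k) \<le> s (Suc k) \<Longrightarrow> norm (C - Z) \<le> norm (C - T)"
    using hosvd_uptoE[OF Suc.prems(1) k] by metis
  have "norm (Z - T) \<le> norm (C - Z) + norm (C - T)"
    using norm_triangle_ineq4[of "C - T" "C - Z"] by simp
  also have "\<dots> \<le> 2 * norm (C - T)" using opt assms(3)[OF k] by simp
  also have "\<dots> \<le> 2 * (2 ^ k * norm (A - T))" using Suc.IH[OF C] Suc.prems by simp
  finally show ?case by simp
qed simp

lemma hosvd_in_variety: "Z \<in> hosvd d n idx s A \<Longrightarrow> Z \<in> tucker_variety d n idx s"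
  using hosvd_upto_trank[of Z s A d] by (simp add: hosvd_def tucker_variety_def)

lemma hosvd_trank_le: "Z \<in> hosvd d n idx s A \<Longrightarrow> j \<in> modes \<Longrightarrow> trank Z j \<le> s j"
  using hosvd_upto_trank[of Z s A d] by (simp add: hosvd_def)

lemma hosvd_dist:
  "Z \<in> hosvd d n idx s A \<Longrightarrow> (\<And>j. j \<in> modes \<Longrightarrow> trank T j \<le> s j) \<Longrightarrow> norm (Z - T) \<le> 2 ^ d * norm (A - T)"
  using hosvd_upto_dist[of Z s A d T] by (simp add: hosvd_def)

end

section \<open>The structure of the approximate projection\<close>

lemma proj_mat_carrier: "S \<in> carrier_mat m r \<Longrightarrow> proj_mat S \<in> carrier_mat m m"
  by (simp add: proj_mat_def)

lemma proj_mat_transpose: "S \<in> carrier_mat m r \<Longrightarrow> (proj_mat S)\<^sup>T = proj_mat S"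
  unfolding proj_mat_def by (subst transpose_mult[of _ m r _ m]) auto

lemma proj_mat_mult_self:
  assumes "S \<in> stiefel r m"
  shows "proj_mat S * S = S"
proof -
  have S: "S \<in> carrier_mat m r" using assms stiefel_carrier by auto
  have "proj_mat S * S = S * (S\<^sup>T * S)"
    unfolding proj_mat_def using S by (intro assoc_mult_mat) auto
  then show ?thesis using stiefel_gram[OF assms] S by simp
qed

lemma proj_mat_idem:
  assumes "S \<in> stiefel r m"
  shows "proj_mat S * proj_mat S = proj_mat S"
proof -
  have S: "S \<in> carrier_mat m r" using assms stiefel_carrier by auto
  have "proj_mat S * (S * S\<^sup>T) = proj_mat S * S * S\<^sup>T"
    using S by (intro assoc_mult_mat[symmetric]) (auto simp: proj_mat_def)
  then show ?thesis unfolding proj_mat_mult_self[OF assms] by (simp add: proj_mat_def)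
qed

lemma perp_mat_eq: "S \<in> carrier_mat m r \<Longrightarrow> perp_mat S = 1\<^sub>m m - proj_mat S"
  by (simp add: perp_mat_def proj_mat_def)

lemma perp_mat_carrier: "S \<in> carrier_mat m r \<Longrightarrow> perp_mat S \<in> carrier_mat m m"
  unfolding perp_mat_eq by (intro minus_carrier_mat proj_mat_carrier)

lemma perp_mat_transpose:
  assumes "S \<in> carrier_mat m r"
  shows "(perp_mat S)\<^sup>T = perp_mat S"
  unfolding perp_mat_eq[OF assms] using proj_mat_carrier[OF assms] proj_mat_transpose[OF assms]
  by (metis one_carrier_mat transpose_minus transpose_one)

lemma proj_mat_mult_perp_mat:
  assumes "S \<in> stiefel r m"
  shows "proj_mat S * perp_mat S = 0\<^sub>m m m"
proof -
  have S: "S \<in> carrier_mat m r" using assms stiefel_carrier by auto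
  show ?thesis
    unfolding perp_mat_eq[OF S] mult_minus_distrib_mat[OF proj_mat_carrier[OF S] one_carrier_mat
        proj_mat_carrier[OF S]] proj_mat_idem[OF assms]
    using proj_mat_carrier[OF S] by (auto intro!: eq_matI)
qed

lemma append_cols_carrier:
  assumes "U \<in> carrier_mat m q" "U' \<in> carrier_mat m p"
  shows "append_cols U U' \<in> carrier_mat m (q + p)"
  using assms unfolding append_cols_def by auto

lemma append_cols_entry:
  assumes "U \<in> carrier_mat m q" "U' \<in> carrier_mat m p" "i < m" "j < q + p"
  shows "append_cols U U' $$ (i, j) = (if j < q then U $$ (i, j) else U' $$ (i, j - q))"
  using assms unfolding append_cols_def append_rows_def by auto

lemma append_cols_stiefel:
  assumes U: "U \<in> stiefel q m" and U': "U' \<in> stiefel p m" and orth: "U\<^sup>T * U' = 0\<^sub>m q p"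
  shows "append_cols U U' \<in> stiefel (q + p) m"
proof -
  note Uc = stiefel_carrier[OF U] and U'c = stiefel_carrier[OF U']
  note Sc = append_cols_carrier[OF Uc U'c]
  let ?S = "append_cols U U'"
  have UU: "(\<Sum>l<m. U $$ (l, i) * U $$ (l, j)) = (if i = j then 1 else 0)" if "i < q" "j < q" for i j
    using mat_mult_entry[of "U\<^sup>T" q m U q i j] Uc that stiefel_gram[OF U] by simp
  have UU': "(\<Sum>l<m. U $$ (l, i) * U' $$ (l, j)) = 0" if "i < q" "j < p" for i j
    using mat_mult_entry[of "U\<^sup>T" q m U' p i j] Uc U'c that orth by simp
  have U'U': "(\<Sum>l<m. U' $$ (l, i) * U' $$ (l, j)) = (if i = j then 1 else 0)" if "i < p" "j < p" for i j
    using mat_mult_entry[of "U'\<^sup>T" p m U' p i j] U'c that stiefel_gram[OF U'] by simp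
  have "?S\<^sup>T * ?S = 1\<^sub>m (q + p)"
  proof (rule eq_matI)
    fix i j assume "i < dim_row (1\<^sub>m (q + p) :: real mat)" "j < dim_col (1\<^sub>m (q + p) :: real mat)"
    then have ij: "i < q + p" "j < q + p" by auto
    have "(?S\<^sup>T * ?S) $$ (i, j) = (\<Sum>l<m. ?S $$ (l, i) * ?S $$ (l, j))"
      using mat_mult_entry[of "?S\<^sup>T" "q + p" m ?S "q + p" i j] Sc ij by simp
    also have "\<dots> = (\<Sum>l<m. (if i < q then U $$ (l, i) else U' $$ (l, i - q)) *
        (if j < q then U $$ (l, j) else U' $$ (l, j - q)))"
      using ij append_cols_entry[OF Uc U'c] by (intro sum.cong) auto
    also have "\<dots> = (if i = j then 1 else 0)"
      using ij UU[of i j] UU'[of i "j - q"] UU'[of j "i - q"] U'U'[of "i - q" "j - q"]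
      by (cases "i < q"; cases "j < q") (auto simp: mult.commute)
    finally show "(?S\<^sup>T * ?S) $$ (i, j) = 1\<^sub>m (q + p) $$ (i, j)" using ij by simp
  qed (use Sc in auto)
  then show ?thesis using Sc by (simp add: stiefel_def)
qed

lemma proj_mat_append_cols_mult:
  assumes U: "U \<in> stiefel q m" and U': "U' \<in> stiefel p m" and orth: "U\<^sup>T * U' = 0\<^sub>m q p"
  shows "proj_mat (append_cols U U') * U = U"
proof -
  note Uc = stiefel_carrier[OF U] and U'c = stiefel_carrier[OF U']
  note S = append_cols_stiefel[OF assms]
  note Sc = stiefel_carrier[OF S]
  define D :: "real mat" where "D = diag_rect (q + p) q (\<lambda>_. 1)"
  have D: "D \<in> carrier_mat (q + p) q" by (simp add: D_def diag_rect_def)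
  have SD: "append_cols U U' * D = U"
  proof (rule eq_matI)
    fix i j assume "i < dim_row U" "j < dim_col U"
    then have ij: "i < m" "j < q" using Uc by auto
    have "(append_cols U U' * D) $$ (i, j) = (\<Sum>l<q + p. append_cols U U' $$ (i, l) * D $$ (l, j))"
      using mat_mult_entry[OF Sc D ij] .
    also have "\<dots> = (\<Sum>l<q + p. if l = j then append_cols U U' $$ (i, j) else 0)"
      using ij by (intro sum.cong) (auto simp: D_def diag_rect_def)
    also have "\<dots> = U $$ (i, j)" using ij append_cols_entry[OF Uc U'c, of i j] by simp
    finally show "(append_cols U U' * D) $$ (i, j) = U $$ (i, j)" .
  qed (use Sc D Uc in auto)
  have "proj_mat (append_cols U U') * (append_cols U U' * D)
      = proj_mat (append_cols U U') * append_cols U U' * D"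
    by (rule assoc_mult_mat[OF proj_mat_carrier[OF Sc] Sc D, symmetric])
  then show ?thesis unfolding proj_mat_mult_self[OF S] SD .
qed

text \<open>With \<open>H H\<^sup>T\<close> invertible, \<open>right_pinv H * H\<close> is the orthogonal projection to the row space of
  \<open>H\<close>. The second claim says this for its transpose, which is what appears when the projection is
  moved across an inner product.\<close>
lemma right_pinv_properties:
  fixes H :: "real mat"
  assumes H: "H \<in> carrier_mat q m"
    and inj: "\<And>x. x \<in> carrier_vec q \<Longrightarrow> H\<^sup>T *\<^sub>v x = 0\<^sub>v m \<Longrightarrow> x = 0\<^sub>v q"
  shows "right_pinv H \<in> carrier_mat m q" and "H * (right_pinv H * H)\<^sup>T = H"
proof -
  have HT: "H\<^sup>T \<in> carrier_mat m q" using H by simp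
  have HH: "H * H\<^sup>T \<in> carrier_mat q q" using H by simp
  obtain B where B: "B \<in> carrier_mat q q" "H * H\<^sup>T * B = 1\<^sub>m q" "B * (H * H\<^sup>T) = 1\<^sub>m q"
    using gram_inverse_exists[OF HT inj] by auto
  then have "H * H\<^sup>T \<in> Units (ring_mat TYPE(real) q ())"
    using HH by (auto simp: Units_def ring_mat_def)
  then obtain Gi where "mat_inverse (H * H\<^sup>T) = Some Gi"
    using mat_inverse(1)[OF HH, where b = "()"] by (cases "mat_inverse (H * H\<^sup>T)") auto
  note Gi = this mat_inverse(2)[OF HH this]
  have pinv: "right_pinv H = H\<^sup>T * Gi" by (simp add: right_pinv_def Gi(1))
  show c: "right_pinv H \<in> carrier_mat m q" unfolding pinv using HT Gi by simp
  have GiT: "Gi\<^sup>T \<in> carrier_mat q q" using Gi by simp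
  have "(right_pinv H)\<^sup>T = Gi\<^sup>T * H"
    unfolding pinv using transpose_mult[OF HT, of Gi q] Gi by simp
  then have "(right_pinv H * H)\<^sup>T = H\<^sup>T * (Gi\<^sup>T * H)"
    using transpose_mult[OF c H] by simp
  then have "H * (right_pinv H * H)\<^sup>T = H * H\<^sup>T * (Gi\<^sup>T * H)"
    using assoc_mult_mat[OF H HT, of "Gi\<^sup>T * H" m] GiT H by simp
  also have "\<dots> = H * H\<^sup>T * Gi\<^sup>T * H" by (rule assoc_mult_mat[OF HH GiT H, symmetric])
  also have "H * H\<^sup>T * Gi\<^sup>T = (Gi * (H * H\<^sup>T))\<^sup>T"
    unfolding transpose_mult[OF Gi(2)[THEN conjunct2, THEN conjunct2] HH] transpose_mult[OF H HT] by simp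
  also have "(Gi * (H * H\<^sup>T))\<^sup>T = 1\<^sub>m q" using Gi by simp
  finally show "H * (right_pinv H * H)\<^sup>T = H" using H by simp
qed

context tensor_space
begin

text \<open>The \<open>k\<close>-th summand \<open>E\<close> of the approximate projection of \<open>A\<close> is described without the
  Tucker decomposition: it is a left multiple of \<open>Z\<close>, perpendicular to \<open>S\<close> in mode \<open>k\<close>, and it
  is the orthogonal projection of the perpendicular part of \<open>A\<close> to the left multiples of \<open>Z\<close>.
  The isometries \<open>U j\<close> drop out of inner products, and \<open>right_pinv G * G\<close> is the orthogonal
  projection to the row space of the unfolded core \<open>G\<close>.\<close>
lemma approx_proj_summand:
  fixes q :: "nat \<Rightarrow> nat" and G :: tensor and U :: "nat \<Rightarrow> real mat" and S :: "real mat"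
    and A Z :: "real ^ 'm"
  defines "q \<equiv> trank Z"
  assumes k: "k \<in> modes"
    and U: "\<And>j. j \<in> modes \<Longrightarrow> U j \<in> stiefel (q j) (n j)"
    and Z: "Z = of_entries idx (multi_prod d q modes G U)"
    and S: "S \<in> stiefel r (n k)"
    and E: "E = of_entries idx (multi_prod d (q(k := n k)) (modes - {k})
      (mode_prod d q k G (perp_mat S * unfold_mode d (q(k := n k)) k
        (multi_prod d n (modes - {k}) (entries idx A) (\<lambda>j. (U j)\<^sup>T)) *
        right_pinv (unfold_mode d q k G))) U)"
  shows "lm k (proj_mat (U k)) Z = Z"
    and "proj_mat S * U k = U k \<Longrightarrow> lm k (proj_mat S) Z = Z"
    and "\<exists>W \<in> carrier_mat (n k) (n k). E = lm k W Z"
    and "lm k (proj_mat S) E = 0"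
    and "\<And>C. C \<in> carrier_mat (n k) (n k) \<Longrightarrow>
      inner E (lm k C Z) = inner A (lm k C Z - lm k (proj_mat S) (lm k C Z))"
proof -
  define D where "D = modes - {k}"
  define p where "p = q(k := n k)"
  define H where "H = tprods D U G"
  define a where "a = tprods D (\<lambda>j. (U j)\<^sup>T) (entries idx A)"
  define \<Gamma> where "\<Gamma> = unfold_mode d q k G"
  define M where "M = unfold_mode d p k a"
  define W where "W = perp_mat S * M * right_pinv \<Gamma>"
  have D: "finite D" "D \<subseteq> modes" "k \<notin> D" "insert k D = modes" "D = modes - {k}"
    using k by (auto simp: D_def)
  have Uc: "U j \<in> carrier_mat (n j) (q j)" if "j \<in> modes" for j
    using U[OF that] by (rule stiefel_carrier)
  have Udim: "dim_row (U j) = n j" "dim_col (U j) = q j" if "j \<in> modes" for j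
    using Uc[OF that] by auto
  have pk: "p k = n k" and pj: "\<And>j. j \<noteq> k \<Longrightarrow> p j = q j" by (simp_all add: p_def)
  have UTU: "(U k)\<^sup>T * U k = 1\<^sub>m (q k)" using stiefel_gram[OF U[OF k]] .
  have Sc: "S \<in> carrier_mat (n k) r" using S by (rule stiefel_carrier)
  note Pc = proj_mat_carrier[OF Sc] and Nc = perp_mat_carrier[OF Sc]
  have UTc: "(U k)\<^sup>T \<in> carrier_mat (q k) (n k)" using Uc[OF k] by simp

  have z: "entries idx Z i = tprod k (U k) H i" if i: "i \<in> multi_indices d n" for i
  proof -
    have "entries idx Z i = multi_prod d q modes G U i"
      unfolding Z using i by (rule entries_of_entries)
    also have "\<dots> = tprods modes U G i"
      using i Udim by (intro multi_prod_eq_tprods[where p' = n]) auto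
    also have "\<dots> = tprod k (U k) H i"
      unfolding H_def using tprods_insert[OF D(1,3), of U G] D(4) by simp
    finally show ?thesis .
  qed
  have lmZ: "lm k C Z = of_entries idx (tprod k (C * U k) H)" if C: "C \<in> carrier_mat (n k) (n k)" for C
  proof -
    have "lm k C Z = of_entries idx (tprod k C (tprod k (U k) H))"
      by (rule lm_eqI[OF k C z])
    also have "\<dots> = of_entries idx (tprod k (C * U k) H)"
      using C Uc[OF k] multi_indices_less[OF _ k] by (intro of_entries_cong tprod_tprod) auto
    finally show ?thesis .
  qed
  have Zeq: "Z = of_entries idx (tprod k (U k) H)"
    using of_entries_cong[of "entries idx Z" "tprod k (U k) H"] z by (simp add: of_entries_entries)
  show "lm k (proj_mat (U k)) Z = Z"
    using lmZ[OF proj_mat_carrier[OF Uc[OF k]]] proj_mat_mult_self[OF U[OF k]] Zeq by simp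
  show "lm k (proj_mat S) Z = Z" if "proj_mat S * U k = U k"
    using lmZ[OF Pc] that Zeq by simp

  have Hu: "unfold_mode d (n(k := q k)) k H \<in> carrier_mat (q k) (codim d n k)"
    using unfold_mode_carrier[of d "n(k := q k)" k H] by simp
  have unfZ: "unf k Z = U k * unfold_mode d (n(k := q k)) k H"
  proof -
    have "unf k Z = unfold_mode d n k (tprod k (U k) H)"
      unfolding unfolding_of_def using z by (intro unfold_mode_cong[OF k])
    then show ?thesis
      using unfold_mode_tprod[of "U k" "n k" "n(k := q k)" k d H] Uc[OF k] k by simp
  qed
  \<comment> \<open>the unfolded core has full row rank: a row vector annihilating it would also annihilate the
    other factor \<open>H\<close> of \<open>Z\<close>, which is impossible since the rank of \<open>Z\<close> in mode \<open>k\<close> is \<open>q k\<close>\<close>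
  have inj: "x = 0\<^sub>v (q k)"
    if x: "x \<in> carrier_vec (q k)" "\<Gamma>\<^sup>T *\<^sub>v x = 0\<^sub>v (codim d q k)" for x
  proof -
    define y where "y = mat_of_row x"
    have y: "y \<in> carrier_mat 1 (q k)" using x by (simp add: y_def)
    have \<Gamma>c: "\<Gamma> \<in> carrier_mat (q k) (codim d q k)" by (simp add: \<Gamma>_def)
    have "(y * \<Gamma>) $$ (0, j) = 0" if j: "j < codim d q k" for j
    proof -
      have "(y * \<Gamma>) $$ (0, j) = (\<Gamma>\<^sup>T *\<^sub>v x) $ j"
        using j x(1) \<Gamma>c comm_scalar_prod[OF x(1), of "col \<Gamma> j"] by (simp add: y_def)
      then show ?thesis using x(2) j by simp
    qed
    then have "y * \<Gamma> = 0\<^sub>m 1 (codim d q k)" using y \<Gamma>c by (intro eq_matI) auto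
    then have "unfold_mode d (q(k := 1)) k (tprod k y G) = 0\<^sub>m 1 (codim d q k)"
      using unfold_mode_tprod[of y 1 q k d G] y k by (simp add: \<Gamma>_def)
    then have zero: "tprod k y G i = 0" if i: "i \<in> multi_indices d (q(k := 1))" for i
      using ten_mode_unfold_mode[OF i k, of "tprod k y G"] multi_indices_less[OF i k] fiber_index(1)[OF i k]
      by (simp add: ten_mode_eq)
    have "tprod k y H i = 0" if i: "i \<in> multi_indices d (n(k := 1))" for i
    proof -
      have "tprod k y H i = tprods D U (tprod k y G) i"
        unfolding H_def using tprods_tprod[OF D(1,3)] by simp
      also have "\<dots> = tprods D U (\<lambda>_. 0) i"
        using Udim D zero
        by (intro tprods_cong[OF D(1,2) _ _ _ i, where p = "q(k := 1)"]) auto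
      also have "\<dots> = 0"
      proof -
        have "tprods D U (\<lambda>_. 0) = (\<lambda>_. 0)" using D(1)
          by (induction D rule: finite_induct) (auto simp: tprods_insert tprod_def)
        then show ?thesis by simp
      qed
      finally show ?thesis .
    qed
    then have "unfold_mode d (n(k := 1)) k (tprod k y H) = unfold_mode d (n(k := 1)) k (\<lambda>_. 0)"
      by (intro unfold_mode_cong[OF k])
    then have yH: "y * unfold_mode d (n(k := q k)) k H = 0\<^sub>m 1 (codim d n k)"
    proof -
      have "unfold_mode d (n(k := 1)) k (\<lambda>_. 0) = 0\<^sub>m 1 (codim d n k)"
        by (intro eq_matI) (auto simp: unfold_mode_def)
      then show ?thesis
        using unfold_mode_tprod[of y 1 "n(k := q k)" k d H] y k
          \<open>unfold_mode d (n(k := 1)) k (tprod k y H) = unfold_mode d (n(k := 1)) k (\<lambda>_. 0)\<close> by simp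
    qed
    obtain P N where PN: "P \<in> carrier_mat (q k) (n k)" "N \<in> carrier_mat (codim d n k) (q k)"
      "P * unf k Z * N = 1\<^sub>m (q k)"
      using le_mat_rank_iff[OF unf_carrier, of "q k" k Z] by (auto simp: q_def trank_eq_mat_rank)
    let ?H = "unfold_mode d (n(k := q k)) k H"
    have PU: "P * U k \<in> carrier_mat (q k) (q k)" and HN: "?H * N \<in> carrier_mat (q k) (q k)"
      using PN Uc[OF k] Hu by auto
    have "P * unf k Z * N = P * U k * ?H * N"
      unfolding unfZ using assoc_mult_mat[OF PN(1) Uc[OF k] Hu] by simp
    also have "\<dots> = (P * U k) * (?H * N)" by (rule assoc_mult_mat[OF PU Hu PN(2)])
    finally have "(P * U k) * (?H * N) = 1\<^sub>m (q k)" using PN by simp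
    then have inv: "(?H * N) * (P * U k) = 1\<^sub>m (q k)"
      by (rule mat_mult_left_right_inverse[OF PU HN])
    have "y * (?H * N) = y * ?H * N" by (rule assoc_mult_mat[OF y Hu PN(2), symmetric])
    also have "\<dots> = 0\<^sub>m 1 (q k)" unfolding yH by (rule left_mult_zero_mat[OF PN(2)])
    finally have yHN: "y * (?H * N) = 0\<^sub>m 1 (q k)" .
    have "y = y * ((?H * N) * (P * U k))" unfolding inv using y by simp
    also have "\<dots> = y * (?H * N) * (P * U k)" by (rule assoc_mult_mat[OF y HN PU, symmetric])
    also have "\<dots> = 0\<^sub>m 1 (q k)" unfolding yHN by (rule left_mult_zero_mat[OF PU])
    finally have "y = 0\<^sub>m 1 (q k)" .
    then have "y $$ (0, j) = 0" if "j < q k" for j using that by simp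
    then have "x $ j = 0" if "j < q k" for j using that x(1) by (simp add: y_def mat_of_row_def)
    then show ?thesis using x(1) by (intro eq_vecI) auto
  qed
  have \<Gamma>c: "\<Gamma> \<in> carrier_mat (q k) (codim d q k)" by (simp add: \<Gamma>_def)
  note pinv = right_pinv_properties[OF \<Gamma>c inj]
  have Mc: "M \<in> carrier_mat (n k) (codim d q k)"
    using unfold_mode_carrier[of d p k a] by (simp add: M_def p_def)
  have NMc: "perp_mat S * M \<in> carrier_mat (n k) (codim d q k)" using Nc Mc by simp
  have Wc: "W \<in> carrier_mat (n k) (q k)" unfolding W_def using NMc pinv(1) by simp

  have "unfold_mode d p k (multi_prod d n D (entries idx A) (\<lambda>j. (U j)\<^sup>T)) = M"
    unfolding M_def a_def
  proof (rule unfold_mode_cong[OF k])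
    fix i assume i: "i \<in> multi_indices d p"
    show "multi_prod d n D (entries idx A) (\<lambda>j. (U j)\<^sup>T) i = tprods D (\<lambda>j. (U j)\<^sup>T) (entries idx A) i"
      using Udim D by (intro multi_prod_eq_tprods[OF D(2) _ _ _ i]) (auto simp: p_def)
  qed
  then have E': "E = of_entries idx (multi_prod d p D (mode_prod d q k G W) U)"
    unfolding E W_def p_def D_def \<Gamma>_def by simp
  have e: "entries idx E i = tprods D U (tprod k W G) i" if i: "i \<in> multi_indices d n" for i
  proof -
    have "entries idx E i = multi_prod d p D (mode_prod d q k G W) U i"
      unfolding E' using i by (rule entries_of_entries)
    also have "\<dots> = tprods D U (tprod k W G) i"
    proof (rule multi_prod_eq_tprods[OF D(2) _ _ _ i])
      show "mode_prod d q k G W j = tprod k W G j" if "j \<in> multi_indices d p" for j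
        using that Wc k by (intro mode_prod_eq_tprod) (auto simp: p_def)
    qed (use Udim D in \<open>auto simp: p_def\<close>)
    finally show ?thesis .
  qed
  have EW: "E = lm k (W * (U k)\<^sup>T) Z"
  proof -
    have "W * (U k)\<^sup>T * U k = W" using assoc_mult_mat[OF Wc UTc Uc[OF k]] UTU Wc by simp
    then have "lm k (W * (U k)\<^sup>T) Z = of_entries idx (tprod k W H)"
      using lmZ[of "W * (U k)\<^sup>T"] Wc UTc by simp
    also have "\<dots> = of_entries idx (entries idx E)"
      using e unfolding H_def by (intro of_entries_cong) (simp add: tprods_tprod[OF D(1,3)])
    finally show ?thesis by (simp add: of_entries_entries)
  qed
  have WUc: "W * (U k)\<^sup>T \<in> carrier_mat (n k) (n k)" using Wc UTc by simp
  then show "\<exists>W \<in> carrier_mat (n k) (n k). E = lm k W Z" using EW by blast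
  show "lm k (proj_mat S) E = 0"
  proof -
    have "proj_mat S * (perp_mat S * M) = 0\<^sub>m (n k) (codim d q k)"
      using assoc_mult_mat[OF Pc Nc Mc] proj_mat_mult_perp_mat[OF S] Mc by simp
    then have "proj_mat S * W = 0\<^sub>m (n k) (q k)"
      unfolding W_def using assoc_mult_mat[OF Pc NMc pinv(1)] pinv(1) by simp
    then have PW: "proj_mat S * (W * (U k)\<^sup>T) = 0\<^sub>m (n k) (n k)"
      using assoc_mult_mat[OF Pc Wc UTc] UTc by simp
    have "lm k (0\<^sub>m (n k) (n k)) Z = 0"
      unfolding lm_def tprod_def using multi_indices_less[OF idx_in k]
      by (simp add: of_entries_def Finite_Cartesian_Product.vec_eq_iff)
    then show ?thesis unfolding EW lm_lm[OF k Pc WUc] PW .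
  qed

  fix C :: "real mat" assume C: "C \<in> carrier_mat (n k) (n k)"
  have CU: "C * U k \<in> carrier_mat (n k) (q k)" using C Uc[OF k] by simp
  have NCU: "perp_mat S * (C * U k) \<in> carrier_mat (n k) (q k)" using Nc CU by simp
  have lmZ': "entries idx (lm k B Z) i = tprods D U (tprod k (B * U k) G) i"
    if "B \<in> carrier_mat (n k) (n k)" "i \<in> multi_indices d n" for B i
    unfolding lmZ[OF that(1)] H_def tprods_tprod[OF D(1,3)] using that(2) by (rule entries_of_entries)
  have adj: "tinner d n (tprods D U X) Y = tinner d p X (tprods D (\<lambda>j. (U j)\<^sup>T) Y)" for X Y
    using Uc D by (intro tprods_adjoint[OF D(1,2)]) (auto simp: p_def)
  have "tprods D (\<lambda>j. (U j)\<^sup>T) (tprods D U X) i = X i" if i: "i \<in> multi_indices d p" for X i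
  proof (rule tprods_left_inverse[OF D(1,2) _ i])
    fix j assume j: "j \<in> D"
    then show "U j \<in> carrier_mat (n j) (p j) \<and> (U j)\<^sup>T \<in> carrier_mat (p j) (n j) \<and> (U j)\<^sup>T * U j = 1\<^sub>m (p j)"
      using Uc[of j] stiefel_gram[OF U, of j] D by (auto simp: p_def)
  qed
  then have iso: "tinner d n (tprods D U X) (tprods D U Y) = tinner d p X Y" for X Y
    unfolding adj by (intro tinner_cong) auto
  have frob: "tinner d p X Y = frob_inner (unfold_mode d p k X) (unfold_mode d p k Y)" for X Y
    unfolding unfold_mode_inner[OF k] frob_inner_def by (subst sum.swap) simp
  have unfp: "unfold_mode d p k (tprod k B G) = B * \<Gamma>" if "B \<in> carrier_mat (n k) (q k)" for B
    using unfold_mode_tprod[of B "n k" q k d G] that k by (simp add: p_def \<Gamma>_def)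
  have NMpc: "right_pinv \<Gamma> * \<Gamma> \<in> carrier_mat (codim d q k) (codim d q k)" using pinv(1) \<Gamma>c by simp
  have CUG: "C * U k * \<Gamma> \<in> carrier_mat (n k) (codim d q k)" using CU \<Gamma>c by simp
  have "inner E (lm k C Z) = tinner d n (tprods D U (tprod k W G)) (tprods D U (tprod k (C * U k) G))"
    unfolding inner_eq_tinner by (intro tinner_cong e lmZ'[OF C])
  also have "\<dots> = frob_inner (W * \<Gamma>) (C * U k * \<Gamma>)"
    unfolding iso frob unfp[OF Wc] unfp[OF CU] ..
  also have "W * \<Gamma> = perp_mat S * M * (right_pinv \<Gamma> * \<Gamma>)"
    unfolding W_def by (rule assoc_mult_mat[OF NMc pinv(1) \<Gamma>c])
  also have "frob_inner \<dots> (C * U k * \<Gamma>)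
      = frob_inner (perp_mat S * M) (C * U k * \<Gamma> * (right_pinv \<Gamma> * \<Gamma>)\<^sup>T)"
    by (rule frob_inner_mult_right[OF NMc NMpc CUG])
  also have "C * U k * \<Gamma> * (right_pinv \<Gamma> * \<Gamma>)\<^sup>T = C * U k * \<Gamma>"
    using assoc_mult_mat[OF CU \<Gamma>c, of "(right_pinv \<Gamma> * \<Gamma>)\<^sup>T" "codim d q k"] NMpc pinv(2) by simp
  also have "frob_inner (perp_mat S * M) (C * U k * \<Gamma>) = frob_inner M (perp_mat S * (C * U k * \<Gamma>))"
    unfolding frob_inner_mult_left[OF Nc Mc CUG] perp_mat_transpose[OF Sc] ..
  also have "perp_mat S * (C * U k * \<Gamma>) = perp_mat S * (C * U k) * \<Gamma>"
    by (rule assoc_mult_mat[OF Nc CU \<Gamma>c, symmetric])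
  also have "frob_inner M \<dots> = tinner d p a (tprod k (perp_mat S * (C * U k)) G)"
    unfolding frob unfp[OF NCU] M_def ..
  also have "\<dots> = tinner d p (tprod k (perp_mat S * (C * U k)) G) a"
    unfolding tinner_def by (simp add: mult.commute)
  also have "\<dots> = tinner d n (tprods D U (tprod k (perp_mat S * (C * U k)) G)) (entries idx A)"
    unfolding adj a_def ..
  also have "\<dots> = inner (lm k (perp_mat S * C) Z) A"
    unfolding inner_eq_tinner using lmZ'[of "perp_mat S * C"] Nc C assoc_mult_mat[OF Nc C Uc[OF k]]
    by (intro tinner_cong) auto
  also have "lm k (perp_mat S * C) Z = lm k (perp_mat S) (lm k C Z)"
    by (rule lm_lm[OF k Nc C, symmetric])
  also have "\<dots> = lm k C Z - lm k (proj_mat S) (lm k C Z)"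
    unfolding perp_mat_eq[OF Sc] using lm_minus_mat[OF k one_carrier_mat Pc] lm_one[OF k] by simp
  finally show "inner E (lm k C Z) = inner A (lm k C Z - lm k (proj_mat S) (lm k C Z))"
    by (simp add: inner_commute)
qed

lemma approx_projE:
  assumes Zvar: "Z \<in> tucker_variety d n idx r" and V: "V \<in> approx_proj d n idx r Z A"
  obtains U S E where
    "\<And>k. k \<in> modes \<Longrightarrow> U k \<in> stiefel (trank Z k) (n k)"
    "\<And>k. k \<in> modes \<Longrightarrow> S k \<in> stiefel (r k) (n k)"
    "\<And>k. k \<in> modes \<Longrightarrow> trank Z k = r k \<Longrightarrow> S k = U k"
    "\<And>k. k \<in> modes \<Longrightarrow> lm k (proj_mat (U k)) Z = Z"
    "\<And>k. k \<in> modes \<Longrightarrow> lm k (proj_mat (S k)) Z = Z"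
    "V = lms modes (\<lambda>k. proj_mat (S k)) A + (\<Sum>k\<in>modes. E k)"
    "norm (lms {k\<in>modes. trank Z k = r k} (\<lambda>k. proj_mat (U k)) A) *
       (\<Prod>k\<in>{k\<in>modes. trank Z k < r k}. sqrt (real (r k - trank Z k) / real (min (n k) (codim d n k))))
       \<le> norm (lms modes (\<lambda>k. proj_mat (S k)) A)"
    "\<And>k. k \<in> modes \<Longrightarrow> \<exists>W \<in> carrier_mat (n k) (n k). E k = lm k W Z"
    "\<And>k. k \<in> modes \<Longrightarrow> lm k (proj_mat (S k)) (E k) = 0"
    "\<And>k C. k \<in> modes \<Longrightarrow> C \<in> carrier_mat (n k) (n k) \<Longrightarrow>
      inner (E k) (lm k C Z) = inner A (lm k C Z - lm k (proj_mat (S k)) (lm k C Z))"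
proof -
  define q where "q = trank Z"
  define I where "I = {k\<in>modes. q k < r k}"
  have qr: "q k \<le> r k" if "k \<in> modes" for k
    using Zvar that by (simp add: tucker_variety_def q_def)
  obtain G U U' where U: "\<And>k. k \<in> modes \<Longrightarrow> U k \<in> stiefel (q k) (n k)"
    and Z: "Z = of_entries idx (multi_prod d q modes G U)"
    and U': "\<And>k. k \<in> I \<Longrightarrow> U' k \<in> stiefel (r k - q k) (n k) \<and> (U k)\<^sup>T * U' k = 0\<^sub>m (q k) (r k - q k)"
    and le: "norm (of_entries idx (multi_prod d n (modes - I) (entries idx A) (\<lambda>k. proj_mat (U k))))
      * (\<Prod>k\<in>I. sqrt (real (r k - q k) / real (min (n k) (codim d n k)))) \<le>
      norm (of_entries idx (multi_prod d n modes (entries idx A)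
        (\<lambda>k. proj_mat (if k \<in> I then append_cols (U k) (U' k) else U k))))"
    and Vf: "V = approx_proj_formula d n idx q G U (\<lambda>k. if k \<in> I then append_cols (U k) (U' k) else U k) A"
    using V unfolding approx_proj_def Let_def I_def q_def by blast
  define S where "S = (\<lambda>k. if k \<in> I then append_cols (U k) (U' k) else U k)"
  have S: "S k \<in> stiefel (r k) (n k) \<and> proj_mat (S k) * U k = U k" if k: "k \<in> modes" for k
  proof (cases "k \<in> I")
    case True
    then have "q k + (r k - q k) = r k" using qr[OF k] by simp
    then show ?thesis
      using append_cols_stiefel[OF U[OF k], of "U' k" "r k - q k"]
        proj_mat_append_cols_mult[OF U[OF k], of "U' k" "r k - q k"] U'[OF True] True
      by (simp add: S_def)
  next
    case False
    then have "q k = r k" using qr[OF k] k by (auto simp: I_def)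
    then show ?thesis using U[OF k] proj_mat_mult_self[OF U[OF k]] False by (simp add: S_def)
  qed
  define E where "E = (\<lambda>k. of_entries idx (multi_prod d (q(k := n k)) (modes - {k})
      (mode_prod d q k G (perp_mat (S k) * unfold_mode d (q(k := n k)) k
        (multi_prod d n (modes - {k}) (entries idx A) (\<lambda>j. (U j)\<^sup>T)) *
        right_pinv (unfold_mode d q k G))) U))"
  have Pc: "proj_mat (S k) \<in> carrier_mat (n k) (n k)" "proj_mat (U k) \<in> carrier_mat (n k) (n k)"
    if "k \<in> modes" for k
    using S[OF that] U[OF that] by (auto intro: proj_mat_carrier stiefel_carrier)
  have first: "of_entries idx (multi_prod d n modes (entries idx A) (\<lambda>k. proj_mat (S k)))
      = lms modes (\<lambda>k. proj_mat (S k)) A"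
    using Pc by (intro multi_prod_eq_lms) auto
  have J: "modes - I = {k\<in>modes. q k = r k}" using qr by (force simp: I_def)
  have second: "of_entries idx (multi_prod d n (modes - I) (entries idx A) (\<lambda>k. proj_mat (U k)))
      = lms {k\<in>modes. q k = r k} (\<lambda>k. proj_mat (U k)) A"
    unfolding J using Pc by (intro multi_prod_eq_lms) auto
  have Ek: "E k = of_entries idx (multi_prod d (q(k := n k)) (modes - {k})
      (mode_prod d q k G (perp_mat (S k) * unfold_mode d (q(k := n k)) k
        (multi_prod d n (modes - {k}) (entries idx A) (\<lambda>j. (U j)\<^sup>T)) *
        right_pinv (unfold_mode d q k G))) U)" for k
    by (simp only: E_def)
  have summand: "lm k (proj_mat (U k)) Z = Z"
    "lm k (proj_mat (S k)) Z = Z"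
    "\<exists>W \<in> carrier_mat (n k) (n k). E k = lm k W Z"
    "lm k (proj_mat (S k)) (E k) = 0"
    "\<And>C. C \<in> carrier_mat (n k) (n k) \<Longrightarrow>
      inner (E k) (lm k C Z) = inner A (lm k C Z - lm k (proj_mat (S k)) (lm k C Z))"
    if k: "k \<in> modes" for k
    using approx_proj_summand[OF k U[unfolded q_def] Z[unfolded q_def] conjunct1[OF S[OF k]]
        Ek[unfolded q_def]] conjunct2[OF S[OF k]] by blast+
  show thesis
  proof (rule that[of U S E], unfold q_def[symmetric])
    show "V = lms modes (\<lambda>k. proj_mat (S k)) A + (\<Sum>k\<in>modes. E k)"
      unfolding Vf approx_proj_formula_def Let_def S_def[symmetric] first E_def ..
    show "norm (lms {k\<in>modes. q k = r k} (\<lambda>k. proj_mat (U k)) A) *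
       (\<Prod>k\<in>{k\<in>modes. q k < r k}. sqrt (real (r k - q k) / real (min (n k) (codim d n k))))
       \<le> norm (lms modes (\<lambda>k. proj_mat (S k)) A)"
      using le unfolding first[unfolded S_def] second I_def[symmetric] by (simp add: S_def)
    show "S k = U k" if "k \<in> modes" "q k = r k" for k using that by (simp add: S_def I_def)
  qed (use U S summand in blast)+
qed

end

section \<open>Limits of matrices\<close>

definition mat_tendsto ::
  "nat \<Rightarrow> nat \<Rightarrow> ('a \<Rightarrow> real mat) \<Rightarrow> real mat \<Rightarrow> 'a filter \<Rightarrow> bool" where
  "mat_tendsto n m A L F \<longleftrightarrow> (\<forall>i<n. \<forall>j<m. ((\<lambda>t. A t $$ (i, j)) \<longlongrightarrow> L $$ (i, j)) F)"

lemma mat_tendsto_const: "mat_tendsto n m (\<lambda>_. A) A F"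
  by (simp add: mat_tendsto_def)

lemma mat_tendsto_mult:
  assumes A: "mat_tendsto n k A L F" "\<And>t. A t \<in> carrier_mat n k" "L \<in> carrier_mat n k"
    and B: "mat_tendsto k m B M F" "\<And>t. B t \<in> carrier_mat k m" "M \<in> carrier_mat k m"
  shows "mat_tendsto n m (\<lambda>t. A t * B t) (L * M) F"
  unfolding mat_tendsto_def
proof (intro allI impI)
  fix i j assume ij: "i < n" "j < m"
  have "((\<lambda>t. \<Sum>l<k. A t $$ (i, l) * B t $$ (l, j)) \<longlongrightarrow> (\<Sum>l<k. L $$ (i, l) * M $$ (l, j))) F"
    using A(1) B(1) ij by (intro tendsto_intros) (auto simp: mat_tendsto_def)
  then show "((\<lambda>t. (A t * B t) $$ (i, j)) \<longlongrightarrow> (L * M) $$ (i, j)) F"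
    using mat_mult_entry[OF A(2) B(2) ij] mat_mult_entry[OF A(3) B(3) ij] by simp
qed

lemma det_tendsto:
  assumes "mat_tendsto n n A L F" "\<And>t. A t \<in> carrier_mat n n" "L \<in> carrier_mat n n"
  shows "((\<lambda>t. Determinant.det (A t)) \<longlongrightarrow> Determinant.det L) F"
  unfolding det_def'[OF assms(2)] det_def'[OF assms(3)] using assms(1)
proof (intro tendsto_intros)
  fix p i assume p: "p \<in> {p. p permutes {0..<n}}" and i: "i \<in> {0..<n}"
  then have "p i < n" using permutes_in_image[of p "{0..<n}" i] by simp
  then show "((\<lambda>t. A t $$ (i, p i)) \<longlongrightarrow> L $$ (i, p i)) F"
    using assms(1) i by (simp add: mat_tendsto_def)
qed

lemma adj_mat_tendsto:
  assumes A: "mat_tendsto n n A L F" "\<And>t. A t \<in> carrier_mat n n" and L: "L \<in> carrier_mat n n"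
  shows "mat_tendsto n n (\<lambda>t. adj_mat (A t)) (adj_mat L) F"
  unfolding mat_tendsto_def
proof (intro allI impI)
  fix i j assume ij: "i < n" "j < n"
  have "mat_tendsto (n - 1) (n - 1) (\<lambda>t. mat_delete (A t) j i) (mat_delete L j i) F"
    unfolding mat_tendsto_def mat_delete_def
    using A L carrier_matD[OF A(2)] by (auto simp: mat_tendsto_def)
  then have "((\<lambda>t. Determinant.det (mat_delete (A t) j i)) \<longlongrightarrow> Determinant.det (mat_delete L j i)) F"
    by (rule det_tendsto) (intro mat_delete_carrier A(2) L)+
  then have "((\<lambda>t. (-1) ^ (j + i) * Determinant.det (mat_delete (A t) j i))
      \<longlongrightarrow> (-1) ^ (j + i) * Determinant.det (mat_delete L j i)) F"
    by (intro tendsto_intros)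
  then show "((\<lambda>t. adj_mat (A t) $$ (i, j)) \<longlongrightarrow> adj_mat L $$ (i, j)) F"
    using ij L carrier_matD[OF A(2)] by (simp add: adj_mat_def cofactor_def)
qed

text \<open>Cramer's inverse; unlike \<open>mat_inverse\<close> it is visibly continuous.\<close>
definition cramer_inverse :: "real mat \<Rightarrow> real mat" where
  "cramer_inverse A = (1 / Determinant.det A) \<cdot>\<^sub>m adj_mat A"

lemma cramer_inverse_carrier: "A \<in> carrier_mat n n \<Longrightarrow> cramer_inverse A \<in> carrier_mat n n"
  using adj_mat(1)[of A n] by (simp add: cramer_inverse_def)

lemma cramer_inverse_right:
  assumes "A \<in> carrier_mat n n" "Determinant.det A \<noteq> 0"
  shows "A * cramer_inverse A = 1\<^sub>m n"
  unfolding cramer_inverse_def using mult_smult_distrib[OF assms(1) adj_mat(1)[OF assms(1)]]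
    adj_mat(2)[OF assms(1)] assms(2) by (auto intro!: eq_matI)

lemma cramer_inverse_tendsto:
  assumes A: "mat_tendsto n n A L F" "\<And>t. A t \<in> carrier_mat n n" and L: "L \<in> carrier_mat n n"
    and "Determinant.det L \<noteq> 0"
  shows "mat_tendsto n n (\<lambda>t. cramer_inverse (A t)) (cramer_inverse L) F"
  unfolding mat_tendsto_def
proof (intro allI impI)
  fix i j assume ij: "i < n" "j < n"
  have "((\<lambda>t. 1 / Determinant.det (A t) * adj_mat (A t) $$ (i, j))
      \<longlongrightarrow> 1 / Determinant.det L * adj_mat L $$ (i, j)) F"
    using adj_mat_tendsto[OF A L] ij assms(4)
    by (intro tendsto_intros det_tendsto[OF A L]) (auto simp: mat_tendsto_def)
  then show "((\<lambda>t. cramer_inverse (A t) $$ (i, j)) \<longlongrightarrow> cramer_inverse L $$ (i, j)) F"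
    using ij carrier_matD[OF adj_mat(1)[OF A(2)]] carrier_matD[OF adj_mat(1)[OF L]]
    by (simp add: cramer_inverse_def)
qed

text \<open>The skeleton (or CUR) identity: a matrix of rank at most \<open>q\<close> is recovered from its
  products with \<open>N\<close> and \<open>P\<close> as soon as the \<open>q \<times> q\<close> matrix \<open>P A N\<close> is invertible.\<close>
lemma skeleton_identity:
  fixes A :: "real mat"
  assumes A: "A \<in> carrier_mat n m" and P: "P \<in> carrier_mat q n" and N: "N \<in> carrier_mat m q"
    and rank: "mat_rank A \<le> q" and det: "Determinant.det (P * A * N) \<noteq> 0"
  shows "A * N * cramer_inverse (P * A * N) * P * A = A"
proof -
  obtain F H where F: "F \<in> carrier_mat n q" and H: "H \<in> carrier_mat q m" and AFH: "A = F * H"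
    using mat_rank_le_iff[OF A] rank by blast
  define K where "K = cramer_inverse (P * A * N)"
  have D: "P * A * N \<in> carrier_mat q q" by (rule mult_carrier_mat[OF mult_carrier_mat[OF P A] N])
  have K: "K \<in> carrier_mat q q" unfolding K_def by (rule cramer_inverse_carrier[OF D])
  have PF: "P * F \<in> carrier_mat q q" and HN: "H * N \<in> carrier_mat q q" using P F H N by auto
  have HNK: "H * N * K \<in> carrier_mat q q" using HN K by simp
  have "P * A * N = P * F * (H * N)"
    unfolding AFH using assoc_mult_mat[OF P F H] assoc_mult_mat[OF PF H N] by simp
  then have "P * F * (H * N) * K = 1\<^sub>m q"
    using cramer_inverse_right[OF D det] by (simp add: K_def)
  then have "P * F * (H * N * K) = 1\<^sub>m q" using assoc_mult_mat[OF PF HN K] by simp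
  then have inv: "H * N * K * (P * F) = 1\<^sub>m q"
    by (rule mat_mult_left_right_inverse[OF PF HNK])
  have "A * N = F * (H * N)" unfolding AFH by (rule assoc_mult_mat[OF F H N])
  then have ANK: "A * N * K = F * (H * N * K)" using assoc_mult_mat[OF F HN K] by simp
  have c: "F * (H * N * K) \<in> carrier_mat n q" using F HNK by simp
  have "A * N * K * P * A = A * N * K * (P * A)"
    by (rule assoc_mult_mat[OF mult_carrier_mat[OF mult_carrier_mat[OF A N] K] P A])
  also have "P * A = P * F * H" unfolding AFH by (rule assoc_mult_mat[OF P F H, symmetric])
  also have "A * N * K * (P * F * H) = F * (H * N * K) * (P * F) * H"
    unfolding ANK by (rule assoc_mult_mat[OF c PF H, symmetric])
  also have "F * (H * N * K) * (P * F) = F"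
    unfolding assoc_mult_mat[OF F HNK PF] inv using F by simp
  finally show ?thesis unfolding K_def AFH .
qed

section \<open>Continuous factors of left multiples\<close>

context tensor_space
begin

text \<open>\<open>h\<close> is a left factor in mode \<open>k\<close> near \<open>L\<close>: for a tensor \<open>Z\<close> near \<open>L\<close> whose rank in mode \<open>k\<close>
  is that of \<open>L\<close>, each left multiple \<open>v\<close> of \<open>Z\<close> is \<open>h Z v\<close> times \<open>Z\<close>, and \<open>h Z v\<close> depends
  continuously on \<open>Z\<close> and \<open>v\<close>. It takes the role that the core tensor and its pseudoinverse
  play in a fixed Tucker decomposition; \<open>lm k (h Z Z)\<close> is an oblique projection to the tensors
  whose mode-\<open>k\<close> fibers lie in the span of those of \<open>Z\<close>.\<close>
definition left_factor :: "nat \<Rightarrow> real ^ 'm \<Rightarrow> (real ^ 'm \<Rightarrow> real ^ 'm \<Rightarrow> real mat) \<Rightarrow> bool" where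
  "left_factor k L h \<longleftrightarrow>
     (\<forall>Z v. h Z v \<in> carrier_mat (n k) (n k)) \<and>
     (\<forall>Z v. \<forall>T \<in> carrier_mat (n k) (n k). h Z (lm k T v) = T * h Z v) \<and>
     (\<forall>Z v v0 x x0. (Z :: nat \<Rightarrow> _) \<longlonglongrightarrow> L \<longrightarrow> v \<longlonglongrightarrow> v0 \<longrightarrow> x \<longlonglongrightarrow> x0 \<longrightarrow>
        (\<lambda>t. lm k (h (Z t) (v t)) (x t)) \<longlonglongrightarrow> lm k (h L v0) x0) \<and>
     (\<forall>Z. (Z :: nat \<Rightarrow> _) \<longlonglongrightarrow> L \<longrightarrow> (\<forall>\<^sub>F t in sequentially. trank L k \<le> trank (Z t) k \<and>
        (trank (Z t) k \<le> trank L k \<longrightarrow> lm k (h (Z t) (Z t)) (Z t) = Z t)))"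

lemma lm_tendsto:
  assumes k: "k \<in> modes" and M: "mat_tendsto (n k) (n k) M M0 F"
    and "\<And>t. M t \<in> carrier_mat (n k) (n k)" "M0 \<in> carrier_mat (n k) (n k)"
    and x: "(x \<longlongrightarrow> x0) F"
  shows "((\<lambda>t. lm k (M t) (x t)) \<longlongrightarrow> lm k M0 x0) F"
proof (rule Finite_Cartesian_Product.vec_tendstoI)
  fix i :: 'm
  have "dim_col (M t) = n k" "dim_col M0 = n k" for t using assms(3)[of t] assms(4) by auto
  moreover have "((\<lambda>t. \<Sum>b<n k. M t $$ (idx i k, b) * entries idx (x t) ((idx i)(k := b)))
    \<longlongrightarrow> (\<Sum>b<n k. M0 $$ (idx i k, b) * entries idx x0 ((idx i)(k := b)))) F"
    unfolding entries_def using M multi_indices_less[OF idx_in k, of i]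
    by (intro tendsto_intros x) (auto simp: mat_tendsto_def)
  ultimately show "((\<lambda>t. vec_nth (lm k (M t) (x t)) i) \<longlongrightarrow> vec_nth (lm k M0 x0) i) F"
    by (simp add: lm_def of_entries_def tprod_def)
qed

lemma unf_tendsto:
  assumes "(x \<longlongrightarrow> x0) F"
  shows "mat_tendsto (n k) (codim d n k) (\<lambda>t. unf k (x t)) (unf k x0) F"
  unfolding mat_tendsto_def unfolding_of_def unfold_mode_def entries_def
  using assms by (auto intro!: tendsto_intros)

text \<open>With \<open>P L N = 1\<close> for the unfolding of \<open>L\<close>, take \<open>h Z v = v N (P Z N)\<^sup>-\<^sup>1 P\<close>. Linearity in \<open>v\<close> from
  the left is evident, continuity comes from Cramer's rule, and \<open>h Z Z\<close> fixes \<open>Z\<close> by the skeleton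
  identity.\<close>
lemma left_factor_exists:
  assumes k: "k \<in> modes"
  shows "\<exists>h. left_factor k L h"
proof -
  define q where "q = trank L k"
  let ?c = "codim d n k"
  obtain P N where P: "P \<in> carrier_mat q (n k)" and N: "N \<in> carrier_mat ?c q"
    and PLN: "P * unf k L * N = 1\<^sub>m q"
    using le_mat_rank_iff[OF unf_carrier, of q k L] by (auto simp: q_def trank_eq_mat_rank)
  define D where "D = (\<lambda>Z. P * unf k Z * N)"
  have D: "D Z \<in> carrier_mat q q" for Z
    unfolding D_def by (rule mult_carrier_mat[OF mult_carrier_mat[OF P unf_carrier] N])
  have DL: "D L = 1\<^sub>m q" using PLN by (simp add: D_def)
  define h where "h = (\<lambda>Z v. unf k v * N * cramer_inverse (D Z) * P)"
  note K = cramer_inverse_carrier[OF D]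
  have vN: "unf k v * N \<in> carrier_mat (n k) q" for v by (rule mult_carrier_mat[OF unf_carrier N])
  have vNK: "unf k v * N * cramer_inverse (D Z) \<in> carrier_mat (n k) q" for Z v
    by (rule mult_carrier_mat[OF vN K])
  have h: "h Z v \<in> carrier_mat (n k) (n k)" for Z v
    unfolding h_def by (rule mult_carrier_mat[OF vNK P])
  have left: "h Z (lm k T v) = T * h Z v" if T: "T \<in> carrier_mat (n k) (n k)" for Z T v
    unfolding h_def unf_lm[OF k T] assoc_mult_mat[OF T unf_carrier N] assoc_mult_mat[OF T vN K]
    by (rule assoc_mult_mat[OF T vNK P])
  have Dlim: "mat_tendsto q q (\<lambda>t. D (Z t)) (D L) sequentially" if "Z \<longlonglongrightarrow> L" for Z :: "nat \<Rightarrow> _"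
    unfolding D_def using P N
    by (intro mat_tendsto_mult[where k = ?c] mat_tendsto_mult[where k = "n k"] mat_tendsto_const
        unf_tendsto that) auto
  have cont: "(\<lambda>t. lm k (h (Z t) (v t)) (x t)) \<longlonglongrightarrow> lm k (h L v0) x0"
    if lim: "Z \<longlonglongrightarrow> L" "v \<longlonglongrightarrow> v0" "x \<longlonglongrightarrow> x0" for Z v :: "nat \<Rightarrow> _" and v0 x x0
  proof (rule lm_tendsto[OF k _ h h lim(3)])
    have "mat_tendsto q q (\<lambda>t. cramer_inverse (D (Z t))) (cramer_inverse (D L)) sequentially"
      using D DL by (intro cramer_inverse_tendsto Dlim lim) auto
    moreover have "mat_tendsto (n k) q (\<lambda>t. unf k (v t) * N) (unf k v0 * N) sequentially"
      by (intro mat_tendsto_mult[where k = ?c] unf_tendsto lim mat_tendsto_const unf_carrier N)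
    ultimately show "mat_tendsto (n k) (n k) (\<lambda>t. h (Z t) (v t)) (h L v0) sequentially"
      unfolding h_def
      by (intro mat_tendsto_mult[OF mat_tendsto_mult[OF _ vN vN _ K K] vNK vNK mat_tendsto_const P P])
  qed
  have ev: "\<forall>\<^sub>F t in sequentially. trank L k \<le> trank (Z t) k \<and>
        (trank (Z t) k \<le> trank L k \<longrightarrow> lm k (h (Z t) (Z t)) (Z t) = Z t)"
    if "Z \<longlonglongrightarrow> L" for Z :: "nat \<Rightarrow> _"
  proof -
    have "(\<lambda>t. Determinant.det (D (Z t))) \<longlonglongrightarrow> Determinant.det (D L)"
      by (rule det_tendsto[OF Dlim[OF that] D D])
    then have "(\<lambda>t. Determinant.det (D (Z t))) \<longlonglongrightarrow> 1" by (simp add: DL)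
    then have "\<forall>\<^sub>F t in sequentially. Determinant.det (D (Z t)) \<noteq> 0"
      by (rule tendsto_imp_eventually_ne) simp
    then show ?thesis
    proof eventually_elim
      case (elim t)
      have inv: "P * unf k (Z t) * (N * cramer_inverse (D (Z t))) = 1\<^sub>m q"
        using assoc_mult_mat[OF mult_carrier_mat[OF P unf_carrier] N K, of "Z t" "Z t"]
          cramer_inverse_right[OF D elim] by (simp add: D_def)
      have "q \<le> mat_rank (unf k (Z t))"
        using inv P N K unfolding le_mat_rank_iff[OF unf_carrier]
        by (intro bexI[of _ P] bexI[of _ "N * cramer_inverse (D (Z t))"]) auto
      moreover have "lm k (h (Z t) (Z t)) (Z t) = Z t" if "trank (Z t) k \<le> q"
      proof (rule unf_inject[OF k])
        show "unf k (lm k (h (Z t) (Z t)) (Z t)) = unf k (Z t)"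
          unfolding unf_lm[OF k h] unfolding h_def D_def
          using that elim by (intro skeleton_identity[OF unf_carrier P N]) (auto simp: trank_eq_mat_rank D_def)
      qed
      ultimately show ?case by (simp add: q_def trank_eq_mat_rank)
    qed
  qed
  have "left_factor k L h" unfolding left_factor_def using h left cont ev by blast
  then show ?thesis by blast
qed

lemma left_factor_carrier: "left_factor k L h \<Longrightarrow> h Z v \<in> carrier_mat (n k) (n k)"
  by (simp add: left_factor_def)

lemma left_factor_lm:
  "left_factor k L h \<Longrightarrow> T \<in> carrier_mat (n k) (n k) \<Longrightarrow> h Z (lm k T v) = T * h Z v"
  by (simp add: left_factor_def)

lemma left_factor_tendsto:
  "left_factor k L h \<Longrightarrow> (Z :: nat \<Rightarrow> _) \<longlonglongrightarrow> L \<Longrightarrow> v \<longlonglongrightarrow> v0 \<Longrightarrow> x \<longlonglongrightarrow> x0 \<Longrightarrow>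
    (\<lambda>t. lm k (h (Z t) (v t)) (x t)) \<longlonglongrightarrow> lm k (h L v0) x0"
  unfolding left_factor_def by blast

lemma left_factor_eventually:
  "left_factor k L h \<Longrightarrow> (Z :: nat \<Rightarrow> _) \<longlonglongrightarrow> L \<Longrightarrow> \<forall>\<^sub>F t in sequentially. trank L k \<le> trank (Z t) k \<and>
        (trank (Z t) k \<le> trank L k \<longrightarrow> lm k (h (Z t) (Z t)) (Z t) = Z t)"
  unfolding left_factor_def by blast

lemma left_factor_self: "left_factor k L h \<Longrightarrow> lm k (h L L) L = L"
  using left_factor_eventually[of k L h "\<lambda>_. L"] by simp

lemma left_factor_left_multiple:
  assumes h: "left_factor k L h" and k: "k \<in> modes" and W: "W \<in> carrier_mat (n k) (n k)"
    and Z: "lm k (h Z Z) Z = Z"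
  shows "lm k (h Z (lm k W Z)) Z = lm k W Z"
  unfolding left_factor_lm[OF h W] lm_lm[OF k W left_factor_carrier[OF h], symmetric] Z ..

lemma trank_lower_semicontinuous:
  assumes "k \<in> modes" "(Z :: nat \<Rightarrow> _) \<longlonglongrightarrow> L"
  shows "\<forall>\<^sub>F t in sequentially. trank L k \<le> trank (Z t) k"
proof -
  obtain h where "left_factor k L h" using left_factor_exists[OF assms(1)] by blast
  from left_factor_eventually[OF this assms(2)] show ?thesis by eventually_elim simp
qed

text \<open>If the rank bound in mode \<open>k\<close> is attained at \<open>L\<close>, then a tangent vector vanishes after
  projecting out the span of the mode-\<open>k\<close> fibers of \<open>L\<close> on the left and the row space of its
  unfolding on the right. The points \<open>y j\<close> that define the tangent vector eventually have the same
  rank as \<open>L\<close>, so a left multiple \<open>u\<close> of \<open>y j\<close> is \<open>h (y j) u\<close> times \<open>y j\<close>. For the projection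
  \<open>R = 1 - h L L\<close>, which annihilates \<open>L\<close>, this applies to \<open>R (y j - L) / t j = R (y j) / t j\<close>, and
  the equation passes to the limit.\<close>
lemma tangent_cone_saturated_mode:
  assumes k: "k \<in> modes" and h: "left_factor k L h" and sat: "trank L k = r k"
    and v: "v \<in> tangent_cone (tucker_variety d n idx r) L"
  shows "v = lm k (h L L) v + (lm k (h L v) L - lm k (h L L) (lm k (h L v) L))"
proof -
  obtain y t where y: "\<And>j. y j \<in> tucker_variety d n idx r" and t: "\<And>j. 0 < t j"
    and yL: "y \<longlonglongrightarrow> L" and v: "(\<lambda>j. inverse (t j) *\<^sub>R (y j - L)) \<longlonglongrightarrow> v"
    using v unfolding tangent_cone_def by blast
  note hc = left_factor_carrier[OF h]
  define R where "R = 1\<^sub>m (n k) - h L L"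
  have R: "R \<in> carrier_mat (n k) (n k)" unfolding R_def by (intro minus_carrier_mat hc)
  have lmR: "lm k R x = x - lm k (h L L) x" for x
    unfolding R_def lm_minus_mat[OF k one_carrier_mat hc] lm_one[OF k] ..
  define u where "u = (\<lambda>j. lm k R (inverse (t j) *\<^sub>R (y j - L)))"
  have ulim: "u \<longlonglongrightarrow> lm k R v" unfolding u_def by (rule tendsto_lm[OF v])
  have "\<forall>\<^sub>F j in sequentially. lm k (h (y j) (u j)) (y j) = u j"
    using left_factor_eventually[OF h yL]
  proof eventually_elim
    case (elim j)
    have "trank (y j) k \<le> trank L k" using y[of j] sat k by (simp add: tucker_variety_def)
    then have yj: "lm k (h (y j) (y j)) (y j) = y j" using elim by blast
    define c where "c = inverse (t j) \<cdot>\<^sub>m 1\<^sub>m (n k)"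
    have c: "c \<in> carrier_mat (n k) (n k)" by (simp add: c_def)
    have cx: "inverse (t j) *\<^sub>R x = lm k c x" for x
    proof -
      have "lm k c x = of_entries idx (tprod k c (entries idx x))" by (simp add: lm_def)
      also have "\<dots> = of_entries idx (\<lambda>i. inverse (t j) * entries idx x i)"
      proof (rule of_entries_cong)
        fix i assume "i \<in> multi_indices d n"
        then have ik: "i k < n k" using multi_indices_less k by blast
        have "tprod k c (entries idx x) i = inverse (t j) * tprod k (1\<^sub>m (n k)) (entries idx x) i"
          using ik unfolding tprod_def sum_distrib_left by (intro sum.cong) (auto simp: c_def)
        then show "tprod k c (entries idx x) i = inverse (t j) * entries idx x i"
          using tprod_one[of i k "n k"] ik by simp
      qed
      also have "\<dots> = inverse (t j) *\<^sub>R x"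
        by (simp add: of_entries_def entries_def inv_idx Finite_Cartesian_Product.vec_eq_iff)
      finally show ?thesis ..
    qed
    have "u j = inverse (t j) *\<^sub>R (lm k R (y j) - lm k R L)"
      unfolding u_def by (simp add: lm_scaleR lm_diff)
    also have "lm k R L = 0" unfolding lmR left_factor_self[OF h] by simp
    finally have "u j = lm k (c * R) (y j)" by (simp add: cx lm_lm[OF k c R])
    then show ?case
      using left_factor_left_multiple[OF h k _ yj, of "c * R"] c R by simp
  qed
  with left_factor_tendsto[OF h yL ulim yL] have "u \<longlonglongrightarrow> lm k (h L (lm k R v)) L"
    by (rule Lim_transform_eventually)
  then have "lm k R v = lm k (h L (lm k R v)) L" using ulim LIMSEQ_unique by blast
  also have "\<dots> = lm k R (lm k (h L v) L)"
    unfolding left_factor_lm[OF h R] lm_lm[OF k R hc] ..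
  finally show ?thesis unfolding lmR by (simp add: algebra_simps)
qed


section \<open>Orthogonal splitting of the approximate projection\<close>

lemma lms_lms:
  assumes "finite K" "K \<subseteq> modes" "\<And>k. k \<in> K \<Longrightarrow> P k \<in> carrier_mat (n k) (n k)"
    "\<And>k. k \<in> K \<Longrightarrow> Q k \<in> carrier_mat (n k) (n k)"
  shows "lms K P (lms K Q x) = lms K (\<lambda>k. P k * Q k) x"
  using assms
proof (induction K rule: finite_induct)
  case (insert k K)
  have k: "k \<in> modes" "P k \<in> carrier_mat (n k) (n k)" "Q k \<in> carrier_mat (n k) (n k)"
    "P k * Q k \<in> carrier_mat (n k) (n k)"
    using insert.prems(1) insert.prems(2)[of k] insert.prems(3)[of k] by auto
  have "lms (insert k K) P (lms (insert k K) Q x) = lm k (P k) (lms K P (lm k (Q k) (lms K Q x)))"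
    using insert.hyps k by (simp add: lms_insert)
  also have "lms K P (lm k (Q k) (lms K Q x)) = lm k (Q k) (lms K P (lms K Q x))"
    using insert.prems insert.hyps k by (intro lms_lm) auto
  also have "lms K P (lms K Q x) = lms K (\<lambda>k. P k * Q k) x"
    using insert.prems by (intro insert.IH) auto
  also have "lm k (P k) (lm k (Q k) (lms K (\<lambda>k. P k * Q k) x)) = lms (insert k K) (\<lambda>k. P k * Q k) x"
    using insert.hyps k by (simp add: lms_insert lm_lm)
  finally show ?case .
qed simp

lemma lms_cong:
  assumes "finite K" "\<And>k. k \<in> K \<Longrightarrow> P k = Q k"
  shows "lms K P x = lms K Q x"
  unfolding lms_def using tprods_matrix_cong[of K P Q] assms by metis

text \<open>The parts \<open>C\<close> and \<open>E k\<close> of an approximate projection of \<open>A\<close> at \<open>Z\<close>, detached from the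
  chosen Tucker decomposition.\<close>
definition tangent_split ::
  "(nat \<Rightarrow> nat) \<Rightarrow> real ^ 'm \<Rightarrow> real ^ 'm \<Rightarrow> real ^ 'm \<Rightarrow> (nat \<Rightarrow> real ^ 'm) \<Rightarrow> bool" where
  "tangent_split r Z A C E \<longleftrightarrow> (\<exists>U S.
     (\<forall>k\<in>modes. U k \<in> stiefel (trank Z k) (n k) \<and> S k \<in> stiefel (r k) (n k) \<and>
        (trank Z k = r k \<longrightarrow> S k = U k) \<and>
        lm k (proj_mat (U k)) Z = Z \<and> lm k (proj_mat (S k)) Z = Z \<and>
        (\<exists>W \<in> carrier_mat (n k) (n k). E k = lm k W Z) \<and>
        lm k (proj_mat (S k)) (E k) = 0 \<and>
        (\<forall>C\<in>carrier_mat (n k) (n k).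
           inner (E k) (lm k C Z) = inner A (lm k C Z - lm k (proj_mat (S k)) (lm k C Z)))) \<and>
     C = lms modes (\<lambda>k. proj_mat (S k)) A \<and>
     norm (lms {k\<in>modes. trank Z k = r k} (\<lambda>k. proj_mat (U k)) A) *
       (\<Prod>k\<in>{k\<in>modes. trank Z k < r k}. sqrt (real (r k - trank Z k) / real (min (n k) (codim d n k))))
       \<le> norm C)"

lemma approx_proj_tangent_split:
  assumes "Z \<in> tucker_variety d n idx r" "V \<in> approx_proj d n idx r Z A"
  shows "\<exists>C E. V = C + (\<Sum>k\<in>modes. E k) \<and> tangent_split r Z A C E"
proof (rule approx_projE[OF assms], goal_cases)
  case (1 U S E)
  note f = 1
  show ?case
    unfolding tangent_split_def
  proof (rule exI[of _ "lms modes (\<lambda>k. proj_mat (S k)) A"], rule exI[of _ E], rule conjI[OF f(6)],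
      rule exI[of _ U], rule exI[of _ S], intro conjI ballI)
    fix k assume k: "k \<in> modes"
    show "trank Z k = r k \<longrightarrow> S k = U k" using f(3)[OF k] by blast
    show "\<exists>W\<in>carrier_mat (n k) (n k). E k = lm k W Z" using f(8)[OF k] .
  qed (use f in blast)+
qed

lemma lm_proj_symmetric:
  assumes "k \<in> modes" "S \<in> stiefel q (n k)"
  shows "inner (lm k (proj_mat S) x) y = inner x (lm k (proj_mat S) y)"
  using lm_adjoint[OF assms(1) proj_mat_carrier[OF stiefel_carrier[OF assms(2)]]]
    proj_mat_transpose[OF stiefel_carrier[OF assms(2)]] by simp

lemma lm_proj_idem:
  assumes "k \<in> modes" "S \<in> stiefel q (n k)"
  shows "lm k (proj_mat S) (lm k (proj_mat S) x) = lm k (proj_mat S) x"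
  using lm_lm[OF assms(1)] proj_mat_carrier[OF stiefel_carrier[OF assms(2)]] proj_mat_idem[OF assms(2)]
  by simp

lemma norm_lm_proj_le:
  assumes "k \<in> modes" "S \<in> stiefel q (n k)"
  shows "norm (lm k (proj_mat S) x) \<le> norm x"
proof -
  let ?y = "lm k (proj_mat S) x"
  have "inner ?y ?y = inner x ?y" unfolding lm_proj_symmetric[OF assms] lm_proj_idem[OF assms] ..
  then have "norm ?y * norm ?y \<le> norm x * norm ?y"
    using norm_cauchy_schwarz[of x ?y] by (simp add: power2_norm_eq_inner[symmetric] power2_eq_square)
  then show ?thesis by (cases "norm ?y = 0") (auto simp: mult_le_cancel_right)
qed

lemma lms_proj_symmetric:
  assumes "K \<subseteq> modes" "\<And>k. k \<in> K \<Longrightarrow> S k \<in> stiefel (q k) (n k)"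
  shows "inner (lms K (\<lambda>k. proj_mat (S k)) x) y = inner x (lms K (\<lambda>k. proj_mat (S k)) y)"
proof -
  have K: "finite K" using assms(1) finite_subset by blast
  have "inner (lms K (\<lambda>k. proj_mat (S k)) x) y = inner x (lms K (\<lambda>k. (proj_mat (S k))\<^sup>T) y)"
    using assms by (intro lms_adjoint K) (auto intro: proj_mat_carrier stiefel_carrier)
  also have "lms K (\<lambda>k. (proj_mat (S k))\<^sup>T) y = lms K (\<lambda>k. proj_mat (S k)) y"
    using assms by (intro lms_cong K) (auto intro: proj_mat_transpose stiefel_carrier)
  finally show ?thesis .
qed

lemma lms_proj_idem:
  assumes "K \<subseteq> modes" "\<And>k. k \<in> K \<Longrightarrow> S k \<in> stiefel (q k) (n k)"
  shows "lms K (\<lambda>k. proj_mat (S k)) (lms K (\<lambda>k. proj_mat (S k)) x) = lms K (\<lambda>k. proj_mat (S k)) x"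
proof -
  have K: "finite K" using assms(1) finite_subset by blast
  have "lms K (\<lambda>k. proj_mat (S k)) (lms K (\<lambda>k. proj_mat (S k)) x)
      = lms K (\<lambda>k. proj_mat (S k) * proj_mat (S k)) x"
    using assms by (intro lms_lms K) (auto intro: proj_mat_carrier stiefel_carrier)
  also have "\<dots> = lms K (\<lambda>k. proj_mat (S k)) x"
    using assms by (intro lms_cong K) (auto intro: proj_mat_idem)
  finally show ?thesis .
qed

text \<open>Since the factors commute, any of them can be moved to the front, where it is idempotent.\<close>
lemma lm_proj_lms:
  assumes "k \<in> modes" "\<And>k. k \<in> modes \<Longrightarrow> S k \<in> stiefel (q k) (n k)"
  shows "lm k (proj_mat (S k)) (lms modes (\<lambda>k. proj_mat (S k)) x) = lms modes (\<lambda>k. proj_mat (S k)) x"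
proof -
  have "lms (insert k (modes - {k})) (\<lambda>k. proj_mat (S k)) x
      = lm k (proj_mat (S k)) (lms (modes - {k}) (\<lambda>k. proj_mat (S k)) x)"
    using assms proj_mat_carrier[OF stiefel_carrier[OF assms(2)[OF assms(1)]]] by (intro lms_insert) auto
  moreover have "insert k (modes - {k}) = modes" using assms(1) by auto
  ultimately show ?thesis using lm_proj_idem[OF assms(1) assms(2)[OF assms(1)]] by simp
qed

lemma tangent_split_inner_parts:
  assumes "tangent_split r Z A C E"
  shows "inner A C = (norm C)\<^sup>2" and "k \<in> modes \<Longrightarrow> inner A (E k) = (norm (E k))\<^sup>2"
proof -
  obtain U S where S: "\<And>k. k \<in> modes \<Longrightarrow> S k \<in> stiefel (r k) (n k)"
    and C: "C = lms modes (\<lambda>k. proj_mat (S k)) A"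
    and E: "\<And>k. k \<in> modes \<Longrightarrow> \<exists>W \<in> carrier_mat (n k) (n k). E k = lm k W Z"
      "\<And>k. k \<in> modes \<Longrightarrow> lm k (proj_mat (S k)) (E k) = 0"
      "\<And>k C. k \<in> modes \<Longrightarrow> C \<in> carrier_mat (n k) (n k) \<Longrightarrow>
           inner (E k) (lm k C Z) = inner A (lm k C Z - lm k (proj_mat (S k)) (lm k C Z))"
    using assms unfolding tangent_split_def by blast
  have "inner C C = inner A C"
    unfolding C using lms_proj_symmetric[of modes S r] lms_proj_idem[of modes S r] S by simp
  then show "inner A C = (norm C)\<^sup>2" by (simp add: power2_norm_eq_inner)
  assume k: "k \<in> modes"
  obtain W where W: "W \<in> carrier_mat (n k) (n k)" "E k = lm k W Z" using E(1)[OF k] by blast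
  show "inner A (E k) = (norm (E k))\<^sup>2"
    using E(3)[OF k W(1)] E(2)[OF k] unfolding W(2)[symmetric] by (simp add: power2_norm_eq_inner)
qed

text \<open>Each part is the image of \<open>A\<close> under an orthogonal projection, so its inner product with \<open>A\<close>
  is its squared norm. For bounded \<open>A\<close>, the approximate projection can therefore only become small
  together with all its parts.\<close>
lemma tangent_split_inner:
  assumes "tangent_split r Z A C E"
  shows "inner A (C + (\<Sum>k\<in>modes. E k)) = (norm C)\<^sup>2 + (\<Sum>k\<in>modes. (norm (E k))\<^sup>2)"
  using tangent_split_inner_parts[OF assms] by (simp add: inner_add_right inner_sum_right)

lemma tangent_split_norm_le:
  assumes "tangent_split r Z A C E"
  shows "norm C \<le> norm A" and "k \<in> modes \<Longrightarrow> norm (E k) \<le> norm A"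
proof -
  have *: "norm x \<le> norm A" if "inner A x = (norm x)\<^sup>2" for x
    using that norm_cauchy_schwarz[of A x] by (cases "norm x = 0") (auto simp: power2_eq_square)
  show "norm C \<le> norm A" by (rule *[OF tangent_split_inner_parts(1)[OF assms]])
  show "norm (E k) \<le> norm A" if "k \<in> modes"
    by (rule *[OF tangent_split_inner_parts(2)[OF assms that]])
qed

section \<open>Vanishing approximate projections in the limit\<close>

text \<open>If the antigradient makes no acute angle with any tangent vector, then \<open>0\<close> is its only nearest
  point in the tangent cone.\<close>
lemma stationaryI:
  assumes X: "X \<in> tucker_variety d n idx r"
    and le: "\<And>v. v \<in> tangent_cone (tucker_variety d n idx r) X \<Longrightarrow> inner (- g X) v \<le> 0"
  shows "stationary d n idx r g X"
proof -
  let ?T = "tangent_cone (tucker_variety d n idx r) X"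
  have zero: "0 \<in> ?T"
    unfolding tangent_cone_def
  proof (intro CollectI exI conjI allI)
    show "(\<lambda>j. inverse (real (Suc j))) \<longlonglongrightarrow> 0" by (rule LIMSEQ_inverse_real_of_nat)
    show "(\<lambda>j. X) \<longlonglongrightarrow> X" by simp
    show "(\<lambda>j. inverse (inverse (real (Suc j))) *\<^sub>R (X - X)) \<longlonglongrightarrow> 0" by simp
  qed (use X in auto)
  have sq: "(dist (- g X) v)\<^sup>2 = (norm (g X))\<^sup>2 - 2 * inner (- g X) v + (norm v)\<^sup>2" for v
    by (simp add: dist_norm power2_norm_eq_inner inner_diff_left inner_diff_right inner_add_left
        inner_add_right inner_commute)
  have "dist (- g X) 0 \<le> dist (- g X) w" if "w \<in> ?T" for w
  proof (rule power2_le_imp_le)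
    show "(dist (- g X) 0)\<^sup>2 \<le> (dist (- g X) w)\<^sup>2"
      unfolding sq[of w] sq[of 0] using le[OF that] by simp
  qed simp
  then have "0 \<in> metric_proj ?T (- g X)" using zero by (simp add: metric_proj_def)
  moreover have "v = 0" if v: "v \<in> metric_proj ?T (- g X)" for v
  proof -
    have vT: "v \<in> ?T" and "dist (- g X) v \<le> dist (- g X) 0"
      using v zero by (auto simp: metric_proj_def)
    then have "(dist (- g X) v)\<^sup>2 \<le> (norm (g X))\<^sup>2" by (intro power_mono) auto
    then have "(norm v)\<^sup>2 \<le> 0" using sq[of v] le[OF vT] by linarith
    then show ?thesis using power2_less_eq_zero_iff norm_eq_zero by blast
  qed
  ultimately have "metric_proj ?T (- g X) = {0}" by blast
  then show ?thesis using X by (simp add: stationary_def)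
qed

lemma left_factors_exist: "\<exists>h. \<forall>k\<in>modes. left_factor k L (h k)"
  by (rule bchoice) (use left_factor_exists in blast)

lemma lms_tendsto:
  assumes "finite K" "K \<subseteq> modes" "\<And>t k. k \<in> K \<Longrightarrow> M t k \<in> carrier_mat (n k) (n k)"
    "\<And>k. k \<in> K \<Longrightarrow> M0 k \<in> carrier_mat (n k) (n k)"
    and "\<And>k x x0. k \<in> K \<Longrightarrow> x \<longlonglongrightarrow> x0 \<Longrightarrow> (\<lambda>t. lm k (M t k) (x t)) \<longlonglongrightarrow> lm k (M0 k) x0"
  shows "(\<lambda>t. lms K (M t) v) \<longlonglongrightarrow> lms K M0 v"
  using assms by (induction K rule: finite_induct) (simp_all add: lms_insert)

text \<open>Peeling off one saturated mode after the other splits a tangent vector at \<open>L\<close> into a part in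
  the product of the fiber spaces of the saturated modes and left multiples of \<open>L\<close>.\<close>
lemma tangent_vector_splitting:
  assumes h: "\<And>k. k \<in> modes \<Longrightarrow> left_factor k L (h k)"
    and K: "finite K" "K \<subseteq> modes"
    and v: "\<And>k. k \<in> K \<Longrightarrow>
      v = lm k (h k L L) v + (lm k (h k L v) L - lm k (h k L L) (lm k (h k L v) L))"
  shows "v = lms K (\<lambda>k. h k L L) v
      + (\<Sum>k\<in>K. lm k (h k L v) L - lm k (h k L L) (lm k (h k L v) L))"
  using K v
proof (induction K rule: finite_induct)
  case (insert k K)
  let ?\<Lambda> = "\<lambda>k. h k L L"
  have k: "k \<in> modes" using insert.prems by simp
  have hc: "h j L w \<in> carrier_mat (n j) (n j)" if "j \<in> modes" for j w
    using left_factor_carrier[OF h[OF that]] .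
  let ?y = "lm k (h k L v) L - lm k (?\<Lambda> k) (lm k (h k L v) L)"
  have comm: "lms K ?\<Lambda> (lm k B x) = lm k B (lms K ?\<Lambda> x)" if "B \<in> carrier_mat (n k) (n k)" for B x
    using insert.prems(1) insert.hyps k that hc by (intro lms_lm) auto
  have LK: "lms K ?\<Lambda> L = L"
    using insert.prems(1) hc left_factor_self[OF h] by (intro lms_fixed insert.hyps) auto
  have "lms K ?\<Lambda> ?y = ?y"
    unfolding linear_diff[OF linear_lms] by (simp add: comm hc[OF k] LK)
  moreover have "lms K ?\<Lambda> v = lms K ?\<Lambda> (lm k (?\<Lambda> k) v) + lms K ?\<Lambda> ?y"
    using insert.prems(2)[of k] linear_add[OF linear_lms, of K ?\<Lambda> "lm k (?\<Lambda> k) v" ?y] by simp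
  ultimately have step: "lms K ?\<Lambda> v = lms (insert k K) ?\<Lambda> v + ?y"
    using insert.hyps k hc by (simp add: comm lms_insert)
  have IH: "v = lms K ?\<Lambda> v
      + (\<Sum>k\<in>K. lm k (h k L v) L - lm k (h k L L) (lm k (h k L v) L))"
    using insert.prems by (intro insert.IH) auto
  have sum: "(\<Sum>k\<in>insert k K. lm k (h k L v) L - lm k (h k L L) (lm k (h k L v) L))
      = ?y + (\<Sum>k\<in>K. lm k (h k L v) L - lm k (h k L L) (lm k (h k L v) L))"
    using insert.hyps by simp
  note IH
  also have "lms K ?\<Lambda> v + (\<Sum>k\<in>K. lm k (h k L v) L - lm k (h k L L) (lm k (h k L v) L))
      = lms (insert k K) ?\<Lambda> v + (?y + (\<Sum>k\<in>K. lm k (h k L v) L - lm k (h k L L) (lm k (h k L v) L)))"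
    by (simp only: step add.assoc)
  finally show ?case by (simp only: sum)
qed simp

text \<open>A tangent vector at the limit \<open>L\<close> is approximated by vectors at the points \<open>Z t\<close> that are
  split in the same way. Against them \<open>A t\<close> only sees its projection to the fiber spaces of the
  saturated modes, which the norm condition on the complementary bases bounds by \<open>C t\<close>, and the
  parts \<open>E t k\<close> in the saturated modes.\<close>
lemma vanishing_split_imp_orthogonal_to_tangent_cone:
  assumes r: "\<And>k. k \<in> modes \<Longrightarrow> r k \<ge> 1 \<and> r k \<le> min (n k) (codim d n k)"
    and ZL: "(Z :: nat \<Rightarrow> _) \<longlonglongrightarrow> L" and rank: "\<And>t k. k \<in> modes \<Longrightarrow> trank (Z t) k = trank L k"
    and A: "A \<longlonglongrightarrow> A0" and split: "\<And>t. tangent_split r (Z t) (A t) (C t) (E t)"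
    and C: "C \<longlonglongrightarrow> 0" and E: "\<And>k. k \<in> modes \<Longrightarrow> (\<lambda>t. E t k) \<longlonglongrightarrow> 0"
    and v: "v \<in> tangent_cone (tucker_variety d n idx r) L"
  shows "inner A0 v = 0"
proof -
  define J where "J = {k\<in>modes. trank L k = r k}"
  have J: "finite J" "J \<subseteq> modes" by (auto simp: J_def)
  obtain h where h: "\<And>k. k \<in> modes \<Longrightarrow> left_factor k L (h k)" using left_factors_exist by blast
  have hc: "h k Y w \<in> carrier_mat (n k) (n k)" if "k \<in> modes" for k Y w
    using left_factor_carrier[OF h[OF that]] .
  define c where "c = (\<Prod>k\<in>{k\<in>modes. trank L k < r k}.
      sqrt (real (r k - trank L k) / real (min (n k) (codim d n k))))"
  have "c > 0" unfolding c_def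
  proof (intro prod_pos ballI)
    fix k assume k: "k \<in> {k\<in>modes. trank L k < r k}"
    then have "0 < real (r k - trank L k)" "0 < real (min (n k) (codim d n k))"
      using r[of k] by auto
    then show "0 < sqrt (real (r k - trank L k) / real (min (n k) (codim d n k)))"
      by (intro real_sqrt_gt_zero divide_pos_pos)
  qed
  define US where "US = (\<lambda>t (U, S).
     (\<forall>k\<in>modes. U k \<in> stiefel (trank L k) (n k) \<and> S k \<in> stiefel (r k) (n k) \<and>
        (trank L k = r k \<longrightarrow> S k = U k) \<and>
        lm k (proj_mat (U k)) (Z t) = Z t \<and>
        (\<forall>D\<in>carrier_mat (n k) (n k). inner (E t k) (lm k D (Z t))
          = inner (A t) (lm k D (Z t) - lm k (proj_mat (S k)) (lm k D (Z t))))) \<and>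
     norm (lms J (\<lambda>k. proj_mat (U k)) (A t)) * c \<le> norm (C t))"
  have "\<exists>p. US t p" for t
  proof -
    have sets: "{k\<in>modes. trank (Z t) k = r k} = J"
      "{k\<in>modes. trank (Z t) k < r k} = {k\<in>modes. trank L k < r k}"
      using rank by (auto simp: J_def)
    have prod: "(\<Prod>k\<in>{k\<in>modes. trank L k < r k}.
        sqrt (real (r k - trank (Z t) k) / real (min (n k) (codim d n k)))) = c"
      unfolding c_def using rank by (intro prod.cong) auto
    show ?thesis
      using split[of t, unfolded tangent_split_def sets prod]
    proof (elim exE conjE, goal_cases)
      case (1 U S)
      have "US t (U, S)"
        unfolding US_def prod.case
      proof (intro conjI ballI)
        fix k assume k: "k \<in> modes"
        note k1 = 1(1)[rule_format, OF k, unfolded rank[OF k]]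
        show "U k \<in> stiefel (trank L k) (n k)" using k1 by (elim conjE)
        show "S k \<in> stiefel (r k) (n k)" using k1 by (elim conjE)
        show "trank L k = r k \<longrightarrow> S k = U k" using k1 by (elim conjE)
        show "lm k (proj_mat (U k)) (Z t) = Z t" using k1 by (elim conjE)
        fix D :: "real mat" assume "D \<in> carrier_mat (n k) (n k)"
        then show "inner (E t k) (lm k D (Z t))
          = inner (A t) (lm k D (Z t) - lm k (proj_mat (S k)) (lm k D (Z t)))"
          using k1 by blast
      qed (rule 1(3))
      then show ?case by blast
    qed
  qed
  then obtain p where p: "\<And>t. US t (p t)" by metis
  define U S where "U = (\<lambda>t. fst (p t))" and "S = (\<lambda>t. snd (p t))"
  have US: "US t (U t, S t)" for t using p[of t] by (simp add: U_def S_def)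
  have U: "U t k \<in> stiefel (trank L k) (n k)" and SU: "trank L k = r k \<Longrightarrow> S t k = U t k"
    and UZ: "lm k (proj_mat (U t k)) (Z t) = Z t"
    and Ein: "\<And>D. D \<in> carrier_mat (n k) (n k) \<Longrightarrow> inner (E t k) (lm k D (Z t))
          = inner (A t) (lm k D (Z t) - lm k (proj_mat (S t k)) (lm k D (Z t)))"
    if "k \<in> modes" for t k
    using US[of t] that unfolding US_def by auto
  have cB: "norm (lms J (\<lambda>k. proj_mat (U t k)) (A t)) * c \<le> norm (C t)" for t
    using US[of t] unfolding US_def by auto
  note Pc = proj_mat_carrier[OF stiefel_carrier[OF U]]
  define B where "B = (\<lambda>t. lms J (\<lambda>k. proj_mat (U t k)) (A t))"
  have B: "B \<longlonglongrightarrow> 0"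
  proof (rule Lim_null_comparison)
    show "\<forall>\<^sub>F t in sequentially. norm (B t) \<le> norm (C t) / c"
      using cB \<open>c > 0\<close> by (auto simp: B_def pos_le_divide_eq)
    show "(\<lambda>t. norm (C t) / c) \<longlonglongrightarrow> 0"
      using tendsto_divide[OF tendsto_norm[OF C] tendsto_const[of c]] \<open>c > 0\<close> by simp
  qed
  have Bsym: "inner (A t) (lms J (\<lambda>k. proj_mat (U t k)) x) = inner (B t) x" for t x
    unfolding B_def using lms_proj_symmetric[of J "U t" "trank L"] U J by (metis subsetD)

  define \<Lambda> where "\<Lambda> = (\<lambda>t k. h k (Z t) (Z t))"
  \<comment> \<open>the parts of the splitting of \<open>v\<close>, transported from \<open>L\<close> to \<open>Z t\<close>\<close>
  define w where "w = (\<lambda>t. lms J (\<Lambda> t) v)"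
  define Y where "Y = (\<lambda>t k. h k (Z t) v - \<Lambda> t k * h k (Z t) v)"
  define y where "y = (\<lambda>t k. lm k (Y t k) (Z t))"
  have Yc: "Y t k \<in> carrier_mat (n k) (n k)" if "k \<in> modes" for t k
    unfolding Y_def \<Lambda>_def by (rule minus_carrier_mat[OF mult_carrier_mat[OF hc hc]]) (rule that)+
  have yeq: "y t k = lm k (h k (Z t) v) (Z t) - lm k (\<Lambda> t k) (lm k (h k (Z t) v) (Z t))"
    if k: "k \<in> modes" for t k
    unfolding y_def Y_def \<Lambda>_def lm_minus_mat[OF k hc[OF k] mult_carrier_mat[OF hc[OF k] hc[OF k]]]
      lm_lm[OF k hc[OF k] hc[OF k]] ..
  have wlim: "w \<longlonglongrightarrow> lms J (\<lambda>k. h k L L) v"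
    unfolding w_def \<Lambda>_def
  proof (rule lms_tendsto[OF J])
    fix k and x :: "nat \<Rightarrow> real ^ 'm" and x0 assume k: "k \<in> J" and x: "x \<longlonglongrightarrow> x0"
    show "(\<lambda>t. lm k (h k (Z t) (Z t)) (x t)) \<longlonglongrightarrow> lm k (h k L L) x0"
      using left_factor_tendsto[OF h ZL ZL x] k J by blast
  qed (use hc J in auto)
  have ylim: "(\<lambda>t. y t k) \<longlonglongrightarrow> lm k (h k L v) L - lm k (h k L L) (lm k (h k L v) L)"
    if k: "k \<in> modes" for k
  proof -
    have 1: "(\<lambda>t. lm k (h k (Z t) v) (Z t)) \<longlonglongrightarrow> lm k (h k L v) L"
      using left_factor_tendsto[OF h[OF k] ZL tendsto_const ZL] .
    show ?thesis unfolding yeq[OF k] \<Lambda>_def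
      by (intro tendsto_diff 1 left_factor_tendsto[OF h[OF k] ZL ZL 1])
  qed
  have "v = lms J (\<lambda>k. h k L L) v + (\<Sum>k\<in>J. lm k (h k L v) L - lm k (h k L L) (lm k (h k L v) L))"
    using J tangent_cone_saturated_mode[OF _ h _ v]
    by (intro tangent_vector_splitting h) (auto simp: J_def)
  moreover have "(\<lambda>t. w t + (\<Sum>k\<in>J. y t k)) \<longlonglongrightarrow>
      lms J (\<lambda>k. h k L L) v + (\<Sum>k\<in>J. lm k (h k L v) L - lm k (h k L L) (lm k (h k L v) L))"
    using J by (intro tendsto_add wlim tendsto_sum ylim) auto
  ultimately have vlim: "(\<lambda>t. w t + (\<Sum>k\<in>J. y t k)) \<longlonglongrightarrow> v" by simp

  have "(\<lambda>t. inner (A t) (w t)) \<longlonglongrightarrow> 0"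
  proof -
    have "lms J (\<lambda>k. proj_mat (U t k)) (w t) = w t" for t
    proof -
      have "lms J (\<lambda>k. proj_mat (U t k)) (w t) = lms J (\<lambda>k. proj_mat (U t k) * \<Lambda> t k) v"
        unfolding w_def using J Pc hc by (intro lms_lms) (auto simp: \<Lambda>_def)
      also have "\<dots> = w t"
        unfolding w_def
      proof (rule lms_cong[OF J(1)])
        fix k assume "k \<in> J"
        then have k: "k \<in> modes" using J by blast
        show "proj_mat (U t k) * \<Lambda> t k = \<Lambda> t k"
          unfolding \<Lambda>_def left_factor_lm[OF h[OF k] Pc[OF k], symmetric] UZ[OF k] ..
      qed
      finally show ?thesis .
    qed
    then have "inner (A t) (w t) = inner (B t) (w t)" for t using Bsym[of t "w t"] by simp
    then show ?thesis using tendsto_inner[OF B wlim] by simp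
  qed
  moreover have "(\<lambda>t. inner (A t) (y t k)) \<longlonglongrightarrow> 0" if kJ: "k \<in> J" for k
  proof -
    have k: "k \<in> modes" "trank L k = r k" using kJ by (auto simp: J_def)
    define z where "z = (\<lambda>t. lm k (proj_mat (U t k)) (y t k))"
    have "lms J (\<lambda>k. proj_mat (U t k)) (z t) = z t" for t
    proof (rule lms_fixed[OF J])
      fix j assume jJ: "j \<in> J"
      then have j: "j \<in> modes" using J by blast
      show "proj_mat (U t j) \<in> carrier_mat (n j) (n j)" by (rule Pc[OF j])
      show "lm j (proj_mat (U t j)) (z t) = z t"
      proof (cases "j = k")
        case True
        then show ?thesis unfolding z_def using lm_proj_idem[OF k(1) U[OF k(1)]] by simp
      next
        case False
        show ?thesis
          unfolding z_def y_def
          by (simp add: lm_commute[OF j k(1) False Pc[OF j] Pc[OF k(1)]]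
              lm_commute[OF j k(1) False Pc[OF j] Yc[OF k(1)]] UZ[OF j])
      qed
    qed
    then have "inner (A t) (z t) = inner (B t) (z t)" for t using Bsym[of t "z t"] by simp
    moreover have "inner (A t) (y t k) = inner (E t k) (y t k) + inner (A t) (z t)" for t
      using Ein[OF k(1) Yc[OF k(1)]] SU[OF k(1) k(2)]
      by (simp add: y_def z_def inner_diff_right)
    ultimately have eq: "inner (A t) (y t k) = inner (E t k) (y t k) + inner (B t) (z t)" for t by simp
    have "(\<lambda>t. inner (B t) (z t)) \<longlonglongrightarrow> 0"
    proof (rule Lim_null_comparison)
      show "\<forall>\<^sub>F t in sequentially. norm (inner (B t) (z t)) \<le> norm (B t) * norm (y t k)"
      proof (rule always_eventually, rule allI)
        fix t
        have "norm (inner (B t) (z t)) \<le> norm (B t) * norm (z t)"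
          using Cauchy_Schwarz_ineq2[of "B t" "z t"] by simp
        also have "\<dots> \<le> norm (B t) * norm (y t k)"
          unfolding z_def by (intro mult_left_mono norm_lm_proj_le[OF k(1) U[OF k(1)]]) auto
        finally show "norm (inner (B t) (z t)) \<le> norm (B t) * norm (y t k)" .
      qed
      show "(\<lambda>t. norm (B t) * norm (y t k)) \<longlonglongrightarrow> 0"
        using tendsto_mult[OF tendsto_norm[OF B] tendsto_norm[OF ylim[OF k(1)]]] by simp
    qed
    then show ?thesis
      unfolding eq using tendsto_add[OF tendsto_inner[OF E[OF k(1)] ylim[OF k(1)]]] by force
  qed
  ultimately have "(\<lambda>t. inner (A t) (w t) + (\<Sum>k\<in>J. inner (A t) (y t k))) \<longlonglongrightarrow> 0 + (\<Sum>k\<in>J. 0)"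
    by (intro tendsto_add tendsto_sum)
  then have "(\<lambda>t. inner (A t) (w t + (\<Sum>k\<in>J. y t k))) \<longlonglongrightarrow> 0"
    by (simp add: inner_add_right inner_sum_right)
  then show "inner A0 v = 0" using tendsto_inner[OF A vlim] LIMSEQ_unique by blast
qed

section \<open>The truncated HOSVD along approximate projections\<close>

text \<open>Multiplying \<open>Z + s C\<close> by \<open>1 + s h (E k)\<close> in all modes gives tensors of admissible rank that
  agree with \<open>Z + s V\<close> up to \<open>o(s)\<close>, and the HOSVD is at most a constant factor worse. So the
  HOSVD is a retraction along the approximate projections, uniformly for base points \<open>Z t\<close> whose
  Tucker rank is that of their limit.\<close>
lemma hosvd_retraction_limit:
  assumes ZL: "(Z :: nat \<Rightarrow> _) \<longlonglongrightarrow> L" and rank: "\<And>t k. k \<in> modes \<Longrightarrow> trank (Z t) k = trank L k"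
    and L: "L \<in> tucker_variety d n idx r"
    and split: "\<And>t. tangent_split r (Z t) (A t) (C t) (E t)"
    and C: "C \<longlonglongrightarrow> C0" and E: "\<And>k. k \<in> modes \<Longrightarrow> (\<lambda>t. E t k) \<longlonglongrightarrow> E0 k"
    and s: "\<And>t. 0 < s t" "s \<longlonglongrightarrow> 0"
    and Y: "\<And>t. Y t \<in> hosvd d n idx r (Z t + s t *\<^sub>R (C t + (\<Sum>k\<in>modes. E t k)))"
  shows "(\<lambda>t. inverse (s t) *\<^sub>R (Y t - Z t)) \<longlonglongrightarrow> C0 + (\<Sum>k\<in>modes. E0 k)"
proof -
  obtain h where h: "\<And>k. k \<in> modes \<Longrightarrow> left_factor k L (h k)" using left_factors_exist by blast
  note hc = left_factor_carrier[OF h]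
  have E0: "E0 k = lm k (h k L (E0 k)) L" if k: "k \<in> modes" for k
  proof -
    have "\<forall>\<^sub>F t in sequentially. lm k (h k (Z t) (E t k)) (Z t) = E t k"
      using left_factor_eventually[OF h[OF k] ZL]
    proof eventually_elim
      case (elim t)
      obtain W where "W \<in> carrier_mat (n k) (n k)" "E t k = lm k W (Z t)"
        using split[of t] k unfolding tangent_split_def by blast
      then show ?case using left_factor_left_multiple[OF h[OF k] k] elim rank[OF k] by simp
    qed
    with left_factor_tendsto[OF h[OF k] ZL E[OF k] ZL]
    have "(\<lambda>t. E t k) \<longlonglongrightarrow> lm k (h k L (E0 k)) L" by (rule Lim_transform_eventually)
    then show ?thesis using E[OF k] LIMSEQ_unique by blast
  qed
  have Lr: "trank L k \<le> r k" if "k \<in> modes" for k using L that by (simp add: tucker_variety_def)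
  have tends: "T \<longlonglongrightarrow> L" if "(\<lambda>t. inverse (s t) *\<^sub>R (T t - Z t)) \<longlonglongrightarrow> l" for T and l :: "real ^ 'm"
  proof -
    have "(\<lambda>t. Z t + s t *\<^sub>R (inverse (s t) *\<^sub>R (T t - Z t))) \<longlonglongrightarrow> L + 0 *\<^sub>R l"
      by (intro tendsto_intros ZL s that)
    moreover have "Z t + s t *\<^sub>R (inverse (s t) *\<^sub>R (T t - Z t)) = T t" for t
      using s(1)[of t] by simp
    ultimately show ?thesis by simp
  qed
  have "\<exists>T. (\<forall>t. \<forall>j\<in>modes. trank (T t) j \<le> r j) \<and>
      (\<lambda>t. inverse (s t) *\<^sub>R (T t - Z t)) \<longlonglongrightarrow> C0 + (\<Sum>k\<in>K. E0 k)"
    if "finite K" "K \<subseteq> modes" for K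
    using that
  proof (induction K rule: finite_induct)
    case empty
    show ?case
    proof (intro exI[of _ "\<lambda>t. Z t + s t *\<^sub>R C t"] conjI allI ballI)
      fix t j assume j: "j \<in> modes"
      obtain U S where S: "\<And>k. k \<in> modes \<Longrightarrow> S k \<in> stiefel (r k) (n k)"
        and SZ: "\<And>k. k \<in> modes \<Longrightarrow> lm k (proj_mat (S k)) (Z t) = Z t"
        and Ct: "C t = lms modes (\<lambda>k. proj_mat (S k)) (A t)"
        using split[of t] unfolding tangent_split_def by blast
      note Sc = stiefel_carrier[OF S[OF j]]
      have "lm j (proj_mat (S j)) (Z t + s t *\<^sub>R C t) = Z t + s t *\<^sub>R C t"
        using lm_proj_lms[of j S r] j S by (simp add: lm_add lm_scaleR SZ Ct)
      then show "trank (Z t + s t *\<^sub>R C t) j \<le> r j"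
        unfolding proj_mat_def using Sc by (intro trank_le_if_fixed[OF j Sc]) auto
    next
      have "inverse (s t) *\<^sub>R (Z t + s t *\<^sub>R C t - Z t) = C t" for t using s(1)[of t] by simp
      then show "(\<lambda>t. inverse (s t) *\<^sub>R (Z t + s t *\<^sub>R C t - Z t)) \<longlonglongrightarrow> C0 + (\<Sum>k\<in>{}. E0 k)"
        using C by simp
    qed
  next
    case (insert k K)
    then have k: "k \<in> modes" by simp
    obtain T where T: "\<And>t j. j \<in> modes \<Longrightarrow> trank (T t) j \<le> r j"
      and lim: "(\<lambda>t. inverse (s t) *\<^sub>R (T t - Z t)) \<longlonglongrightarrow> C0 + (\<Sum>k\<in>K. E0 k)"
      using insert.IH insert.prems by blast
    define T' where "T' = (\<lambda>t. T t + s t *\<^sub>R lm k (h k (Z t) (E t k)) (T t))"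
    have "trank (T' t) j \<le> r j" if j: "j \<in> modes" for t j
    proof -
      define R where "R = 1\<^sub>m (n k) - (- s t) \<cdot>\<^sub>m h k (Z t) (E t k)"
      have H: "(- s t) \<cdot>\<^sub>m h k (Z t) (E t k) \<in> carrier_mat (n k) (n k)" using hc[OF k] by simp
      have "lm k ((- s t) \<cdot>\<^sub>m h k (Z t) (E t k)) (T t) = (- s t) *\<^sub>R lm k (h k (Z t) (E t k)) (T t)"
      proof (rule entries_eqI)
        fix i assume i: "i \<in> multi_indices d n"
        show "entries idx (lm k ((- s t) \<cdot>\<^sub>m h k (Z t) (E t k)) (T t)) i
            = entries idx ((- s t) *\<^sub>R lm k (h k (Z t) (E t k)) (T t)) i"
          unfolding entries_scaleR entries_lm[OF i] tprod_def sum_distrib_left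
          using multi_indices_less[OF i k] hc[OF k, of "Z t" "E t k"] by (intro sum.cong) auto
      qed
      then have "T' t = lm k R (T t)"
        unfolding R_def T'_def lm_minus_mat[OF k one_carrier_mat H] lm_one[OF k] by simp
      moreover have "R \<in> carrier_mat (n k) (n k)" unfolding R_def by (rule minus_carrier_mat[OF H])
      ultimately show ?thesis using trank_lm_le[OF k j, of R "T t"] T[OF j, of t] by simp
    qed
    moreover have "(\<lambda>t. inverse (s t) *\<^sub>R (T' t - Z t)) \<longlonglongrightarrow> C0 + (\<Sum>k\<in>insert k K. E0 k)"
    proof -
      have "(\<lambda>t. lm k (h k (Z t) (E t k)) (T t)) \<longlonglongrightarrow> E0 k"
        using left_factor_tendsto[OF h[OF k] ZL E[OF k] tends[OF lim]] E0[OF k] by simp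
      then have "(\<lambda>t. inverse (s t) *\<^sub>R (T t - Z t) + lm k (h k (Z t) (E t k)) (T t))
          \<longlonglongrightarrow> (C0 + (\<Sum>k\<in>K. E0 k)) + E0 k"
        by (intro tendsto_add lim)
      moreover have "inverse (s t) *\<^sub>R (T t - Z t) + lm k (h k (Z t) (E t k)) (T t)
          = inverse (s t) *\<^sub>R (T' t - Z t)" for t
        using s(1)[of t] by (simp add: T'_def algebra_simps)
      ultimately show ?thesis using insert.hyps by (simp add: algebra_simps)
    qed
    ultimately show ?case by blast
  qed
  from this[OF finite_atLeastAtMost subset_refl]
  obtain T where T: "\<And>t j. j \<in> modes \<Longrightarrow> trank (T t) j \<le> r j"
    and lim: "(\<lambda>t. inverse (s t) *\<^sub>R (T t - Z t)) \<longlonglongrightarrow> C0 + (\<Sum>k\<in>modes. E0 k)"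
    by blast
  define V where "V = (\<lambda>t. C t + (\<Sum>k\<in>modes. E t k))"
  have Vlim: "V \<longlonglongrightarrow> C0 + (\<Sum>k\<in>modes. E0 k)"
    unfolding V_def by (intro tendsto_add C tendsto_sum E)
  have "(\<lambda>t. inverse (s t) *\<^sub>R (Y t - T t)) \<longlonglongrightarrow> 0"
  proof (rule Lim_null_comparison)
    show "\<forall>\<^sub>F t in sequentially. norm (inverse (s t) *\<^sub>R (Y t - T t))
        \<le> 2 ^ d * norm (V t - inverse (s t) *\<^sub>R (T t - Z t))"
    proof (rule always_eventually, rule allI)
      fix t
      have "norm (Y t - T t) \<le> 2 ^ d * norm (Z t + s t *\<^sub>R V t - T t)"
        using hosvd_dist[OF Y[of t]] T unfolding V_def by blast
      then have "inverse (s t) * norm (Y t - T t) \<le> inverse (s t) * (2 ^ d * norm (Z t + s t *\<^sub>R V t - T t))"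
        using s(1)[of t] by (intro mult_left_mono) auto
      also have "\<dots> = 2 ^ d * norm (inverse (s t) *\<^sub>R (Z t + s t *\<^sub>R V t - T t))"
        using s(1)[of t] by simp
      also have "inverse (s t) *\<^sub>R (Z t + s t *\<^sub>R V t - T t) = V t - inverse (s t) *\<^sub>R (T t - Z t)"
        using s(1)[of t] by (simp add: algebra_simps)
      finally show "norm (inverse (s t) *\<^sub>R (Y t - T t)) \<le> 2 ^ d * norm (V t - inverse (s t) *\<^sub>R (T t - Z t))"
        using s(1)[of t] by simp
    qed
    have "(\<lambda>t. 2 ^ d * norm (V t - inverse (s t) *\<^sub>R (T t - Z t))) \<longlonglongrightarrow>
        2 ^ d * norm ((C0 + (\<Sum>k\<in>modes. E0 k)) - (C0 + (\<Sum>k\<in>modes. E0 k)))"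
      by (intro tendsto_mult tendsto_const tendsto_norm tendsto_diff Vlim lim)
    then show "(\<lambda>t. 2 ^ d * norm (V t - inverse (s t) *\<^sub>R (T t - Z t))) \<longlonglongrightarrow> 0" by simp
  qed
  from tendsto_add[OF this lim] show ?thesis by (simp add: algebra_simps)
qed

end

text \<open>By the mean value theorem, the difference quotient is the derivative at an intermediate point,
  and these points converge to \<open>L\<close> too.\<close>
lemma difference_quotient_limit:
  fixes f :: "'a::real_inner \<Rightarrow> real" and Z Y :: "nat \<Rightarrow> 'a"
  assumes f: "\<And>x. GDERIV f x :> g x" and g: "continuous_on UNIV g"
    and Z: "Z \<longlonglongrightarrow> L" and s: "\<And>t. 0 < s t" "s \<longlonglongrightarrow> 0"
    and V: "(\<lambda>t. inverse (s t) *\<^sub>R (Y t - Z t)) \<longlonglongrightarrow> V"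
  shows "(\<lambda>t. (f (Y t) - f (Z t)) / s t) \<longlonglongrightarrow> inner (g L) V"
proof -
  have "\<exists>\<theta>\<in>{0..1}. f (Y t) - f (Z t) = inner (Y t - Z t) (g (Z t + \<theta> *\<^sub>R (Y t - Z t)))" for t
  proof -
    define \<phi> where "\<phi> = (\<lambda>\<theta>. f (Z t + \<theta> *\<^sub>R (Y t - Z t)))"
    have "\<exists>\<theta>\<in>{0..1}. \<phi> 1 - \<phi> 0 = (\<lambda>x. x * inner (Y t - Z t) (g (Z t + \<theta> *\<^sub>R (Y t - Z t)))) (1 - 0)"
    proof (rule mvt_very_simple)
      fix \<theta> :: real
      have "((\<lambda>\<theta>. Z t + \<theta> *\<^sub>R (Y t - Z t)) has_derivative (\<lambda>x. x *\<^sub>R (Y t - Z t))) (at \<theta> within {0..1})"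
        by (auto intro!: derivative_eq_intros)
      moreover have "(f has_derivative (\<lambda>x. inner x (g (Z t + \<theta> *\<^sub>R (Y t - Z t)))))
          (at (Z t + \<theta> *\<^sub>R (Y t - Z t)))"
        using f by (simp add: gderiv_def)
      ultimately show "(\<phi> has_derivative (\<lambda>x. x * inner (Y t - Z t) (g (Z t + \<theta> *\<^sub>R (Y t - Z t)))))
          (at \<theta> within {0..1})"
        unfolding \<phi>_def using has_derivative_compose by fastforce
    qed simp
    then show ?thesis by (auto simp: \<phi>_def)
  qed
  then obtain \<theta> where \<theta>: "\<And>t. \<theta> t \<in> {0..1}"
    and mv: "\<And>t. f (Y t) - f (Z t) = inner (Y t - Z t) (g (Z t + \<theta> t *\<^sub>R (Y t - Z t)))" by metis
  have "(\<lambda>t. s t *\<^sub>R (inverse (s t) *\<^sub>R (Y t - Z t))) \<longlonglongrightarrow> 0 *\<^sub>R V"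
    by (intro tendsto_intros s V)
  moreover have "s t *\<^sub>R (inverse (s t) *\<^sub>R (Y t - Z t)) = Y t - Z t" for t using s(1)[of t] by simp
  ultimately have YZ: "(\<lambda>t. Y t - Z t) \<longlonglongrightarrow> 0" by simp
  have "(\<lambda>t. \<theta> t *\<^sub>R (Y t - Z t)) \<longlonglongrightarrow> 0"
  proof (rule Lim_null_comparison)
    show "\<forall>\<^sub>F t in sequentially. norm (\<theta> t *\<^sub>R (Y t - Z t)) \<le> norm (Y t - Z t)"
      using \<theta> by (intro always_eventually allI) (simp add: mult_left_le_one_le)
    show "(\<lambda>t. norm (Y t - Z t)) \<longlonglongrightarrow> 0" using tendsto_norm[OF YZ] by simp
  qed
  from tendsto_add[OF Z this] have "(\<lambda>t. Z t + \<theta> t *\<^sub>R (Y t - Z t)) \<longlonglongrightarrow> L" by simp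
  then have gl: "(\<lambda>t. g (Z t + \<theta> t *\<^sub>R (Y t - Z t))) \<longlonglongrightarrow> g L"
    using g continuous_on_tendsto_compose[OF g] by auto
  have "(f (Y t) - f (Z t)) / s t = inner (inverse (s t) *\<^sub>R (Y t - Z t)) (g (Z t + \<theta> t *\<^sub>R (Y t - Z t)))" for t
    unfolding mv by (simp add: divide_inverse mult.commute)
  then show ?thesis using tendsto_inner[OF V gl] by (simp add: inner_commute)
qed

section \<open>The GRAP-R method\<close>

context tensor_space
begin

lemma armijo_pointE:
  assumes "armijo_point d n idx r f g sbar \<rho> a Z V Y"
  obtains l where "Y \<in> hosvd d n idx r (Z + (\<rho> ^ l * sbar) *\<^sub>R V)"
    "\<rho> ^ l * sbar * a * inner (- g Z) V \<le> f Z - f Y"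
    "l > 0 \<Longrightarrow> \<exists>Y'\<in>hosvd d n idx r (Z + (\<rho> ^ (l - 1) * sbar) *\<^sub>R V).
       f Z - f Y' < \<rho> ^ (l - 1) * sbar * a * inner (- g Z) V"
proof -
  obtain trial l where
    hosvd: "\<And>j. j \<le> l \<Longrightarrow> trial j \<in> hosvd d n idx r (Z + (\<rho> ^ j * sbar) *\<^sub>R V)"
    and dec: "f Z - f (trial l) \<ge> \<rho> ^ l * sbar * a * inner (- g Z) V"
    and before: "\<And>j. j < l \<Longrightarrow> \<not> f Z - f (trial j) \<ge> \<rho> ^ j * sbar * a * inner (- g Z) V"
    and Y: "Y = trial l"
    using assms unfolding armijo_point_def Let_def by blast
  show thesis
  proof (rule that[of l])
    show "Y \<in> hosvd d n idx r (Z + (\<rho> ^ l * sbar) *\<^sub>R V)" using hosvd[of l] Y by simp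
    show "\<rho> ^ l * sbar * a * inner (- g Z) V \<le> f Z - f Y" using dec Y by simp
    assume "l > 0"
    then show "\<exists>Y'\<in>hosvd d n idx r (Z + (\<rho> ^ (l - 1) * sbar) *\<^sub>R V).
       f Z - f Y' < \<rho> ^ (l - 1) * sbar * a * inner (- g Z) V"
      using hosvd[of "l - 1"] before[of "l - 1"] by (intro bexI[of _ "trial (l - 1)"]) auto
  qed
qed

text \<open>The truncation of \<open>X\<close> competes with \<open>X\<close> itself, which lies at distance zero.\<close>
lemma hosvd_self:
  assumes "Z \<in> hosvd d n idx q X" "\<And>j. j \<in> modes \<Longrightarrow> trank X j \<le> q j"
  shows "Z = X"
  using hosvd_dist[OF assms] by simp

lemma candidate_ranksI:
  assumes "norm (X - L) \<le> \<Delta>" "\<And>k. k \<in> modes \<Longrightarrow> trank L k \<le> trank X k"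
  shows "restrict (trank L) modes \<in> candidate_ranks d n idx \<Delta> X"
  unfolding candidate_ranks_def using assms(2) rank_Delta_le_trank[OF _ assms(1)]
  by (intro restrict_PiE_iff[THEN iffD2]) auto

text \<open>The full Tucker rank of \<open>X\<close> is among the candidates, and its truncation is \<open>X\<close> itself.\<close>
lemma grap_r_step_descent:
  assumes X: "X \<in> tucker_variety d n idx r" and step: "grap_r_step d n idx r f g \<Delta> sbar \<rho> a X X'"
    and pos: "0 < \<Delta>" "0 < sbar" "0 < \<rho>" "0 < a"
  shows "X' \<in> tucker_variety d n idx r \<and> f X' \<le> f X"
proof -
  obtain Z V Y where ZVY: "\<And>q. q \<in> candidate_ranks d n idx \<Delta> X \<Longrightarrow>
      Z q \<in> hosvd d n idx q X \<and> V q \<in> approx_proj d n idx r (Z q) (- g (Z q)) \<and>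
      armijo_point d n idx r f g sbar \<rho> a (Z q) (V q) (Y q)"
    and X': "\<exists>q \<in> candidate_ranks d n idx \<Delta> X. X' = Y q"
    and le: "\<And>q. q \<in> candidate_ranks d n idx \<Delta> X \<Longrightarrow> f X' \<le> f (Y q)"
    using step unfolding grap_r_step_def by blast
  define q where "q = restrict (trank X) modes"
  have q: "q \<in> candidate_ranks d n idx \<Delta> X"
    unfolding q_def using pos by (intro candidate_ranksI) auto
  have Zq: "Z q = X" using ZVY[OF q] by (intro hosvd_self[of _ q]) (auto simp: q_def)
  obtain l where l: "\<rho> ^ l * sbar * a * inner (- g X) (V q) \<le> f X - f (Y q)"
  proof -
    have "armijo_point d n idx r f g sbar \<rho> a X (V q) (Y q)" using ZVY[OF q] Zq by simp
    then show thesis by (rule armijo_pointE) (rule that)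
  qed
  obtain C E where VCE: "V q = C + (\<Sum>k\<in>modes. E k)" and split: "tangent_split r X (- g X) C E"
    using approx_proj_tangent_split[OF X, of "V q" "- g X"] ZVY[OF q] Zq by auto
  have "0 \<le> inner (- g X) (V q)"
    unfolding VCE tangent_split_inner[OF split] by (intro add_nonneg_nonneg sum_nonneg) auto
  then have "0 \<le> \<rho> ^ l * sbar * a * inner (- g X) (V q)"
    using pos by (intro mult_nonneg_nonneg zero_le_power) auto
  then have "f X' \<le> f X" using l le[OF q] by linarith
  moreover from X' obtain q' where "q' \<in> candidate_ranks d n idx \<Delta> X" "X' = Y q'" by blast
  then have "armijo_point d n idx r f g sbar \<rho> a (Z q') (V q') X'" using ZVY[of q'] by simp
  then have "X' \<in> tucker_variety d n idx r" by (rule armijo_pointE) (rule hosvd_in_variety)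
  ultimately show ?thesis by blast
qed

text \<open>The case of a constant sequence in the limit argument.\<close>
lemma grap_r_stop_stationary:
  assumes r: "\<And>k. k \<in> modes \<Longrightarrow> r k \<ge> 1 \<and> r k \<le> min (n k) (codim d n k)"
    and X: "X \<in> tucker_variety d n idx r" and stop: "grap_r_stop d n idx r g X"
  shows "stationary d n idx r g X"
proof -
  obtain V where "V \<in> approx_proj d n idx r X (- g X)" "V = 0"
    using stop unfolding grap_r_stop_def by auto
  then obtain C E where CE: "C + (\<Sum>k\<in>modes. E k) = 0" and split: "tangent_split r X (- g X) C E"
    using approx_proj_tangent_split[OF X, of V "- g X"] by auto
  have nn: "0 \<le> (\<Sum>k\<in>modes. (norm (E k))\<^sup>2)" by (intro sum_nonneg) auto
  have zero: "(norm C)\<^sup>2 + (\<Sum>k\<in>modes. (norm (E k))\<^sup>2) = 0"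
    using tangent_split_inner[OF split] unfolding CE by simp
  then have C: "C = 0"
    using nn zero_le_power2[of "norm C"] by (metis add_nonneg_eq_0_iff norm_eq_zero power2_eq_iff_nonneg
        power_zero_numeral norm_ge_zero order_refl)
  then have "(\<Sum>k\<in>modes. (norm (E k))\<^sup>2) = 0" using zero by simp
  then have E: "E k = 0" if "k \<in> modes" for k
    using that by (subst (asm) sum_nonneg_eq_0_iff) auto
  show ?thesis
  proof (rule stationaryI[OF X])
    fix v assume v: "v \<in> tangent_cone (tucker_variety d n idx r) X"
    have "inner (- g X) v = 0"
      using vanishing_split_imp_orthogonal_to_tangent_cone[OF r, of "\<lambda>_. X" X "\<lambda>_. - g X" "- g X"
          "\<lambda>_. C" "\<lambda>_. E" v] split C E v by simp
    then show "inner (- g X) v \<le> 0" by simp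
  qed
qed

text \<open>Near the limit \<open>L\<close> the Tucker rank of \<open>L\<close> is a candidate, and truncating to it gives points
  \<open>Z j\<close> that still converge to \<open>L\<close> but now have the Tucker rank of \<open>L\<close>, so the approximate
  projections behave continuously along them. The values at their Armijo points are at least
  \<open>f L\<close>. On a subsequence with convergent step sizes, a positive limit of these makes the
  sufficient decrease force the approximate projections to zero. If the limit is zero, then the
  rejected steps before the accepted ones tend to zero as well, and that they were rejected
  contradicts the first-order behaviour of \<open>f\<close> unless the approximate projections tend to zero.\<close>
lemma grap_r_limit_stationary:
  assumes r: "\<And>k. k \<in> modes \<Longrightarrow> r k \<ge> 1 \<and> r k \<le> min (n k) (codim d n k)"
    and f: "\<And>x. GDERIV f x :> g x" and g: "continuous_on UNIV g"
    and par: "0 < \<Delta>" "0 < sbar" "0 < \<rho>" "\<rho> < 1" "0 < a" "a < 1"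
    and L: "L \<in> tucker_variety d n idx r" and XL: "X \<longlonglongrightarrow> L"
    and step: "\<And>j. grap_r_step d n idx r f g \<Delta> sbar \<rho> a (X j) (X' j)"
    and above: "\<And>j. f L \<le> f (X' j)"
  shows "stationary d n idx r g L"
proof -
  have contf: "(\<lambda>j. f (x j)) \<longlonglongrightarrow> f y" if "x \<longlonglongrightarrow> y" for x :: "nat \<Rightarrow> real ^ 'm" and y
  proof -
    have "isCont f y" using f[of y] unfolding gderiv_def by (rule has_derivative_continuous)
    then show ?thesis using that by (rule isCont_tendsto_compose)
  qed
  have contg: "(\<lambda>j. g (x j)) \<longlonglongrightarrow> g y" if "x \<longlonglongrightarrow> y" for x :: "nat \<Rightarrow> real ^ 'm" and y
    using continuous_on_tendsto_compose[OF g that] by simp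

  define q where "q = restrict (trank L) modes"
  have "\<forall>\<^sub>F j in sequentially. norm (X j - L) < \<Delta>"
    using XL par(1) by (simp add: tendsto_iff dist_norm)
  moreover have "\<forall>\<^sub>F j in sequentially. \<forall>k\<in>modes. trank L k \<le> trank (X j) k"
    using trank_lower_semicontinuous[OF _ XL] by (intro eventually_ball_finite) auto
  ultimately have "\<forall>\<^sub>F j in sequentially. q \<in> candidate_ranks d n idx \<Delta> (X j)"
    unfolding q_def
  proof eventually_elim
    case (elim j)
    then show ?case by (intro candidate_ranksI) (auto intro: less_imp_le)
  qed
  then obtain j0 where j0: "\<And>j. q \<in> candidate_ranks d n idx \<Delta> (X (j + j0))"
    unfolding eventually_sequentially by (meson le_add2)
  have "\<exists>Z V Y. Z \<in> hosvd d n idx q (X (j + j0)) \<and> V \<in> approx_proj d n idx r Z (- g Z) \<and>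
      armijo_point d n idx r f g sbar \<rho> a Z V Y \<and> f (X' (j + j0)) \<le> f Y" for j
    using step[of "j + j0"] j0[of j] unfolding grap_r_step_def by blast
  then obtain Z0 V0 Y0 where Z0: "\<And>j. Z0 j \<in> hosvd d n idx q (X (j + j0))"
    and V0: "\<And>j. V0 j \<in> approx_proj d n idx r (Z0 j) (- g (Z0 j))"
    and Y0: "\<And>j. armijo_point d n idx r f g sbar \<rho> a (Z0 j) (V0 j) (Y0 j)"
    and X'Y: "\<And>j. f (X' (j + j0)) \<le> f (Y0 j)"
    by metis
  have Z0L: "Z0 \<longlonglongrightarrow> L"
  proof (rule LIM_zero_cancel, rule Lim_null_comparison)
    show "\<forall>\<^sub>F j in sequentially. norm (Z0 j - L) \<le> 2 ^ d * norm (X (j + j0) - L)"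
      using hosvd_dist[OF Z0, of L] by (intro always_eventually allI) (auto simp: q_def)
    have "(\<lambda>j. X (j + j0) - L) \<longlonglongrightarrow> 0" by (rule LIM_zero[OF LIMSEQ_ignore_initial_segment[OF XL]])
    from tendsto_mult[OF tendsto_const tendsto_norm[OF this], of "2 ^ d"]
    show "(\<lambda>j. 2 ^ d * norm (X (j + j0) - L)) \<longlonglongrightarrow> 0" by simp
  qed
  have Z0le: "trank (Z0 j) k \<le> trank L k" if "k \<in> modes" for j k
    using hosvd_trank_le[OF Z0 that, of j] that by (simp add: q_def)
  have "\<forall>\<^sub>F j in sequentially. \<forall>k\<in>modes. trank L k \<le> trank (Z0 j) k"
    using trank_lower_semicontinuous[OF _ Z0L] by (intro eventually_ball_finite) auto
  then obtain j1 where "\<And>j k. k \<in> modes \<Longrightarrow> trank L k \<le> trank (Z0 (j + j1)) k"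
    unfolding eventually_sequentially by (meson le_add2)
  then have rank1: "trank (Z0 (j + j1)) k = trank L k" if "k \<in> modes" for j k
    using Z0le[OF that, of "j + j1"] that by (intro antisym) auto
  have Zvar: "Z0 (j + j1) \<in> tucker_variety d n idx r" for j
    using L rank1 by (simp add: tucker_variety_def)
  have "\<exists>C E. V0 (j + j1) = C + (\<Sum>k\<in>modes. E k) \<and> tangent_split r (Z0 (j + j1)) (- g (Z0 (j + j1))) C E" for j
    by (rule approx_proj_tangent_split[OF Zvar V0])
  then obtain C1 E1 where V1: "\<And>j. V0 (j + j1) = C1 j + (\<Sum>k\<in>modes. E1 j k)"
    and split1: "\<And>j. tangent_split r (Z0 (j + j1)) (- g (Z0 (j + j1))) (C1 j) (E1 j)"
    by metis
  have "\<exists>l. Y0 j \<in> hosvd d n idx r (Z0 j + (\<rho> ^ l * sbar) *\<^sub>R V0 j) \<and>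
    \<rho> ^ l * sbar * a * inner (- g (Z0 j)) (V0 j) \<le> f (Z0 j) - f (Y0 j) \<and>
    (l > 0 \<longrightarrow> (\<exists>Y'\<in>hosvd d n idx r (Z0 j + (\<rho> ^ (l - 1) * sbar) *\<^sub>R V0 j).
       f (Z0 j) - f Y' < \<rho> ^ (l - 1) * sbar * a * inner (- g (Z0 j)) (V0 j)))" for j
    by (rule armijo_pointE[OF Y0[of j]]) blast
  then obtain l0 where dec0: "\<And>j. \<rho> ^ l0 j * sbar * a * inner (- g (Z0 j)) (V0 j) \<le> f (Z0 j) - f (Y0 j)"
    and rej0: "\<And>j. l0 j > 0 \<Longrightarrow> \<exists>Y'\<in>hosvd d n idx r (Z0 j + (\<rho> ^ (l0 j - 1) * sbar) *\<^sub>R V0 j).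
       f (Z0 j) - f Y' < \<rho> ^ (l0 j - 1) * sbar * a * inner (- g (Z0 j)) (V0 j)"
    by metis

  \<comment> \<open>pass to a subsequence on which the parts of the approximate projection and the step
    sizes converge\<close>
  have "(\<lambda>j. - g (Z0 (j + j1))) \<longlonglongrightarrow> - g L"
    by (intro tendsto_minus contg LIMSEQ_ignore_initial_segment Z0L)
  then have "bounded (range (\<lambda>j. - g (Z0 (j + j1))))" by (rule convergent_imp_bounded)
  then obtain b where b: "\<And>j. norm (- g (Z0 (j + j1))) \<le> b" unfolding bounded_iff by blast
  have "norm (if k = 0 then C1 j else E1 j k) \<le> b" if "k \<in> {0..d}" for k j
    using order_trans[OF tangent_split_norm_le(1)[OF split1] b]
      order_trans[OF tangent_split_norm_le(2)[OF split1] b] that by simp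
  then have "bounded (range (\<lambda>j. if k = 0 then C1 j else E1 j k))" if "k \<in> {0..d}" for k
    using that by (intro boundedI[of _ b]) blast
  then obtain \<phi> l where \<phi>: "strict_mono \<phi>"
    and lim1: "\<forall>k\<in>{0..d}. (\<lambda>j. if k = 0 then C1 (\<phi> j) else E1 (\<phi> j) k) \<longlonglongrightarrow> l k"
    using finite_family_convergent_subsequence[of "{0..d}" "\<lambda>k j. if k = 0 then C1 j else E1 j k"]
    by auto
  have s_bound: "0 < \<rho> ^ i * sbar" "\<rho> ^ i * sbar \<le> sbar" for i
    using par by (auto simp: power_le_one mult_left_le_one_le)
  have "bounded (range (\<lambda>j. \<rho> ^ l0 (\<phi> j + j1) * sbar))"
    using s_bound less_imp_le[OF s_bound(1)] by (intro boundedI[of _ sbar]) auto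
  then obtain \<psi> s0 where \<psi>: "strict_mono \<psi>" and s0: "(\<lambda>j. \<rho> ^ l0 (\<phi> (\<psi> j) + j1) * sbar) \<longlonglongrightarrow> s0"
    using bounded_imp_convergent_subsequence[of "\<lambda>j. \<rho> ^ l0 (\<phi> j + j1) * sbar"] by (auto simp: o_def)
  define \<theta> where "\<theta> = (\<lambda>j. \<phi> (\<psi> j) + j1)"
  have \<theta>: "strict_mono \<theta>" using \<phi> \<psi> by (simp add: \<theta>_def strict_mono_def)
  define Z V Y C E s where "Z = (\<lambda>j. Z0 (\<theta> j))" and "V = (\<lambda>j. V0 (\<theta> j))" and "Y = (\<lambda>j. Y0 (\<theta> j))"
    and "C = (\<lambda>j. C1 (\<phi> (\<psi> j)))" and "E = (\<lambda>j. E1 (\<phi> (\<psi> j)))" and "s = (\<lambda>j. \<rho> ^ l0 (\<theta> j) * sbar)"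
  define A where "A = (\<lambda>j. - g (Z j))"
  have rank: "trank (Z j) k = trank L k" if "k \<in> modes" for j k
    unfolding Z_def \<theta>_def by (rule rank1[OF that])
  have split: "tangent_split r (Z j) (A j) (C j) (E j)" for j
    unfolding Z_def \<theta>_def A_def C_def E_def by (rule split1)
  have VCE: "V j = C j + (\<Sum>k\<in>modes. E j k)" for j
    unfolding V_def \<theta>_def C_def E_def by (rule V1)
  have ZL: "Z \<longlonglongrightarrow> L" unfolding Z_def using LIMSEQ_subseq_LIMSEQ[OF Z0L \<theta>] by (simp add: o_def)
  have AL: "A \<longlonglongrightarrow> - g L" unfolding A_def by (intro tendsto_minus contg ZL)
  have CL: "C \<longlonglongrightarrow> l 0"
    unfolding C_def using LIMSEQ_subseq_LIMSEQ[OF lim1[rule_format, of 0] \<psi>] by (simp add: o_def)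
  have EL: "(\<lambda>j. E j k) \<longlonglongrightarrow> l k" if "k \<in> modes" for k
    unfolding E_def using LIMSEQ_subseq_LIMSEQ[OF lim1[rule_format, of k] \<psi>] that by (simp add: o_def)
  have VL: "V \<longlonglongrightarrow> l 0 + (\<Sum>k\<in>modes. l k)"
    unfolding VCE by (intro tendsto_add CL tendsto_sum EL)
  have sL: "s \<longlonglongrightarrow> s0" using s0 by (simp add: s_def \<theta>_def)
  have fYL: "f L \<le> f (Y j)" for j
    unfolding Y_def using above X'Y order_trans by blast
  define p where "p = (norm (l 0))\<^sup>2 + (\<Sum>k\<in>modes. (norm (l k))\<^sup>2)"
  have AVp: "(\<lambda>j. inner (A j) (V j)) \<longlonglongrightarrow> p"
    unfolding VCE tangent_split_inner[OF split] p_def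
    by (intro tendsto_add tendsto_power tendsto_norm CL tendsto_sum EL)
  have gp: "inner (g L) (l 0 + (\<Sum>k\<in>modes. l k)) = - p"
    using LIMSEQ_unique[OF tendsto_inner[OF AL VL] AVp] by simp

  \<comment> \<open>\<open>p\<close> is the limit of the squared lengths of the approximate projections\<close>
  have "p \<le> 0"
  proof (cases "s0 = 0")
    case False
    have "0 \<le> s0" using sL by (rule LIMSEQ_le_const) (use less_imp_le[OF s_bound(1)] in \<open>auto simp: s_def\<close>)
    then have "0 < s0" using False by simp
    have "(\<lambda>j. f (Z j) - f L) \<longlonglongrightarrow> f L - f L" by (intro tendsto_diff contf ZL tendsto_const)
    moreover have "(\<lambda>j. s j * a * inner (A j) (V j)) \<longlonglongrightarrow> s0 * a * p"
      by (intro tendsto_mult sL AVp tendsto_const)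
    moreover have "s j * a * inner (A j) (V j) \<le> f (Z j) - f L" for j
      using dec0[of "\<theta> j"] fYL[of j] by (simp add: s_def A_def Z_def V_def Y_def)
    ultimately have "s0 * a * p \<le> f L - f L" by (intro LIMSEQ_le) auto
    then show ?thesis using \<open>0 < s0\<close> par by (simp add: mult_le_0_iff)
  next
    case True
    have "\<forall>\<^sub>F j in sequentially. s j < sbar"
      using order_tendstoD(2)[OF sL[unfolded True] par(2)] .
    then obtain j2 where j2: "\<And>j. s (j + j2) < sbar"
      unfolding eventually_sequentially by (meson le_add2)
    have lpos: "l0 (\<theta> (j + j2)) > 0" for j
      using j2[of j] by (cases "l0 (\<theta> (j + j2)) = 0") (auto simp: s_def)
    \<comment> \<open>the last rejected step sizes\<close>
    define s' where "s' = (\<lambda>j. \<rho> ^ (l0 (\<theta> (j + j2)) - 1) * sbar)"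
    have s': "s' j = s (j + j2) / \<rho>" for j
      using lpos[of j] par(3) by (simp add: s'_def s_def power_diff)
    have s'pos: "0 < s' j" for j unfolding s'_def by (rule s_bound)
    have s'0: "s' \<longlonglongrightarrow> 0"
      unfolding s' using tendsto_divide[OF LIMSEQ_ignore_initial_segment[OF sL, of j2] tendsto_const[of \<rho>]]
        True par by simp
    have "\<exists>Y'. Y' \<in> hosvd d n idx r (Z (j + j2) + s' j *\<^sub>R V (j + j2)) \<and>
        f (Z (j + j2)) - f Y' < s' j * a * inner (A (j + j2)) (V (j + j2))" for j
      using rej0[OF lpos[of j]] unfolding s'_def Z_def V_def A_def by blast
    then obtain Y' where Y': "\<And>j. Y' j \<in> hosvd d n idx r (Z (j + j2) + s' j *\<^sub>R V (j + j2))"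
      and rej: "\<And>j. f (Z (j + j2)) - f (Y' j) < s' j * a * inner (A (j + j2)) (V (j + j2))"
      by metis
    have "(\<lambda>j. inverse (s' j) *\<^sub>R (Y' j - Z (j + j2))) \<longlonglongrightarrow> l 0 + (\<Sum>k\<in>modes. l k)"
    proof (rule hosvd_retraction_limit[where L = L and r = r and C = "\<lambda>j. C (j + j2)"
          and E = "\<lambda>j. E (j + j2)" and A = "\<lambda>j. A (j + j2)"])
      show "(\<lambda>j. E (j + j2) k) \<longlonglongrightarrow> l k" if "k \<in> modes" for k
        by (rule LIMSEQ_ignore_initial_segment[OF EL[OF that]])
      show "Y' j \<in> hosvd d n idx r (Z (j + j2) + s' j *\<^sub>R (C (j + j2) + (\<Sum>k\<in>modes. E (j + j2) k)))" for j
        using Y'[of j] by (simp add: VCE)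
    qed (use L rank split s'pos s'0 LIMSEQ_ignore_initial_segment[OF ZL]
        LIMSEQ_ignore_initial_segment[OF CL] in auto)
    then have "(\<lambda>j. (f (Y' j) - f (Z (j + j2))) / s' j) \<longlonglongrightarrow> inner (g L) (l 0 + (\<Sum>k\<in>modes. l k))"
      by (rule difference_quotient_limit[OF f g LIMSEQ_ignore_initial_segment[OF ZL] s'pos s'0])
    then have "(\<lambda>j. (f (Y' j) - f (Z (j + j2))) / s' j) \<longlonglongrightarrow> - p" unfolding gp .
    moreover have "(\<lambda>j. - a * inner (A (j + j2)) (V (j + j2))) \<longlonglongrightarrow> - a * p"
      by (intro tendsto_mult tendsto_const LIMSEQ_ignore_initial_segment[OF AVp])
    moreover have "- a * inner (A (j + j2)) (V (j + j2)) \<le> (f (Y' j) - f (Z (j + j2))) / s' j" for j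
      using rej[of j] s'pos[of j] by (simp add: pos_le_divide_eq algebra_simps)
    ultimately have "- a * p \<le> - p" by (intro LIMSEQ_le) auto
    then have "(1 - a) * p \<le> 0" by (simp add: algebra_simps)
    then show ?thesis using par by (simp add: mult_le_0_iff)
  qed
  moreover have "0 \<le> (\<Sum>k\<in>modes. (norm (l k))\<^sup>2)" by (intro sum_nonneg) auto
  moreover have "0 \<le> (norm (l 0))\<^sup>2" by simp
  ultimately have l0: "(norm (l 0))\<^sup>2 \<le> 0" and lsum: "(\<Sum>k\<in>modes. (norm (l k))\<^sup>2) \<le> 0"
    unfolding p_def by linarith+
  have C0: "C \<longlonglongrightarrow> 0" using CL l0 by simp
  have E0: "(\<lambda>j. E j k) \<longlonglongrightarrow> 0" if k: "k \<in> modes" for k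
  proof -
    have "(norm (l k))\<^sup>2 \<le> (\<Sum>k\<in>modes. (norm (l k))\<^sup>2)" using k by (intro member_le_sum) auto
    then show ?thesis using EL[OF k] lsum by (metis norm_eq_zero order_trans power2_less_eq_zero_iff)
  qed
  show ?thesis
  proof (rule stationaryI[OF L])
    fix v assume "v \<in> tangent_cone (tucker_variety d n idx r) L"
    then have "inner (- g L) v = 0"
      using vanishing_split_imp_orthogonal_to_tangent_cone[OF r ZL rank AL split C0 E0] by blast
    then show "inner (- g L) v \<le> 0" by simp
  qed
qed

end

theorem theorem4p5:
  fixes d :: nat and n r :: "nat \<Rightarrow> nat" and idx :: "'m::finite \<Rightarrow> (nat \<Rightarrow> nat)"
    and f :: "real ^ 'm \<Rightarrow> real" and g :: "real ^ 'm \<Rightarrow> real ^ 'm"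
    and fstar \<Delta> sbar \<rho> a :: real
    and X :: "nat \<Rightarrow> real ^ 'm" and T :: enat
  assumes "d \<ge> 1" and "\<forall>k\<in>{1..d}. n k \<ge> 1"
    and "\<forall>k\<in>{1..d}. 1 \<le> r k \<and> r k \<le> min (n k) (codim d n k)"
    and "tensor_index d n idx"
    and gradient: "\<forall>A. GDERIV f A :> g A"
    and "continuous_on UNIV g" and "locally_Lipschitz g"
    and "\<forall>A \<in> tucker_variety d n idx r. fstar \<le> f A"
    and "compact {A \<in> tucker_variety d n idx r. f A \<le> f (X 0)}"
    and "\<Delta> > 0" and "sbar > 0" and "0 < \<rho>" "\<rho> < 1" and "0 < a" "a < 1"
    and "X 0 \<in> tucker_variety d n idx r"
    and "grap_r_sequence d n idx r f g \<Delta> sbar \<rho> a X T"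
  shows "(\<forall>N. T = enat N \<longrightarrow> stationary d n idx r g (X N)) \<and>
         (T = \<infinity> \<longrightarrow>
            (\<exists>L. accumulation_point X L) \<and>
            (\<forall>L. accumulation_point X L \<longrightarrow> stationary d n idx r g L))"
proof -
  interpret tensor_space d n idx using assms(4) by (rule tensor_space.intro)
  let ?M = "{A \<in> tucker_variety d n idx r. f A \<le> f (X 0)}"
  have r: "\<And>k. k \<in> {1..d} \<Longrightarrow> r k \<ge> 1 \<and> r k \<le> min (n k) (codim d n k)" using assms(3) by blast
  have step: "grap_r_step d n idx r f g \<Delta> sbar \<rho> a (X t) (X (Suc t))" if "enat t < T" for t
    using assms(17) that by (simp add: grap_r_sequence_def)
  have inM: "X t \<in> ?M" if "enat t \<le> T" for t
    using that
  proof (induction t)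
    case (Suc t)
    then have t: "enat t < T" by (simp add: Suc_ile_eq)
    then have "X t \<in> ?M" using Suc.IH by (simp add: less_imp_le)
    then show ?case
      using grap_r_step_descent[OF _ step[OF t] assms(10,11,12,14)] by fastforce
  qed (use assms(16) in auto)
  show ?thesis
  proof (intro conjI allI impI)
    fix N assume T: "T = enat N"
    then have "grap_r_stop d n idx r g (X N)" using assms(17) by (simp add: grap_r_sequence_def)
    then show "stationary d n idx r g (X N)"
      using inM[of N] T by (intro grap_r_stop_stationary[OF r]) auto
  next
    assume "T = \<infinity>"
    then have "\<forall>t. X t \<in> ?M" using inM by simp
    then obtain L \<phi> where "strict_mono \<phi>" "(X \<circ> \<phi>) \<longlonglongrightarrow> L"
      using assms(9) unfolding compact_eq_seq_compact_metric seq_compact_def by meson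
    then show "\<exists>L. accumulation_point X L" unfolding accumulation_point_def by blast
  next
    fix L assume T: "T = \<infinity>" and "accumulation_point X L"
    then obtain \<phi> where \<phi>: "strict_mono \<phi>" and lim: "(X \<circ> \<phi>) \<longlonglongrightarrow> L"
      unfolding accumulation_point_def by blast
    have M: "X t \<in> ?M" for t using inM T by simp
    have "L \<in> ?M"
      by (rule closed_sequentially[OF compact_imp_closed[OF assms(9)] _ lim]) (unfold o_def, rule M)
    have desc: "f (X (Suc t)) \<le> f (X t)" for t
    proof -
      have "X t \<in> tucker_variety d n idx r" "enat t < T" using M[of t] T by auto
      then show ?thesis using grap_r_step_descent[OF _ step assms(10,11,12,14)] by blast
    qed
    have "isCont f L" using gradient unfolding gderiv_def by (blast intro: has_derivative_continuous)
    then have flim: "(\<lambda>j. f (X (\<phi> j))) \<longlonglongrightarrow> f L"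
      using isCont_tendsto_compose[OF _ lim] by (simp add: o_def)
    have above: "f L \<le> f (X t)" for t
    proof (rule LIMSEQ_le_const2[OF flim], intro exI[of _ t] allI impI)
      fix j assume "t \<le> j"
      then have "t \<le> \<phi> j" using seq_suble[OF \<phi>] order_trans by blast
      then show "f (X (\<phi> j)) \<le> f (X t)" by (rule lift_Suc_antimono_le[of "\<lambda>t. f (X t)", OF desc])
    qed
    show "stationary d n idx r g L"
    proof (rule grap_r_limit_stationary[OF r _ assms(6) assms(10-15) _ lim])
      show "grap_r_step d n idx r f g \<Delta> sbar \<rho> a ((X \<circ> \<phi>) j) (X (Suc (\<phi> j)))" for j
        using step[of "\<phi> j"] T by simp
    qed (use gradient \<open>L \<in> ?M\<close> above in auto)
  qed
qed

end
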